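(* Let $k$ be a field of characteristic zero, $\boldsymbol{w}\in k[[x_1,\ldots,x_n]]$ an isolated singularity, and $t=(t_1,\ldots,t_n)\in(k^* )^n$ a diagonal symmetry of $\boldsymbol{w}$, with coordinates numbered so that $t_i\neq 1$ for $i\le\ell$ and $t_{\ell+1}=\ldots=t_n=1$. Let $\bar{E}=(E,\delta_E)$ be a matrix factorization of $\boldsymbol{w}$ with a trivialization $E\simeq U\otimes R$. Under the isomorphism $\mathrm{Tr}(t^* )\simeq H(\boldsymbol{w}_t)$, the generalized boundary-bulk map $\tau^{\bar{E}}_{t^*}:\mathrm{Hom}(\bar{E},t^*\bar{E})\to\mathrm{Tr}(t^* )\simeq H(\boldsymbol{w}_t)$ is given by $$\tau^{\bar{E}}_{t^*}(\alpha)=\mathrm{str}\Bigl(\bigl[\partial_n\delta_E\circ\ldots\circ\partial_{\ell+1}\delta_E\circ\alpha\bigr]\big|_{x_1=\ldots=x_\ell=0}\Bigr)\cdot dx_{\ell+1}\wedge\ldots\wedge dx_n\ \bmod\ (\partial_{\ell+1}\boldsymbol{w}_t,\ldots,\partial_n\boldsymbol{w}_t).$$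
   Context: $R=k[[x_1,\ldots,x_n]]$ with maximal ideal $\mathfrak m$; "isolated singularity" means $\boldsymbol{w}\in\mathfrak m$ and $R/(\partial_1\boldsymbol{w},\ldots,\partial_n\boldsymbol{w})$ is finite-dimensional; "diagonal symmetry" means $\boldsymbol{w}(t_1x_1,\ldots,t_nx_n)=\boldsymbol{w}(x_1,\ldots,x_n)$. A matrix factorization $\bar{E}=(E,\delta_E)$ of $\boldsymbol{w}$ is a $\mathbb{Z}/2$-graded finitely generated free $R$-module $E$ with an odd endomorphism $\delta_E$, $\delta_E^2=\boldsymbol{w}\cdot\mathrm{id}$; $\mathrm{MF}(\boldsymbol{w})$ is the $\mathbb{Z}/2$-dg-category with morphism complexes $\mathrm{Hom}_R(E_1,E_2)$ and differential induced by $\delta_{E_1},\delta_{E_2}$, and $\mathrm{Hom}(\bar{E}_1,\bar{E}_2)$ denotes the cohomology. $t^*$ is the autoequivalence induced by $f\mapsto f\circ t$, $t:(x_i)\mapsto(t_ix_i)$. With $E\simeq U\otimes R$, $U$ a $\mathbb{Z}/2$-graded vector space, $\delta_E$ is viewed as an element of $\mathrm{End}(U)\otimes R$, $\partial_i\delta_E$ is the entrywise partial derivative, and the complex of morphisms $\bar{E}\to t^*\bar{E}$ is identified with $\mathrm{End}(U)\otimes R$ with the differential induced by $\delta_E$; $\alpha$ is represented by a closed element. $\mathrm{str}$ is the supertrace on $U$. $\boldsymbol{w}_t(x_{\ell+1},\ldots,x_n)=\boldsymbol{w}|_{x_1=\ldots=x_\ell=0}$ (again an isolated singularity), and for an isolated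 singularity $\boldsymbol{v}$ in variables $z_1,\ldots,z_m$ one sets $H(\boldsymbol{v})=\bigl(k[[z_1,\ldots,z_m]]/(\partial_1\boldsymbol{v},\ldots,\partial_m\boldsymbol{v})\bigr)\otimes dz_1\wedge\ldots\wedge dz_m[m]$, a $\mathbb{Z}/2$-graded space. Kernels for functors $\mathrm{MF}(\boldsymbol{w})\to\mathrm{MF}(\boldsymbol{w})$ are matrix factorizations of $\widetilde{\boldsymbol{w}}=\boldsymbol{w}(y)-\boldsymbol{w}(x)$ over $R^e=k[[x_1,\ldots,x_n,y_1,\ldots,y_n]]$. The diagonal kernel is the Koszul matrix factorization $\Delta^{st}=R^e\otimes\bigwedge^\bullet(V)$, $V=\bigoplus_{i=1}^n k e_i$, with differential: wedge product with $\sum_i\Delta_i\boldsymbol{w}\cdot e_i$ plus contraction with $\sum_i(y_i-x_i)e_i^*$, where $\Delta_i\boldsymbol{w}=\frac{\boldsymbol{w}(x_1,\ldots,x_{i-1},y_i,\ldots,y_n)-\boldsymbol{w}(x_1,\ldots,x_i,y_{i+1},\ldots,y_n)}{y_i-x_i}$, so $\widetilde{\boldsymbol{w}}=\sum_i\Delta_i\boldsymbol{w}\cdot(y_i-x_i)$. The trace functor $\mathrm{Tr}$ is restriction to the diagonal $y=x$ (followed by cohomology). The kernel of $t^*$ is $(\mathrm{id}\times t)^*\Delta^{st}$, so $\mathrm{Tr}(t^* )=H^*(\Delta^{st}|_{\Gamma_t})$, with $\Gamma_t=\{y_i=t_ix_i\}$. The isomorphism $\mathrm{Tr}(t^* )\simeq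 H(\boldsymbol{w}_t)$ is induced by restricting to $x=y$, $x_1=\ldots=x_\ell=0$ and projecting the term $\bigwedge^{n-\ell}(V)$ to the coefficient of $e_{\ell+1}\wedge\ldots\wedge e_n$ (with $e_i$ corresponding to $dx_i$), modulo $(\partial_{\ell+1}\boldsymbol{w}_t,\ldots,\partial_n\boldsymbol{w}_t)$. Boundary-bulk map. $c^{\bar{E}}:\bar{E}^*\boxtimes\bar{E}\to\Delta^{st}$ is the canonical morphism in the homotopy category of $\mathrm{MF}(\widetilde{\boldsymbol{w}})$ ($\bar{E}^*$ the dual matrix factorization of $-\boldsymbol{w}(x)$, $\bar{E}$ taken in the variables $y$), characterized by the property that its composition with the projection $\Delta^{st}\to R^e\otimes\bigwedge^0(V)\to R^e/(y-x)=R$ is the restriction to the diagonal followed by the evaluation pairing $E^*\otimes_R E\to R$. Then $c^{\bar{E}}_{t^*}=(\mathrm{id}\times t)^*c^{\bar{E}}:\bar{E}^*\boxtimes t^*\bar{E}\to(\mathrm{id}\times t)^*\Delta^{st}$, and $\tau^{\bar{E}}_{t^*}=\mathrm{Tr}(c^{\bar{E}}_{t^*})$, using $\mathrm{Tr}(\bar{E}^*\boxtimes t^*\bar{E})\simeq\mathrm{Hom}(\bar{E},t^*\bar{E})$. *)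

theory Defs
  imports "HOL-Library.Multiset"
begin

section \<open>Formal power series in several variables\<close>

text \<open>A monomial in variables of type \<^typ>\<open>'v\<close> is a finite multiset of variables, and a
  power series is an arbitrary assignment of coefficients to monomials.  The type \<open>('v, 'a) mps\<close>
  has all elements of \<^typ>\<open>'v\<close> as variables; the ring \<open>k[[V]]\<close> for a finite set \<open>V\<close> of variables
  is the subring \<open>series V\<close> below.\<close>

typedef ('v, 'a) mps = "UNIV :: ('v multiset \<Rightarrow> 'a) set"
  morphisms mps_coeff Abs_mps
  by simp

setup_lifting type_definition_mps

lemma mps_eqI: "(\<And>M. mps_coeff f M = mps_coeff g M) \<Longrightarrow> f = g"
  by (simp add: mps_coeff_inject[symmetric] fun_eq_iff)

lemma finite_submultisets: "finite {A. A \<subseteq># M}"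
proof (induction M)
  case empty
  then show ?case by simp
next
  case (add x M)
  have "{A. A \<subseteq># add_mset x M} \<subseteq> {A. A \<subseteq># M} \<union> add_mset x ` {A. A \<subseteq># M}"
  proof
    fix A assume A: "A \<in> {A. A \<subseteq># add_mset x M}"
    show "A \<in> {A. A \<subseteq># M} \<union> add_mset x ` {A. A \<subseteq># M}"
    proof (cases "x \<in># A")
      case True
      then obtain B where B: "A = add_mset x B" by (metis mset_add)
      with A show ?thesis by auto
    next
      case False
      with A have "A \<subseteq># M"
        by (simp add: subset_mset.inf.absorb_iff2 inter_add_left1)
      then show ?thesis by simp
    qed
  qed
  with add show ?case by (meson finite_UnI finite_imageI finite_subset)
qed

lemma submultiset_facts:
  "B \<subseteq># A \<Longrightarrow> A \<subseteq># M \<Longrightarrow> B \<subseteq># M"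
  "B \<subseteq># A \<Longrightarrow> A \<subseteq># M \<Longrightarrow> A - B \<subseteq># M - B"
  "B \<subseteq># A \<Longrightarrow> A \<subseteq># M \<Longrightarrow> M - B - (A - B) = M - A"
  "B \<subseteq># A \<Longrightarrow> B + (A - B) = A"
  "A \<subseteq># M \<Longrightarrow> M - (M - A) = A"
  by (auto simp: subseteq_mset_def diff_le_mono multiset_eq_iff intro: order_trans)

lemma submultiset_add:
  "B \<subseteq># M \<Longrightarrow> C \<subseteq># M - B \<Longrightarrow> B + C \<subseteq># M"
  by (metis subset_mset.add_diff_inverse subset_mset.add_left_mono)

instantiation mps :: (type, comm_ring_1) comm_ring_1
begin

lift_definition zero_mps :: "('a, 'b) mps" is "\<lambda>_. 0" .

lift_definition one_mps :: "('a, 'b) mps" is "\<lambda>M. if M = {#} then 1 else 0" .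

lift_definition plus_mps :: "('a, 'b) mps \<Rightarrow> ('a, 'b) mps \<Rightarrow> ('a, 'b) mps"
  is "\<lambda>f g M. f M + g M" .

lift_definition minus_mps :: "('a, 'b) mps \<Rightarrow> ('a, 'b) mps \<Rightarrow> ('a, 'b) mps"
  is "\<lambda>f g M. f M - g M" .

lift_definition uminus_mps :: "('a, 'b) mps \<Rightarrow> ('a, 'b) mps"
  is "\<lambda>f M. - f M" .

lift_definition times_mps :: "('a, 'b) mps \<Rightarrow> ('a, 'b) mps \<Rightarrow> ('a, 'b) mps"
  is "\<lambda>f g M. \<Sum>A | A \<subseteq># M. f A * g (M - A)" .

instance
proof
  fix a b c :: "('a, 'b) mps"
  show "a * b * c = a * (b * c)"
  proof (rule mps_eqI)
    fix M :: "'a multiset"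
    let ?a = "mps_coeff a" and ?b = "mps_coeff b" and ?c = "mps_coeff c"
    have "mps_coeff (a * b * c) M
        = (\<Sum>A | A \<subseteq># M. \<Sum>B | B \<subseteq># A. ?a B * ?b (A - B) * ?c (M - A))"
      by (simp add: times_mps.rep_eq sum_distrib_right)
    also have "\<dots> = (\<Sum>(A, B)\<in>(SIGMA A:{A. A \<subseteq># M}. {B. B \<subseteq># A}).
        ?a B * ?b (A - B) * ?c (M - A))"
      by (rule sum.Sigma) (auto simp: finite_submultisets)
    also have "\<dots> = (\<Sum>(B, C)\<in>(SIGMA B:{B. B \<subseteq># M}. {C. C \<subseteq># M - B}).
        ?a B * (?b C * ?c (M - B - C)))"
      by (rule sum.reindex_bij_witness
          [where i = "\<lambda>(B, C). (B + C, B)" and j = "\<lambda>(A, B). (B, A - B)"])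
        (auto simp: mult.assoc submultiset_facts submultiset_add)
    also have "\<dots> = (\<Sum>B | B \<subseteq># M. \<Sum>C | C \<subseteq># M - B. ?a B * (?b C * ?c (M - B - C)))"
      by (rule sum.Sigma[symmetric]) (auto simp: finite_submultisets)
    also have "\<dots> = mps_coeff (a * (b * c)) M"
      by (simp add: times_mps.rep_eq sum_distrib_left)
    finally show "mps_coeff (a * b * c) M = mps_coeff (a * (b * c)) M" .
  qed
  show "a * b = b * a"
  proof (rule mps_eqI)
    fix M :: "'a multiset"
    show "mps_coeff (a * b) M = mps_coeff (b * a) M"
      unfolding times_mps.rep_eq
      by (rule sum.reindex_bij_witness[where i = "\<lambda>A. M - A" and j = "\<lambda>A. M - A"])
        (auto simp: mult.commute submultiset_facts)
  qed
  show "1 * a = a"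
  proof (rule mps_eqI)
    fix M :: "'a multiset"
    have "mps_coeff (1 * a) M = (\<Sum>A\<in>{{#} :: 'a multiset}. mps_coeff a M)"
      unfolding times_mps.rep_eq one_mps.rep_eq
      by (rule sum.mono_neutral_cong_right) (auto simp: finite_submultisets)
    then show "mps_coeff (1 * a) M = mps_coeff a M" by simp
  qed
  show "(a + b) * c = a * c + b * c"
    by (rule mps_eqI) (simp add: times_mps.rep_eq plus_mps.rep_eq distrib_right sum.distrib)
  show "(0::('a, 'b) mps) \<noteq> 1"
  proof
    assume "(0::('a, 'b) mps) = 1"
    then have "mps_coeff (0::('a, 'b) mps) {#} = mps_coeff (1::('a, 'b) mps) {#}" by simp
    then show False by (simp add: zero_mps.rep_eq one_mps.rep_eq)
  qed
qed (rule mps_eqI; simp add: plus_mps.rep_eq zero_mps.rep_eq uminus_mps.rep_eq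
      minus_mps.rep_eq algebra_simps)+

end


definition series :: "'v set \<Rightarrow> ('v, 'a::zero) mps set" where
  "series V = {f. \<forall>M. mps_coeff f M \<noteq> 0 \<longrightarrow> set_mset M \<subseteq> V}"

lift_definition mps_const :: "'a::zero \<Rightarrow> ('v, 'a) mps"
  is "\<lambda>a M. if M = {#} then a else 0" .

lift_definition mps_var :: "'v \<Rightarrow> ('v, 'a::zero_neq_one) mps"
  is "\<lambda>v M. if M = {#v#} then 1 else 0" .

lift_definition mps_deriv :: "'v \<Rightarrow> ('v, 'a::semiring_1) mps \<Rightarrow> ('v, 'a) mps"
  is "\<lambda>v f M. of_nat (count M v + 1) * f (add_mset v M)" .

text \<open>The substitution homomorphism \<open>x\<^sub>v \<mapsto> a\<^sub>v \<cdot> x\<^bsub>\<rho> v\<^esub>\<close>.  It is only meaningful when \<open>\<rho>\<close> has finite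
  fibres, because the coefficient sum below is then finite; all uses satisfy this.\<close>

lift_definition mps_subst ::
    "('v \<Rightarrow> 'u) \<Rightarrow> ('v \<Rightarrow> 'a) \<Rightarrow> ('v, 'a::comm_semiring_1) mps \<Rightarrow> ('u, 'a) mps"
  is "\<lambda>\<rho> a f M. \<Sum>N | image_mset \<rho> N = M. (\<Prod>v\<in>#N. a v) * f N" .

text \<open>Exact quotient, used only where the divisor is not a zero divisor and divides.\<close>

definition mps_quot :: "('v, 'a::comm_ring_1) mps \<Rightarrow> ('v, 'a) mps \<Rightarrow> ('v, 'a) mps" where
  "mps_quot f g = (THE h. h * g = f)"

definition jacobian_ideal :: "'v set \<Rightarrow> ('v, 'a::comm_ring_1) mps \<Rightarrow> ('v, 'a) mps set" where
  "jacobian_ideal V v = {\<Sum>i\<in>V. g i * mps_deriv i v | g. \<forall>i\<in>V. g i \<in> series V}"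

text \<open>The last conjunct says that the quotient of \<open>k[[V]]\<close> by the Jacobian ideal is spanned over
  \<open>k\<close> by the classes of finitely many elements.\<close>

definition isolated_singularity :: "'v set \<Rightarrow> ('v, 'a::field) mps \<Rightarrow> bool" where
  "isolated_singularity V v \<longleftrightarrow> v \<in> series V \<and> mps_coeff v {#} = 0 \<and>
     (\<exists>B. finite B \<and> B \<subseteq> series V \<and>
        (\<forall>f\<in>series V. \<exists>a. f - (\<Sum>b\<in>B. mps_const (a b) * b) \<in> jacobian_ideal V v))"


section \<open>Matrix factorizations\<close>

text \<open>A \<open>\<int>/2\<close>-graded finitely generated free module \<open>U \<otimes> k[[V]]\<close> is given by a homogeneous basis of \<open>U\<close>
  together with the parity of each basis vector; \<open>mf_diff X c b\<close> is the coefficient of the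
  basis vector \<open>c\<close> in the image of \<open>b\<close> under the differential.\<close>

record ('b, 'v, 'a) mf =
  mf_basis :: "'b set"
  mf_odd :: "'b \<Rightarrow> bool"
  mf_diff :: "'b \<Rightarrow> 'b \<Rightarrow> ('v, 'a) mps"

abbreviation parity_sign :: "bool \<Rightarrow> 'r::comm_ring_1" where
  "parity_sign p \<equiv> (if p then - 1 else 1)"

text \<open>Morphisms of the underlying modules, not necessarily homogeneous.  Matrices and
  coordinate vectors vanish outside the bases, so that equality of morphisms is equality of
  functions.\<close>

definition homs ::
    "'v set \<Rightarrow> ('b, 'v, 'a) mf \<Rightarrow> ('c, 'v, 'a) mf \<Rightarrow> ('c \<Rightarrow> 'b \<Rightarrow> ('v, 'a::comm_ring_1) mps) set" where
  "homs V X Y = {\<phi>. \<forall>c b. \<phi> c b \<in> series V \<and>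
     (\<phi> c b \<noteq> 0 \<longrightarrow> c \<in> mf_basis Y \<and> b \<in> mf_basis X)}"

definition even_homs ::
    "'v set \<Rightarrow> ('b, 'v, 'a) mf \<Rightarrow> ('c, 'v, 'a) mf \<Rightarrow> ('c \<Rightarrow> 'b \<Rightarrow> ('v, 'a::comm_ring_1) mps) set" where
  "even_homs V X Y = {\<phi> \<in> homs V X Y. \<forall>c b. \<phi> c b \<noteq> 0 \<longrightarrow> mf_odd Y c = mf_odd X b}"

definition odd_homs ::
    "'v set \<Rightarrow> ('b, 'v, 'a) mf \<Rightarrow> ('c, 'v, 'a) mf \<Rightarrow> ('c \<Rightarrow> 'b \<Rightarrow> ('v, 'a::comm_ring_1) mps) set" where
  "odd_homs V X Y = {\<phi> \<in> homs V X Y. \<forall>c b. \<phi> c b \<noteq> 0 \<longrightarrow> mf_odd Y c \<noteq> mf_odd X b}"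

definition mat_mult ::
    "'c set \<Rightarrow> ('d \<Rightarrow> 'c \<Rightarrow> 'r) \<Rightarrow> ('c \<Rightarrow> 'b \<Rightarrow> 'r) \<Rightarrow> 'd \<Rightarrow> 'b \<Rightarrow> 'r::comm_ring_1" where
  "mat_mult B \<psi> \<phi> = (\<lambda>d b. \<Sum>c\<in>B. \<psi> d c * \<phi> c b)"

definition mat_apply ::
    "'b set \<Rightarrow> ('c \<Rightarrow> 'b \<Rightarrow> 'r) \<Rightarrow> ('b \<Rightarrow> 'r) \<Rightarrow> 'c \<Rightarrow> 'r::comm_ring_1" where
  "mat_apply B \<phi> \<eta> = (\<lambda>c. \<Sum>b\<in>B. \<phi> c b * \<eta> b)"

definition is_mf :: "'v set \<Rightarrow> ('v, 'a::comm_ring_1) mps \<Rightarrow> ('b, 'v, 'a) mf \<Rightarrow> bool" where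
  "is_mf V f X \<longleftrightarrow> finite (mf_basis X) \<and> mf_diff X \<in> odd_homs V X X \<and>
     mat_mult (mf_basis X) (mf_diff X) (mf_diff X) =
       (\<lambda>c b. if c = b \<and> b \<in> mf_basis X then f else 0)"

text \<open>The differential \<open>\<delta>\<^sub>Y \<phi> - (-1)\<^bsup>|\<phi>|\<^esup> \<phi> \<delta>\<^sub>X\<close>; the sign is put on each matrix entry of \<open>\<phi>\<close>, which
  extends the formula additively to inhomogeneous \<open>\<phi>\<close>.\<close>

definition hom_diff ::
    "('b, 'v, 'a) mf \<Rightarrow> ('c, 'v, 'a) mf \<Rightarrow> ('c \<Rightarrow> 'b \<Rightarrow> ('v, 'a) mps) \<Rightarrow>
      'c \<Rightarrow> 'b \<Rightarrow> ('v, 'a::comm_ring_1) mps" where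
  "hom_diff X Y \<phi> = (\<lambda>c b. mat_mult (mf_basis Y) (mf_diff Y) \<phi> c b -
     mat_mult (mf_basis X) (\<lambda>c b. parity_sign (mf_odd Y c \<noteq> mf_odd X b) * \<phi> c b) (mf_diff X) c b)"

definition closed_homs ::
    "'v set \<Rightarrow> ('b, 'v, 'a) mf \<Rightarrow> ('c, 'v, 'a) mf \<Rightarrow> ('c \<Rightarrow> 'b \<Rightarrow> ('v, 'a::comm_ring_1) mps) set" where
  "closed_homs V X Y = {\<phi> \<in> homs V X Y. hom_diff X Y \<phi> = (\<lambda>_ _. 0)}"

text \<open>The class of a closed morphism in the (total) cohomology of the morphism complex.\<close>

definition hom_class ::
    "'v set \<Rightarrow> ('b, 'v, 'a) mf \<Rightarrow> ('c, 'v, 'a) mf \<Rightarrow> ('c \<Rightarrow> 'b \<Rightarrow> ('v, 'a) mps) \<Rightarrow>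
      ('c \<Rightarrow> 'b \<Rightarrow> ('v, 'a::comm_ring_1) mps) set" where
  "hom_class V X Y \<phi> = {\<lambda>c b. \<phi> c b + hom_diff X Y h c b | h. h \<in> homs V X Y}"

text \<open>Morphisms of the homotopy category: homotopy classes of closed even morphisms.\<close>

definition ho_homs ::
    "'v set \<Rightarrow> ('b, 'v, 'a) mf \<Rightarrow> ('c, 'v, 'a) mf \<Rightarrow>
      ('c \<Rightarrow> 'b \<Rightarrow> ('v, 'a::comm_ring_1) mps) set set" where
  "ho_homs V X Y =
     {{\<lambda>c b. \<phi> c b + hom_diff X Y h c b | h. h \<in> odd_homs V X Y} | \<phi>.
        \<phi> \<in> closed_homs V X Y \<inter> even_homs V X Y}"

text \<open>The class of an element in the cohomology of a matrix factorization of \<open>0\<close>, i.e. of a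
  \<open>\<int>/2\<close>-graded complex.\<close>

definition mf_elems :: "'v set \<Rightarrow> ('b, 'v, 'a) mf \<Rightarrow> ('b \<Rightarrow> ('v, 'a::comm_ring_1) mps) set" where
  "mf_elems V X = {\<eta>. \<forall>b. \<eta> b \<in> series V \<and> (b \<notin> mf_basis X \<longrightarrow> \<eta> b = 0)}"

definition coh_class ::
    "'v set \<Rightarrow> ('b, 'v, 'a) mf \<Rightarrow> ('b \<Rightarrow> ('v, 'a) mps) \<Rightarrow> ('b \<Rightarrow> ('v, 'a::comm_ring_1) mps) set" where
  "coh_class V X \<eta> =
     {\<lambda>b. \<eta> b + mat_apply (mf_basis X) (mf_diff X) \<xi> b | \<xi>. \<xi> \<in> mf_elems V X}"

text \<open>Base change along a homomorphism of power series rings.\<close>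

definition mf_map ::
    "(('v, 'a) mps \<Rightarrow> ('u, 'a) mps) \<Rightarrow> ('b, 'v, 'a) mf \<Rightarrow> ('b, 'u, 'a) mf" where
  "mf_map \<theta> X = \<lparr>mf_basis = mf_basis X, mf_odd = mf_odd X,
     mf_diff = (\<lambda>c b. \<theta> (mf_diff X c b))\<rparr>"

text \<open>The dual, in the dual basis (indexed as the basis itself), with the Koszul sign
  \<open>\<delta>\<^sup>*(f) = - (-1)\<^bsup>|f|\<^esup> f \<circ> \<delta>\<close>.\<close>

definition mf_dual :: "('b, 'v, 'a::comm_ring_1) mf \<Rightarrow> ('b, 'v, 'a) mf" where
  "mf_dual X = \<lparr>mf_basis = mf_basis X, mf_odd = mf_odd X,
     mf_diff = (\<lambda>c b. - parity_sign (mf_odd X b) * mf_diff X b c)\<rparr>"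

text \<open>The tensor product, with \<open>\<delta>(e \<otimes> f) = \<delta>e \<otimes> f + (-1)\<^bsup>|e|\<^esup> e \<otimes> \<delta>f\<close>.\<close>

definition mf_tensor ::
    "('b, 'v, 'a) mf \<Rightarrow> ('c, 'v, 'a) mf \<Rightarrow> ('b \<times> 'c, 'v, 'a::comm_ring_1) mf" where
  "mf_tensor X Y = \<lparr>mf_basis = mf_basis X \<times> mf_basis Y,
     mf_odd = (\<lambda>(b, c). mf_odd X b \<noteq> mf_odd Y c),
     mf_diff = (\<lambda>(b', c') (b, c).
       (if c' = c \<and> c \<in> mf_basis Y then mf_diff X b' b else 0) +
       (if b' = b \<and> b \<in> mf_basis X then parity_sign (mf_odd X b) * mf_diff Y c' c else 0))\<rparr>"

text \<open>The Koszul module \<open>\<And>\<^sup>\<bullet>(\<Oplus>\<^sub>i k e\<^sub>i)\<close>, \<open>i \<in> I\<close>, with differential wedge product with \<open>\<Sum> a\<^sub>i e\<^sub>i\<close> plus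
  contraction with \<open>\<Sum> b\<^sub>i e\<^sub>i\<^sup>*\<close>.  The basis vector with index \<open>J = {j\<^sub>1 < \<dots> < j\<^sub>r}\<close> is
  \<open>e\<^sub>j\<^sub>1 \<and> \<dots> \<and> e\<^sub>j\<^sub>r\<close>; the sign comes from moving \<open>e\<^sub>i\<close> into or out of its place.\<close>

definition koszul ::
    "nat set \<Rightarrow> (nat \<Rightarrow> ('v, 'a) mps) \<Rightarrow> (nat \<Rightarrow> ('v, 'a) mps) \<Rightarrow>
      (nat set, 'v, 'a::comm_ring_1) mf" where
  "koszul I a b = \<lparr>mf_basis = Pow I, mf_odd = (\<lambda>J. odd (card J)),
     mf_diff = (\<lambda>J' J. if J \<subseteq> I then
       (\<Sum>i\<in>I. (- 1) ^ card {j\<in>J. j < i} *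
          ((if i \<notin> J \<and> J' = insert i J then a i else 0) +
           (if i \<in> J \<and> J' = J - {i} then b i else 0))) else 0)\<rparr>"

definition supertrace ::
    "('b, 'v, 'a) mf \<Rightarrow> ('b \<Rightarrow> 'b \<Rightarrow> ('u, 'a::comm_ring_1) mps) \<Rightarrow> ('u, 'a) mps" where
  "supertrace X \<phi> = (\<Sum>b\<in>mf_basis X. parity_sign (mf_odd X b) * \<phi> b b)"


section \<open>Kernels and the generalized boundary-bulk map\<close>

text \<open>\<open>R = k[[x\<^sub>1,\<dots>,x\<^sub>n]]\<close> is \<open>series {1..n}\<close> over the variables \<^typ>\<open>nat\<close>.  For \<open>R\<^sup>e\<close> the variables have
  type \<^typ>\<open>nat + nat\<close>: \<open>Inl i\<close> is \<open>x\<^sub>i\<close> and \<open>Inr i\<close> is \<open>y\<^sub>i\<close>.\<close>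

abbreviation vars_e :: "nat \<Rightarrow> (nat + nat) set" where
  "vars_e n \<equiv> {1..n} <+> {1..n}"

definition in_x :: "(nat, 'a::comm_ring_1) mps \<Rightarrow> (nat + nat, 'a) mps" where
  "in_x = mps_subst Inl (\<lambda>_. 1)"

definition in_y :: "(nat, 'a::comm_ring_1) mps \<Rightarrow> (nat + nat, 'a) mps" where
  "in_y = mps_subst Inr (\<lambda>_. 1)"

text \<open>\<open>f(x\<^sub>1,\<dots>,x\<^bsub>i-1\<^esub>,y\<^sub>i,\<dots>,y\<^sub>n)\<close>\<close>

definition in_xy :: "nat \<Rightarrow> (nat, 'a::comm_ring_1) mps \<Rightarrow> (nat + nat, 'a) mps" where
  "in_xy i = mps_subst (\<lambda>j. if j < i then Inl j else Inr j) (\<lambda>_. 1)"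

text \<open>Restriction to \<open>y = x\<close>.\<close>

definition diagonal :: "(nat + nat, 'a::comm_ring_1) mps \<Rightarrow> (nat, 'a) mps" where
  "diagonal = mps_subst (case_sum id id) (\<lambda>_. 1)"

text \<open>\<open>f \<mapsto> f \<circ> t\<close>, and \<open>(id \<times> t)\<^sup>*\<close>, which is \<open>y\<^sub>i \<mapsto> t\<^sub>i y\<^sub>i\<close>.\<close>

definition scale :: "(nat \<Rightarrow> 'a) \<Rightarrow> (nat, 'a::comm_ring_1) mps \<Rightarrow> (nat, 'a) mps" where
  "scale t = mps_subst id t"

definition scale_y :: "(nat \<Rightarrow> 'a) \<Rightarrow> (nat + nat, 'a::comm_ring_1) mps \<Rightarrow> (nat + nat, 'a) mps" where
  "scale_y t = mps_subst id (case_sum (\<lambda>_. 1) t)"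

text \<open>Restriction to \<open>x\<^sub>1 = \<dots> = x\<^sub>l = 0\<close>.\<close>

definition vanish :: "nat \<Rightarrow> (nat, 'a::comm_ring_1) mps \<Rightarrow> (nat, 'a) mps" where
  "vanish l = scale (\<lambda>i. if i \<le> l then 0 else 1)"

definition difference_quot :: "nat \<Rightarrow> (nat, 'a::comm_ring_1) mps \<Rightarrow> (nat + nat, 'a) mps" where
  "difference_quot i w =
     mps_quot (in_xy i w - in_xy (i + 1) w) (mps_var (Inr i) - mps_var (Inl i))"

definition diag_kernel :: "nat \<Rightarrow> (nat, 'a::comm_ring_1) mps \<Rightarrow> (nat set, nat + nat, 'a) mf" where
  "diag_kernel n w =
     koszul {1..n} (\<lambda>i. difference_quot i w) (\<lambda>i. mps_var (Inr i) - mps_var (Inl i))"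

definition dual_box_self ::
    "('b, nat, 'a) mf \<Rightarrow> ('b \<times> 'b, nat + nat, 'a::comm_ring_1) mf" where
  "dual_box_self E = mf_tensor (mf_map in_x (mf_dual E)) (mf_map in_y E)"

text \<open>The condition characterizing the canonical morphism: followed by the projection to \<open>\<And>\<^sup>0\<close> and
  to \<open>R = R\<^sup>e/(y-x)\<close>, the morphism \<open>c\<close> is homotopic to the evaluation pairing on the diagonal,
  which sends \<open>b\<^sup>* \<otimes> b'\<close> to \<open>1\<close> if \<open>b = b'\<close> and to \<open>0\<close> otherwise.  Since \<open>R\<close> is purely even with zero
  differential, a homotopy is an \<open>R\<^sup>e\<close>-linear map \<open>h\<close> to \<open>R\<close> that is nonzero on odd basis elements
  only, with boundary \<open>h \<circ> \<delta>\<close>.\<close>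

definition lifts_evaluation ::
    "nat \<Rightarrow> ('b, nat, 'a) mf \<Rightarrow> (nat set \<Rightarrow> 'b \<times> 'b \<Rightarrow> (nat + nat, 'a::comm_ring_1) mps) \<Rightarrow> bool" where
  "lifts_evaluation n E c \<longleftrightarrow>
     (\<exists>h. (\<forall>q. h q \<in> series {1..n} \<and> (h q \<noteq> 0 \<longrightarrow> mf_odd (dual_box_self E) q)) \<and>
        (\<forall>q\<in>mf_basis (dual_box_self E).
           diagonal (c {} q) = (if fst q = snd q then 1 else 0) +
             (\<Sum>q'\<in>mf_basis (dual_box_self E). h q' * diagonal (mf_diff (dual_box_self E) q' q))))"

definition canonical_morphism ::
    "nat \<Rightarrow> (nat, 'a) mps \<Rightarrow> ('b, nat, 'a) mf \<Rightarrow>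
      (nat set \<Rightarrow> 'b \<times> 'b \<Rightarrow> (nat + nat, 'a::comm_ring_1) mps) set" where
  "canonical_morphism n w E =
     (THE C. C \<in> ho_homs (vars_e n) (dual_box_self E) (diag_kernel n w) \<and>
        (\<forall>c\<in>C. lifts_evaluation n E c))"

text \<open>The complex \<open>\<Delta>\<^sup>s\<^sup>t|\<^sub>\<Gamma>\<^sub>t\<close>, whose cohomology is \<open>Tr(t\<^sup>*)\<close>.\<close>

definition trace_complex ::
    "nat \<Rightarrow> (nat, 'a) mps \<Rightarrow> (nat \<Rightarrow> 'a) \<Rightarrow> (nat set, nat, 'a::comm_ring_1) mf" where
  "trace_complex n w t = mf_map diagonal (mf_map (scale_y t) (diag_kernel n w))"

text \<open>The identification of \<open>Hom(E, t\<^sup>*E)\<close> with the restriction of \<open>E\<^sup>* \<boxtimes> t\<^sup>*E\<close> to the diagonal: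
  \<open>f \<otimes> e\<close> corresponds to the map \<open>v \<mapsto> (-1)\<^bsup>|f||e|\<^esup> f(v) e\<close>.  With this sign the differential of the tensor
  product becomes \<open>hom_diff\<close>, and evaluation becomes the supertrace.\<close>

definition hom_to_box ::
    "('b, 'v, 'a) mf \<Rightarrow> ('b \<Rightarrow> 'b \<Rightarrow> ('v, 'a) mps) \<Rightarrow> 'b \<times> 'b \<Rightarrow> ('v, 'a::comm_ring_1) mps" where
  "hom_to_box E \<alpha> = (\<lambda>(a, b). parity_sign (mf_odd E a \<and> mf_odd E b) * \<alpha> b a)"

text \<open>The generalized boundary-bulk map from cohomology classes \<open>A\<close> of morphisms \<open>E \<rightarrow> t\<^sup>*E\<close> to
  cohomology classes of \<open>trace_complex\<close>.  As usual for maps between quotients, it is written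
  as the union of the classes obtained from all representatives (of \<open>A\<close> and of the canonical
  morphism), which is a single class exactly when these all agree.\<close>

definition boundary_bulk ::
    "nat \<Rightarrow> (nat, 'a) mps \<Rightarrow> (nat \<Rightarrow> 'a) \<Rightarrow> ('b, nat, 'a) mf \<Rightarrow> ('b \<Rightarrow> 'b \<Rightarrow> (nat, 'a) mps) set \<Rightarrow>
      (nat set \<Rightarrow> (nat, 'a::comm_ring_1) mps) set" where
  "boundary_bulk n w t E A = (\<Union>c\<in>canonical_morphism n w E. \<Union>\<alpha>\<in>A.
     coh_class {1..n} (trace_complex n w t)
       (mat_apply (mf_basis (dual_box_self E)) (\<lambda>J q. diagonal (scale_y t (c J q)))
          (hom_to_box E \<alpha>)))"

text \<open>The class of \<open>f dz\<^sub>1 \<and> \<dots> \<and> dz\<^sub>m\<close> in \<open>H(v)\<close>, where \<open>V\<close> is the set of variables \<open>z\<^sub>1 < \<dots> < z\<^sub>m\<close>.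
  Differential forms are functions on sets of indices, as for \<open>koszul\<close>.\<close>

definition H_class ::
    "nat set \<Rightarrow> (nat, 'a) mps \<Rightarrow> (nat, 'a) mps \<Rightarrow> (nat set \<Rightarrow> (nat, 'a::comm_ring_1) mps) set" where
  "H_class V v f =
     {\<lambda>J. if J = V then g else 0 | g. g \<in> series V \<and> g - f \<in> jacobian_ideal V v}"

text \<open>The isomorphism \<open>Tr(t\<^sup>*) \<simeq> H(w\<^sub>t)\<close>, with \<open>w\<^sub>t = vanish l w\<close>: restriction to
  \<open>x\<^sub>1 = \<dots> = x\<^sub>l = 0\<close> and projection to the coefficient of \<open>e\<^bsub>l+1\<^esub> \<and> \<dots> \<and> e\<^sub>n\<close>.\<close>

definition trace_iso ::
    "nat \<Rightarrow> nat \<Rightarrow> (nat, 'a) mps \<Rightarrow> (nat set \<Rightarrow> (nat, 'a) mps) set \<Rightarrow>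
      (nat set \<Rightarrow> (nat, 'a::comm_ring_1) mps) set" where
  "trace_iso n l w Z = (\<Union>\<eta>\<in>Z. H_class {l+1..n} (vanish l w) (vanish l (\<eta> {l+1..n})))"

text \<open>\<open>\<partial>\<^sub>n\<delta> \<circ> \<dots> \<circ> \<partial>\<^bsub>l+1\<^esub>\<delta> \<circ> \<alpha>\<close>\<close>

definition deriv_comp ::
    "nat \<Rightarrow> nat \<Rightarrow> ('b, nat, 'a) mf \<Rightarrow> ('b \<Rightarrow> 'b \<Rightarrow> (nat, 'a) mps) \<Rightarrow>
      'b \<Rightarrow> 'b \<Rightarrow> (nat, 'a::comm_ring_1) mps" where
  "deriv_comp n l E \<alpha> =
     fold (\<lambda>i. mat_mult (mf_basis E) (\<lambda>c b. mps_deriv i (mf_diff E c b))) [l+1..<n+1] \<alpha>"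

end

(* The canonical morphism has an explicit representative. Replacing the variables y by x one at a
   time turns delta(y) into delta(x) in n steps; let D_i be the difference quotient of delta at step
   i. Since delta^2 = w, moving delta through the product of the D_j, j in J, produces exactly the
   terms of the Koszul differential, so e |-> sum_J +- D_{j_r} ... D_{j_1} e e_J is closed, and its
   degree 0 part is the evaluation pairing. It represents the canonical morphism because the Koszul
   complex of the y_i - x_i is exact in positive degrees, so a closed morphism that vanishes after
   projection to R is null-homotopic, by induction on the exterior degree. On the diagonal D_i becomes
   the partial derivative of delta, which gives the formula; coboundaries contribute multiples of the
   partial derivatives of w_t. *)

theory Submission
  imports Defs
begin

section \<open>Substitution in power series\<close>

text \<open>The twist enters only at the end: where x_1 = ... = x_l = 0, the graph y = t x agrees
  with the diagonal, because t_i = 1 for the other i. The kernel morphism can therefore be built for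
  the identity functor, and untwisted partial derivatives appear in the formula. An obstacle to the
  induction on exterior degree is that the wedge part of the Koszul differential raises this degree,
  so \<open>diag_kernel\<close> is not a complex in it; but in the lowest degree where a morphism is
  nonzero only the contraction part is visible. Exactness is made explicit: \<open>dquot\<close>,
  given by a finite formula on coefficients, is a linear left inverse of multiplication by y_i -
  x_i, and the contracting homotopy is composed of such operators and restrictions.
  \<open>canonical_morphism\<close> is a definite description, so its class must be shown both to
  exist and to be unique; \<open>boundary_bulk\<close> is a union over all representatives, so each
  of them has to give the same class, and the union has to be nonempty. The supertrace sign arises
  from two signs: the one for moving |J| odd factors past a dual basis vector, and the one in
  \<open>hom_to_box\<close>.\<close>

lemma mps_coeff_var_times:
  "mps_coeff (mps_var v * f) M = (if v \<in># M then mps_coeff f (M - {#v#}) else 0)"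
proof -
  have "mps_coeff (mps_var v * f) M
      = (\<Sum>A | A \<subseteq># M \<and> A = {#v#}. mps_coeff f (M - A))"
    unfolding times_mps.rep_eq mps_var.rep_eq
    by (rule sum.mono_neutral_cong_right) (auto simp: finite_submultisets)
  also have "{A. A \<subseteq># M \<and> A = {#v#}} = (if v \<in># M then {{#v#}} else {})"
    by auto
  finally show ?thesis by simp
qed

section \<open>Closure properties of the subring of series in given variables\<close>

lemma series_0 [simp]: "0 \<in> series V"
  by (simp add: series_def zero_mps.rep_eq)

lemma series_1 [simp]: "1 \<in> series V"
  by (simp add: series_def one_mps.rep_eq)

lemma series_add: "f \<in> series V \<Longrightarrow> g \<in> series V \<Longrightarrow> f + g \<in> series V"
  by (force simp: series_def plus_mps.rep_eq)

lemma series_uminus: "f \<in> series V \<Longrightarrow> - f \<in> series V" for f :: "('v, 'a::comm_ring_1) mps"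
  by (auto simp: series_def uminus_mps.rep_eq)

lemma series_diff: "f \<in> series V \<Longrightarrow> g \<in> series V \<Longrightarrow> f - g \<in> series V"
  for f :: "('v, 'a::comm_ring_1) mps"
  using series_add[of f V "- g"] by (simp add: series_uminus)

lemma series_mult: "f \<in> series V \<Longrightarrow> g \<in> series V \<Longrightarrow> f * g \<in> series V"
  for f :: "('v, 'a::comm_ring_1) mps"
proof -
  assume f: "f \<in> series V" and g: "g \<in> series V"
  have "set_mset M \<subseteq> V" if "mps_coeff (f * g) M \<noteq> 0" for M
  proof -
    from that obtain A where A: "A \<subseteq># M" "mps_coeff f A * mps_coeff g (M - A) \<noteq> 0"
      unfolding times_mps.rep_eq by (auto elim: sum.not_neutral_contains_not_neutral)
    then have "mps_coeff f A \<noteq> 0" "mps_coeff g (M - A) \<noteq> 0" by auto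
    then have "set_mset A \<subseteq> V" "set_mset (M - A) \<subseteq> V"
      using f g by (simp_all add: series_def)
    moreover have "set_mset M = set_mset A \<union> set_mset (M - A)"
      using A(1) by (metis set_mset_union subset_mset.add_diff_inverse)
    ultimately show ?thesis by simp
  qed
  then show ?thesis by (simp add: series_def)
qed

lemma series_sum: "(\<And>a. a \<in> A \<Longrightarrow> f a \<in> series V) \<Longrightarrow> sum f A \<in> series V"
  for f :: "_ \<Rightarrow> ('v, 'a::comm_ring_1) mps"
  by (induction A rule: infinite_finite_induct) (auto intro: series_add)

lemma series_var: "v \<in> V \<Longrightarrow> mps_var v \<in> series V"
  by (simp add: series_def mps_var.rep_eq)

lemma series_sign: "(- 1) ^ k \<in> series V" for V :: "'v set"
  by (cases "even k") (auto intro: series_uminus)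

text \<open>A coefficient of \<open>mps_subst\<close> is a sum over all multisets with a given
  image. Over an infinite index set this sum would be 0 by convention and multiplicativity could
  fail; finite fibres on variables give finite fibres on multisets.\<close>

definition finite_fibres :: "('v \<Rightarrow> 'u) \<Rightarrow> bool" where
  "finite_fibres \<rho> \<longleftrightarrow> (\<forall>u. finite (\<rho> -` {u}))"

lemma finite_fibres_inj: "inj \<rho> \<Longrightarrow> finite_fibres \<rho>"
  by (simp add: finite_fibres_def finite_vimageI)

lemma finite_fibres_compose: "finite_fibres \<rho> \<Longrightarrow> finite_fibres \<sigma> \<Longrightarrow> finite_fibres (\<sigma> \<circ> \<rho>)"
proof -
  assume \<rho>: "finite_fibres \<rho>" and \<sigma>: "finite_fibres \<sigma>"
  have "(\<sigma> \<circ> \<rho>) -` {u} = (\<Union>v\<in>\<sigma> -` {u}. \<rho> -` {v})" for u by auto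
  then show ?thesis using \<rho> \<sigma> by (simp add: finite_fibres_def)
qed

lemma finite_image_mset_fibre:
  assumes "finite_fibres \<rho>"
  shows "finite {N. image_mset \<rho> N = M}"
proof (induction M)
  case empty
  then show ?case by simp
next
  case (add u M)
  have "{N. image_mset \<rho> N = add_mset u M}
      \<subseteq> (\<Union>v\<in>\<rho> -` {u}. add_mset v ` {N. image_mset \<rho> N = M})"
    by (auto dest!: msed_map_invR)
  moreover have "finite \<dots>" using assms add by (simp add: finite_fibres_def)
  ultimately show ?case by (rule finite_subset)
qed

lemma subst_add: "mps_subst \<rho> a (f + g) = mps_subst \<rho> a f + mps_subst \<rho> a g"
  for f :: "('v, 'a::comm_ring_1) mps"
  by (rule mps_eqI) (simp add: mps_subst.rep_eq plus_mps.rep_eq distrib_left sum.distrib)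

lemma subst_one:
  assumes "finite_fibres \<rho>"
  shows "mps_subst \<rho> a 1 = (1 :: ('u, 'a::comm_ring_1) mps)"
proof (rule mps_eqI)
  fix M
  have "mps_coeff (mps_subst \<rho> a 1) M
      = (\<Sum>N | image_mset \<rho> N = M \<and> N = {#}. 1 :: 'a)"
    unfolding mps_subst.rep_eq one_mps.rep_eq
    by (rule sum.mono_neutral_cong_right) (auto simp: finite_image_mset_fibre[OF assms])
  also have "{N. image_mset \<rho> N = M \<and> N = {#}} = (if M = {#} then {{#}} else {})" by auto
  finally show "mps_coeff (mps_subst \<rho> a 1) M = mps_coeff (1 :: ('u, 'a) mps) M"
    by (simp add: one_mps.rep_eq)
qed

text \<open>Both coefficients sum over pairs (A, C) such that A + C is mapped to M. The left side
  groups them by N = A + C, the right side by the image B of A, a submultiset of M.\<close>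

lemma subst_mult:
  fixes f :: "('v, 'a::comm_ring_1) mps"
  assumes "finite_fibres \<rho>"
  shows "mps_subst \<rho> a (f * g) = mps_subst \<rho> a f * mps_subst \<rho> a g"
proof (rule mps_eqI)
  fix M
  let ?F = "\<lambda>M. {N. image_mset \<rho> N = M}"
  let ?p = "\<lambda>N. \<Prod>v\<in>#N. a v"
  let ?f = "mps_coeff f" and ?g = "mps_coeff g"
  note fin = finite_image_mset_fibre[OF assms]
  have "mps_coeff (mps_subst \<rho> a (f * g)) M
      = (\<Sum>N\<in>?F M. \<Sum>A | A \<subseteq># N. ?p N * (?f A * ?g (N - A)))"
    by (simp add: mps_subst.rep_eq times_mps.rep_eq sum_distrib_left)
  also have "\<dots> = (\<Sum>(N, A)\<in>(SIGMA N:?F M. {A. A \<subseteq># N}). ?p N * (?f A * ?g (N - A)))"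
    by (rule sum.Sigma) (auto simp: finite_submultisets fin)
  also have "\<dots> = (\<Sum>(B, A, C)\<in>(SIGMA B:{B. B \<subseteq># M}. ?F B \<times> ?F (M - B)).
      (?p A * ?f A) * (?p C * ?g C))"
  proof (rule sum.reindex_bij_witness
        [where i = "\<lambda>(B, A, C). (A + C, A)" and j = "\<lambda>(N, A). (image_mset \<rho> A, A, N - A)"],
      goal_cases)
    case (5 x)
    then obtain N A where x: "x = (N, A)" and A: "A \<subseteq># N" by auto
    have "?p N = ?p A * ?p (N - A)"
      using A by (metis image_mset_union prod_mset_Un subset_mset.add_diff_inverse)
    then show ?case by (simp add: x mult.assoc mult.left_commute)
  qed (auto simp: image_mset_subseteq_mono image_mset_Diff submultiset_facts)
  also have "\<dots> = (\<Sum>B | B \<subseteq># M. \<Sum>(A, C)\<in>?F B \<times> ?F (M - B).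
      (?p A * ?f A) * (?p C * ?g C))"
    by (rule sum.Sigma[symmetric]) (auto simp: finite_submultisets fin)
  also have "\<dots> = mps_coeff (mps_subst \<rho> a f * mps_subst \<rho> a g) M"
    by (simp add: mps_subst.rep_eq times_mps.rep_eq sum_product sum.cartesian_product)
  finally show "mps_coeff (mps_subst \<rho> a (f * g)) M
      = mps_coeff (mps_subst \<rho> a f * mps_subst \<rho> a g) M" .
qed

text \<open>The intermediate multiset L is the image of N, so the double sum collapses to a sum over
  N.\<close>

lemma subst_subst:
  fixes f :: "('v, 'a::comm_ring_1) mps"
  assumes "finite_fibres \<rho>" "finite_fibres \<sigma>"
  shows "mps_subst \<sigma> b (mps_subst \<rho> a f) = mps_subst (\<sigma> \<circ> \<rho>) (\<lambda>v. a v * b (\<rho> v)) f"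
proof (rule mps_eqI)
  fix M
  let ?f = "mps_coeff f"
  note fin = finite_image_mset_fibre[OF assms(1)] finite_image_mset_fibre[OF assms(2)]
  have "mps_coeff (mps_subst \<sigma> b (mps_subst \<rho> a f)) M
     = (\<Sum>L | image_mset \<sigma> L = M. \<Sum>N | image_mset \<rho> N = L.
          (\<Prod>u\<in>#L. b u) * ((\<Prod>v\<in>#N. a v) * ?f N))"
    by (simp add: mps_subst.rep_eq sum_distrib_left)
  also have "\<dots> = (\<Sum>(L, N)\<in>(SIGMA L:{L. image_mset \<sigma> L = M}. {N. image_mset \<rho> N = L}).
          (\<Prod>u\<in>#L. b u) * ((\<Prod>v\<in>#N. a v) * ?f N))"
    by (rule sum.Sigma) (auto simp: fin)
  also have "\<dots> = (\<Sum>N | image_mset (\<sigma> \<circ> \<rho>) N = M. (\<Prod>v\<in>#N. a v * b (\<rho> v)) * ?f N)"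
    by (rule sum.reindex_bij_witness
        [where i = "\<lambda>N. (image_mset \<rho> N, N)" and j = "\<lambda>(L, N). N"])
      (auto simp: multiset.map_comp prod_mset.distrib mult.assoc mult.left_commute o_def)
  finally show "mps_coeff (mps_subst \<sigma> b (mps_subst \<rho> a f)) M
      = mps_coeff (mps_subst (\<sigma> \<circ> \<rho>) (\<lambda>v. a v * b (\<rho> v)) f) M"
    by (simp add: mps_subst.rep_eq)
qed

text \<open>Only monomials in V contribute, so the substitutions may differ on other variables. Both
  maps need finite fibres on all variables, since the coefficient sums range over all multisets
  before zero terms are dropped.\<close>

lemma subst_cong:
  fixes f :: "('v, 'a::comm_ring_1) mps"
  assumes f: "f \<in> series V" and "finite_fibres \<rho>" "finite_fibres \<rho>'"
    and eq: "\<And>v. v \<in> V \<Longrightarrow> \<rho> v = \<rho>' v" "\<And>v. v \<in> V \<Longrightarrow> a v = a' v"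
  shows "mps_subst \<rho> a f = mps_subst \<rho>' a' f"
proof (rule mps_eqI)
  fix M
  have im: "image_mset \<rho> N = image_mset \<rho>' N" "image_mset a N = image_mset a' N"
    if "mps_coeff f N \<noteq> 0" for N
  proof -
    from that f have "set_mset N \<subseteq> V" by (auto simp: series_def)
    then show "image_mset \<rho> N = image_mset \<rho>' N" "image_mset a N = image_mset a' N"
      using eq by (auto intro!: image_mset_cong)
  qed
  have "(\<Sum>N | image_mset \<rho> N = M. (\<Prod>v\<in>#N. a v) * mps_coeff f N)
      = (\<Sum>N | image_mset \<rho> N = M \<and> mps_coeff f N \<noteq> 0. (\<Prod>v\<in>#N. a v) * mps_coeff f N)"
    by (rule sum.mono_neutral_right) (auto simp: finite_image_mset_fibre[OF assms(2)])
  also have "\<dots> = (\<Sum>N | image_mset \<rho>' N = M \<and> mps_coeff f N \<noteq> 0. (\<Prod>v\<in>#N. a' v) * mps_coeff f N)"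
    by (rule sum.cong) (auto simp: im)
  also have "\<dots> = (\<Sum>N | image_mset \<rho>' N = M. (\<Prod>v\<in>#N. a' v) * mps_coeff f N)"
    by (rule sum.mono_neutral_left) (auto simp: finite_image_mset_fibre[OF assms(3)])
  finally show "mps_coeff (mps_subst \<rho> a f) M = mps_coeff (mps_subst \<rho>' a' f) M"
    by (simp add: mps_subst.rep_eq)
qed

lemma subst_id [simp]: "mps_subst id (\<lambda>_. 1) f = f"
  by (rule mps_eqI) (simp add: mps_subst.rep_eq)

text \<open>The alternative \<open>a v = 0\<close> serves \<open>vanish\<close>, which sends x_i to
  0 times x_i for i \<le> l: monomials containing such a variable acquire a zero factor.\<close>

lemma series_subst:
  fixes f :: "('v, 'a::comm_ring_1) mps"
  assumes "f \<in> series V" "\<And>v. v \<in> V \<Longrightarrow> \<rho> v \<in> W \<or> a v = 0"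
  shows "mps_subst \<rho> a f \<in> series W"
proof -
  have "set_mset M \<subseteq> W" if "mps_coeff (mps_subst \<rho> a f) M \<noteq> 0" for M
  proof -
    from that obtain N where N: "image_mset \<rho> N = M" "(\<Prod>v\<in>#N. a v) * mps_coeff f N \<noteq> 0"
      unfolding mps_subst.rep_eq by (auto elim: sum.not_neutral_contains_not_neutral)
    then have "mps_coeff f N \<noteq> 0" by auto
    then have V: "set_mset N \<subseteq> V" using assms(1) by (simp add: series_def)
    have "a v \<noteq> 0" if "v \<in># N" for v
    proof
      assume "a v = 0"
      with that have "(\<Prod>v\<in>#N. a v) = 0" by (metis mset_add image_mset_add_mset prod_mset.add_mset mult_zero_left)
      with N(2) show False by simp
    qed
    with V assms(2) have "\<rho> ` set_mset N \<subseteq> W" by blast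
    with N(1) show ?thesis by auto
  qed
  then show ?thesis by (simp add: series_def)
qed

lemma subst_var: 
  assumes "finite_fibres \<rho>"
  shows "mps_subst \<rho> (\<lambda>_. 1) (mps_var v) = (mps_var (\<rho> v) :: ('u, 'a::comm_ring_1) mps)"
proof (rule mps_eqI)
  fix M
  have "mps_coeff (mps_subst \<rho> (\<lambda>_. 1) (mps_var v)) M
      = (\<Sum>N | image_mset \<rho> N = M \<and> N = {#v#}. 1 :: 'a)"
    unfolding mps_subst.rep_eq mps_var.rep_eq
    by (rule sum.mono_neutral_cong_right) (auto simp: finite_image_mset_fibre[OF assms])
  also have "{N. image_mset \<rho> N = M \<and> N = {#v#}} = (if M = {#\<rho> v#} then {{#v#}} else {})" by auto
  finally show "mps_coeff (mps_subst \<rho> (\<lambda>_. 1) (mps_var v)) M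
      = mps_coeff (mps_var (\<rho> v) :: ('u, 'a) mps) M"
    by (simp add: mps_var.rep_eq)
qed

section \<open>Substitutions as ring homomorphisms\<close>

locale unital_ring_hom =
  fixes h :: "'r::comm_ring_1 \<Rightarrow> 's::comm_ring_1"
  assumes hom_add: "h (x + y) = h x + h y"
    and hom_mult: "h (x * y) = h x * h y"
    and hom_one [simp]: "h 1 = 1"
begin

lemma hom_zero [simp]: "h 0 = 0"
  using hom_add[of 0 0] by simp

lemma hom_uminus: "h (- x) = - h x"
  using hom_add[of x "- x"] by (simp add: eq_neg_iff_add_eq_0 add.commute)

lemma hom_diff: "h (x - y) = h x - h y"
  using hom_add[of x "- y"] by (simp add: hom_uminus)

lemma hom_sum: "h (sum f A) = (\<Sum>a\<in>A. h (f a))"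
  by (induction A rule: infinite_finite_induct) (simp_all add: hom_add)

lemma hom_sign: "h ((- 1) ^ k) = (- 1) ^ k"
  by (cases "even k") (simp_all add: hom_uminus)

lemma hom_if_zero: "h (if P then x else 0) = (if P then h x else 0)"
  by simp

end

lemma subst_hom: "finite_fibres \<rho> \<Longrightarrow> unital_ring_hom (mps_subst \<rho> a)"
  for a :: "'v \<Rightarrow> 'a::comm_ring_1"
  by unfold_locales (simp_all add: subst_add subst_mult subst_one)

lemma hom_compose: "unital_ring_hom f \<Longrightarrow> unital_ring_hom g \<Longrightarrow> unital_ring_hom (g \<circ> f)"
  by (simp add: unital_ring_hom_def)

lemma finite_fibres_in_xy: "finite_fibres (\<lambda>j. if j < i then Inl j else Inr j)"
  by (rule finite_fibres_inj) (auto simp: inj_def)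

lemma finite_fibres_diagonal: "finite_fibres (case_sum id id)"
proof -
  have "case_sum id id -` {u} \<subseteq> {Inl u, Inr u}" for u by (auto split: sum.splits)
  then show ?thesis unfolding finite_fibres_def by (meson finite.emptyI finite_insert finite_subset)
qed

lemma finite_fibres_id: "finite_fibres id" by (rule finite_fibres_inj) simp

lemma finite_fibres_sum: "finite_fibres Inl" "finite_fibres Inr"
  by (auto intro!: finite_fibres_inj)

lemmas finite_fibres_simps [simp] = finite_fibres_in_xy finite_fibres_diagonal finite_fibres_id
  finite_fibres_sum

interpretation in_x: unital_ring_hom in_x
  unfolding in_x_def by (rule subst_hom) simp
interpretation in_y: unital_ring_hom in_y
  unfolding in_y_def by (rule subst_hom) simp
interpretation in_xy: unital_ring_hom "in_xy i" for i
  unfolding in_xy_def by (rule subst_hom) simp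
interpretation diagonal: unital_ring_hom diagonal
  unfolding diagonal_def by (rule subst_hom) simp
interpretation scale: unital_ring_hom "scale t" for t
  unfolding scale_def by (rule subst_hom) simp
interpretation scale_y: unital_ring_hom "scale_y t" for t
  unfolding scale_y_def by (rule subst_hom) simp
interpretation vanish: unital_ring_hom "vanish l" for l
  unfolding vanish_def by (rule scale.unital_ring_hom_axioms)

section \<open>Difference quotients\<close>

text \<open>The quotient of f - f(y := x) by y - x. From x^a (y^b - x^b) = (y - x) (x^a y^(b-1) +
  ... + x^(a+b-1)), the monomial x^p y^q receives the coefficients of x^(p-j) y^(q+j+1) for 0 \<le>
  j \<le> p. The sum is finite, so no notion of convergence is involved.\<close>

lift_definition dquot :: "'v \<Rightarrow> 'v \<Rightarrow> ('v, 'a::comm_ring_1) mps \<Rightarrow> ('v, 'a) mps"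
  is "\<lambda>x y f M. \<Sum>j\<le>count M x. f (M - replicate_mset j x + replicate_mset (Suc j) y)" .

definition identify :: "'v \<Rightarrow> 'v \<Rightarrow> ('v, 'a::comm_ring_1) mps \<Rightarrow> ('v, 'a) mps" where
  "identify x y = mps_subst (id(y := x)) (\<lambda>_. 1)"

lemma finite_fibres_identify [simp]: "finite_fibres (id(y := x))"
proof -
  have "id(y := x) -` {u} \<subseteq> {u, y}" for u by (auto split: if_splits)
  then show ?thesis unfolding finite_fibres_def by (meson finite.emptyI finite_insert finite_subset)
qed

interpretation identify: unital_ring_hom "identify x y" for x y
  unfolding identify_def by (rule subst_hom) simp

lemma count_image_identify:
  "x \<noteq> y \<Longrightarrow> count (image_mset (id(y := x)) N) z =
    (if z = y then 0 else if z = x then count N x + count N y else count N z)"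
  by (induction N) auto

lemma identify_fibre:
  assumes "x \<noteq> y"
  shows "{N. image_mset (id(y := x)) N = M} = (if y \<in># M then {}
    else (\<lambda>j. M - replicate_mset j x + replicate_mset j y) ` {..count M x})" (is "?L = ?R")
proof (intro equalityI subsetI)
  fix N assume "N \<in> ?L"
  then have M: "M = image_mset (id(y := x)) N" by simp
  have "y \<notin># M" unfolding not_in_iff M count_image_identify[OF assms] by simp
  moreover have "N = M - replicate_mset (count N y) x + replicate_mset (count N y) y"
    using assms by (auto simp: M multiset_eq_iff count_image_identify)
  moreover have "count N y \<le> count M x"
    using assms by (simp add: M count_image_identify)
  ultimately show "N \<in> ?R" by auto
next
  fix N assume "N \<in> ?R"
  then obtain j where j: "y \<notin># M" "j \<le> count M x"
    and N: "N = M - replicate_mset j x + replicate_mset j y" by (auto split: if_splits)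
  then show "N \<in> ?L" using assms
    by (auto simp: multiset_eq_iff count_image_identify not_in_iff)
qed

lemma coeff_identify:
  assumes "x \<noteq> y"
  shows "mps_coeff (identify x y f) M = (if y \<in># M then 0
    else \<Sum>j\<le>count M x. mps_coeff f (M - replicate_mset j x + replicate_mset j y))"
proof -
  have "inj_on (\<lambda>j. M - replicate_mset j x + replicate_mset j y) {..count M x}" if "y \<notin># M"
  proof (rule inj_onI)
    fix i j assume "M - replicate_mset i x + replicate_mset i y
      = M - replicate_mset j x + replicate_mset j y"
    then have "count (M - replicate_mset i x + replicate_mset i y) y
      = count (M - replicate_mset j x + replicate_mset j y) y" by simp
    then show "i = j" using assms that by (simp add: not_in_iff)
  qed
  then show ?thesis
    by (simp add: identify_def mps_subst.rep_eq identify_fibre[OF assms] sum.reindex)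
qed

text \<open>With \<open>?c j\<close> the coefficient after turning j copies of x into y,
  multiplication by x shifts j by one. If y occurs in M, the two sums differ by \<open>?c 0\<close>,
  the coefficient of f; if not, only the x-sum is present, and it is the coefficient of
  \<open>identify x y f\<close> without \<open>?c 0\<close>.\<close>

lemma dquot_mult:
  assumes "x \<noteq> y"
  shows "(mps_var y - mps_var x) * dquot x y f = f - identify x y f"
proof (rule mps_eqI)
  fix M
  let ?c = "\<lambda>j. mps_coeff f (M - replicate_mset j x + replicate_mset j y)"
  have y: "mps_coeff (mps_var y * dquot x y f) M = (if y \<in># M then \<Sum>j\<le>count M x. ?c j else 0)"
  proof -
    have "M - {#y#} - replicate_mset j x + replicate_mset (Suc j) y
        = M - replicate_mset j x + replicate_mset j y" if "y \<in># M" for j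
      using that assms by (auto simp: multiset_eq_iff)
    then show ?thesis using assms by (simp add: mps_coeff_var_times dquot.rep_eq del: replicate_mset_Suc)
  qed
  have x: "mps_coeff (mps_var x * dquot x y f) M = (\<Sum>j<count M x. ?c (Suc j))"
  proof (cases "x \<in># M")
    case True
    then obtain b where b: "count M x = Suc b" using not0_implies_Suc by fastforce
    have "M - {#x#} - replicate_mset j x + replicate_mset (Suc j) y
        = M - replicate_mset (Suc j) x + replicate_mset (Suc j) y" for j
      by (auto simp: multiset_eq_iff)
    with True b show ?thesis
      by (simp add: mps_coeff_var_times dquot.rep_eq lessThan_Suc_atMost del: replicate_mset_Suc)
  next
    case False
    then have "count M x = 0" by (simp add: not_in_iff)
    with False show ?thesis by (simp add: mps_coeff_var_times)
  qed
  have sum: "(\<Sum>j\<le>count M x. ?c j) = mps_coeff f M + (\<Sum>j<count M x. ?c (Suc j))"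
    by (simp add: lessThan_Suc_atMost[symmetric] sum.lessThan_Suc_shift del: sum.lessThan_Suc)
  show "mps_coeff ((mps_var y - mps_var x) * dquot x y f) M = mps_coeff (f - identify x y f) M"
    using sum by (simp add: left_diff_distrib minus_mps.rep_eq x y coeff_identify[OF assms])
qed

lemma dquot_cancel:
  assumes "x \<noteq> y"
  shows "dquot x y ((mps_var y - mps_var x) * f) = f"
proof (rule mps_eqI)
  fix M
  \<comment> \<open>The cut-off above \<open>count M x\<close> matters: multiset subtraction is
    truncated, so the bare formula could give a nonzero coefficient there and spoil the end of the
    telescoping sum.\<close>
  let ?d = "\<lambda>j. if j \<le> count M x
    then mps_coeff f (M - replicate_mset j x + replicate_mset j y) else 0"
  have "mps_coeff ((mps_var y - mps_var x) * f) (M - replicate_mset j x + replicate_mset (Suc j) y)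
      = ?d j - ?d (Suc j)" if "j \<le> count M x" for j
  proof -
    have "M - replicate_mset j x + replicate_mset (Suc j) y - {#x#}
      = M - replicate_mset (Suc j) x + replicate_mset (Suc j) y"
      using assms by (auto simp: multiset_eq_iff)
    moreover have "x \<in># M - replicate_mset j x + replicate_mset (Suc j) y \<longleftrightarrow> Suc j \<le> count M x"
      using assms by (auto simp: Suc_le_eq simp flip: count_greater_zero_iff)
    moreover have "M - replicate_mset j x + replicate_mset (Suc j) y - {#y#}
      = M - replicate_mset j x + replicate_mset j y"
      by simp
    ultimately show ?thesis using that
      by (simp add: left_diff_distrib minus_mps.rep_eq mps_coeff_var_times)
  qed
  then have "mps_coeff (dquot x y ((mps_var y - mps_var x) * f)) M
      = (\<Sum>j\<le>count M x. ?d j - ?d (Suc j))"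
    by (simp add: dquot.rep_eq)
  also have "\<dots> = ?d 0 - ?d (Suc (count M x))"
    by (rule sum_telescope)
  finally show "mps_coeff (dquot x y ((mps_var y - mps_var x) * f)) M = mps_coeff f M"
    by simp
qed

text \<open>Multiplication by y - x has the left inverse \<open>dquot\<close>. This is what
  determines quotients such as \<open>mps_quot\<close> uniquely.\<close>

lemma var_diff_cancel:
  assumes "x \<noteq> y" "(mps_var y - mps_var x) * f = (mps_var y - mps_var x) * g"
  shows "f = (g :: ('v, 'a::comm_ring_1) mps)"
  using assms by (metis dquot_cancel)

lemma dquot_add: "dquot x y (f + g) = dquot x y f + dquot x y g"
  by (rule mps_eqI) (simp add: dquot.rep_eq plus_mps.rep_eq sum.distrib)

lemma dquot_zero [simp]: "dquot x y 0 = 0"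
  by (rule mps_eqI) (simp add: dquot.rep_eq zero_mps.rep_eq)

lemma dquot_uminus: "dquot x y (- f) = - dquot x y f"
  using dquot_add[of x y f "- f"] by (simp add: eq_neg_iff_add_eq_0 add.commute)

lemma dquot_sum: "dquot x y (sum f A) = (\<Sum>a\<in>A. dquot x y (f a))"
  by (induction A rule: infinite_finite_induct) (simp_all add: dquot_add)

lemma dquot_sign: "dquot x y ((- 1) ^ k * f) = (- 1) ^ k * dquot x y f"
  by (cases "even k") (simp_all add: dquot_uminus)

text \<open>\<open>identify x y a = a\<close> says that y does not occur in a. In the Koszul complex
  a will be y_i - x_i for an index i different from that of the quotient.\<close>

lemma dquot_linear:
  assumes "x \<noteq> y" "identify x y a = a"
  shows "dquot x y (a * f) = a * dquot x y f"
proof (rule var_diff_cancel[OF assms(1)])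
  have "(mps_var y - mps_var x) * (a * dquot x y f)
      = a * ((mps_var y - mps_var x) * dquot x y f)" by (rule mult.left_commute)
  then show "(mps_var y - mps_var x) * dquot x y (a * f)
      = (mps_var y - mps_var x) * (a * dquot x y f)"
    using assms by (simp add: dquot_mult identify.hom_mult right_diff_distrib)
qed

text \<open>x must lie in V because the quotient of a power of y contains powers of x.\<close>

lemma series_dquot:
  assumes "f \<in> series V" "x \<in> V"
  shows "dquot x y f \<in> series V"
proof -
  have "set_mset M \<subseteq> V" if "mps_coeff (dquot x y f) M \<noteq> 0" for M
  proof -
    from that obtain j where "mps_coeff f (M - replicate_mset j x + replicate_mset (Suc j) y) \<noteq> 0"
      unfolding dquot.rep_eq by (auto elim: sum.not_neutral_contains_not_neutral)
    then have "set_mset (M - replicate_mset j x + replicate_mset (Suc j) y) \<subseteq> V"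
      using assms(1) unfolding series_def by blast
    moreover have "set_mset M \<subseteq> insert x (set_mset (M - replicate_mset j x))"
      by (auto simp: in_diff_count not_in_iff simp flip: count_greater_zero_iff split: if_splits)
    ultimately show ?thesis using assms(2) by auto
  qed
  then show ?thesis by (simp add: series_def)
qed

section \<open>Partial derivatives\<close>

lemma deriv_diff: "mps_deriv v (f - g) = mps_deriv v f - mps_deriv v g"
  for f :: "('v, 'a::comm_ring_1) mps"
  by (rule mps_eqI) (simp add: mps_deriv.rep_eq minus_mps.rep_eq right_diff_distrib)

lemma deriv_zero [simp]: "mps_deriv v 0 = (0 :: ('v, 'a::comm_ring_1) mps)"
  by (rule mps_eqI) (simp add: mps_deriv.rep_eq zero_mps.rep_eq)

text \<open>The Leibniz rule for a factor that is a variable; together with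
  \<open>deriv_other_var_times\<close> it differentiates (y - x) q.\<close>

lemma deriv_var_times: "mps_deriv v (mps_var v * f) = f + mps_var v * mps_deriv v f"
  for f :: "('v, 'a::comm_ring_1) mps"
proof (rule mps_eqI)
  fix M
  show "mps_coeff (mps_deriv v (mps_var v * f)) M = mps_coeff (f + mps_var v * mps_deriv v f) M"
  proof (cases "v \<in># M")
    case True
    then obtain N where M: "M = add_mset v N" by (metis mset_add)
    then show ?thesis
      by (simp add: mps_deriv.rep_eq plus_mps.rep_eq mps_coeff_var_times distrib_right)
  next
    case False
    then have "count M v = 0" by (simp add: not_in_iff)
    with False show ?thesis
      by (simp add: mps_deriv.rep_eq plus_mps.rep_eq mps_coeff_var_times)
  qed
qed

lemma deriv_other_var_times:
  "u \<noteq> v \<Longrightarrow> mps_deriv v (mps_var u * f) = mps_var u * mps_deriv v f"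
  for f :: "('v, 'a::comm_ring_1) mps"
  by (rule mps_eqI) (auto simp: mps_deriv.rep_eq mps_coeff_var_times add_mset_remove_trivial_If)

lemma deriv_identify: "x \<noteq> y \<Longrightarrow> mps_deriv y (identify x y f) = 0"
  by (rule mps_eqI) (simp add: mps_deriv.rep_eq coeff_identify zero_mps.rep_eq)

text \<open>For injective \<rho> the preimages of a monomial containing \<open>\<rho> v\<close>
  contain v, with the same multiplicity. The scalar is fixed to 1 at v alone, which admits
  \<open>vanish\<close>, where other variables are killed.\<close>

lemma deriv_subst_inj:
  fixes f :: "('v, 'a::comm_ring_1) mps"
  assumes "inj \<rho>" "a v = 1"
  shows "mps_deriv (\<rho> v) (mps_subst \<rho> a f) = mps_subst \<rho> a (mps_deriv v f)"
proof (rule mps_eqI)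
  fix M
  have fib: "{N. image_mset \<rho> N = add_mset (\<rho> v) M} = add_mset v ` {N. image_mset \<rho> N = M}"
    using assms(1) by (auto dest!: msed_map_invR simp: inj_def)
  have count: "count (image_mset \<rho> N) (\<rho> v) = count N v" for N
    using assms(1) by (induction N) (auto simp: inj_def)
  have "mps_coeff (mps_deriv (\<rho> v) (mps_subst \<rho> a f)) M
      = of_nat (count M (\<rho> v) + 1) *
        (\<Sum>N | image_mset \<rho> N = M. (\<Prod>u\<in>#add_mset v N. a u) * mps_coeff f (add_mset v N))"
    by (simp add: mps_deriv.rep_eq mps_subst.rep_eq fib sum.reindex inj_on_def comp_def)
  also have "\<dots> = (\<Sum>N | image_mset \<rho> N = M.
      (\<Prod>u\<in>#N. a u) * (of_nat (count N v + 1) * mps_coeff f (add_mset v N)))"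
    unfolding sum_distrib_left
    by (rule sum.cong) (use assms(2) count in \<open>auto simp: mult.left_commute\<close>)
  also have "\<dots> = mps_coeff (mps_subst \<rho> a (mps_deriv v f)) M"
    by (simp add: mps_deriv.rep_eq mps_subst.rep_eq)
  finally show "mps_coeff (mps_deriv (\<rho> v) (mps_subst \<rho> a f)) M
      = mps_coeff (mps_subst \<rho> a (mps_deriv v f)) M" .
qed

lemma diagonal_var [simp]: "diagonal (mps_var (Inr i) - mps_var (Inl i)) = 0"
  by (simp add: diagonal.hom_diff) (simp add: diagonal_def subst_var)

lemma diagonal_in_xy [simp]: "diagonal (in_xy i f) = f"
proof -
  have "case_sum id id \<circ> (\<lambda>j. if j < i then Inl j else Inr j) = (id :: nat \<Rightarrow> nat)"
    by auto
  then show ?thesis by (simp add: diagonal_def in_xy_def subst_subst)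
qed

lemma identify_in_xy: "identify (Inl i) (Inr i) (in_xy i f) = in_xy (i + 1) f"
proof -
  have "(id(Inr i := Inl i)) \<circ> (\<lambda>j. if j < i then Inl j else Inr j)
      = (\<lambda>j. if j < i + 1 then Inl j else Inr j)"
    by (auto simp: fun_eq_iff)
  then show ?thesis by (simp add: identify_def in_xy_def subst_subst)
qed

text \<open>Resolves the definite description in \<open>mps_quot\<close>: \<open>dquot\<close>
  supplies a quotient, and cancellation of y_i - x_i makes it the only one.\<close>

lemma difference_quot_eq: "difference_quot i f = dquot (Inl i) (Inr i) (in_xy i f)"
  unfolding difference_quot_def mps_quot_def
proof (rule the_equality)
  have "(mps_var (Inr i) - mps_var (Inl i)) * dquot (Inl i) (Inr i) (in_xy i f)
      = in_xy i f - in_xy (i + 1) f"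
    by (simp add: dquot_mult identify_in_xy)
  then show "dquot (Inl i) (Inr i) (in_xy i f) * (mps_var (Inr i) - mps_var (Inl i))
      = in_xy i f - in_xy (i + 1) f"
    by (simp add: mult.commute)
  show "h = dquot (Inl i) (Inr i) (in_xy i f)"
    if "h * (mps_var (Inr i) - mps_var (Inl i)) = in_xy i f - in_xy (i + 1) f" for h
  proof (rule var_diff_cancel)
    show "(mps_var (Inr i) - mps_var (Inl i)) * h
      = (mps_var (Inr i) - mps_var (Inl i)) * dquot (Inl i) (Inr i) (in_xy i f)"
      using that by (simp add: dquot_mult identify_in_xy mult.commute)
  qed simp
qed

lemma difference_quot_mult:
  "(mps_var (Inr i) - mps_var (Inl i)) * difference_quot i f = in_xy i f - in_xy (i + 1) f"
  by (simp add: difference_quot_eq dquot_mult identify_in_xy)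

text \<open>\<open>\<partial>\<close> of \<open>(y - x) q\<close> is \<open>q + (y - x) \<partial>q\<close>, so on the diagonal the difference quotient is a
  partial derivative.\<close>

lemma diagonal_dquot: "diagonal (dquot (Inl i) (Inr i) f) = diagonal (mps_deriv (Inr i) f)"
proof -
  let ?q = "dquot (Inl i) (Inr i) f"
  have "mps_deriv (Inr i) f = mps_deriv (Inr i) (f - identify (Inl i) (Inr i) f)"
    by (simp add: deriv_diff deriv_identify)
  also have "\<dots> = mps_deriv (Inr i) ((mps_var (Inr i) - mps_var (Inl i)) * ?q)"
    by (simp add: dquot_mult)
  also have "\<dots> = ?q + (mps_var (Inr i) - mps_var (Inl i)) * mps_deriv (Inr i) ?q"
    by (simp add: left_diff_distrib deriv_diff deriv_var_times deriv_other_var_times)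
  finally show ?thesis by (simp add: diagonal.hom_add diagonal.hom_mult)
qed

lemma diagonal_difference_quot [simp]: "diagonal (difference_quot i f) = mps_deriv i f"
proof -
  have "mps_deriv (Inr i) (in_xy i f) = in_xy i (mps_deriv i f)"
    using deriv_subst_inj[of "\<lambda>j. if j < i then Inl j else Inr j" "\<lambda>_. 1" i f]
    by (auto simp: in_xy_def inj_def)
  then show ?thesis by (simp add: difference_quot_eq diagonal_dquot)
qed

lemma difference_quot_zero [simp]: "difference_quot i 0 = 0"
  by (simp add: difference_quot_eq)

lemma series_in_xy: "f \<in> series {1..n} \<Longrightarrow> in_xy i f \<in> series (vars_e n)"
  unfolding in_xy_def by (rule series_subst) auto

lemma series_in_x: "f \<in> series {1..n} \<Longrightarrow> in_x f \<in> series (vars_e n)"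
  unfolding in_x_def by (rule series_subst) auto

lemma series_in_y: "f \<in> series {1..n} \<Longrightarrow> in_y f \<in> series (vars_e n)"
  unfolding in_y_def by (rule series_subst) auto

lemma series_diagonal: "f \<in> series (vars_e n) \<Longrightarrow> diagonal f \<in> series {1..n}"
  unfolding diagonal_def by (rule series_subst) auto

lemma series_scale_y: "f \<in> series (vars_e n) \<Longrightarrow> scale_y t f \<in> series (vars_e n)"
  unfolding scale_y_def by (rule series_subst) auto

lemma series_difference_quot:
  "i \<in> {1..n} \<Longrightarrow> f \<in> series {1..n} \<Longrightarrow> difference_quot i f \<in> series (vars_e n)"
  unfolding difference_quot_eq by (intro series_dquot series_in_xy) auto

lemma series_koszul_var:
  "i \<in> {1..n} \<Longrightarrow> mps_var (Inr i) - mps_var (Inl i) \<in> series (vars_e n)"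
  by (auto intro!: series_diff series_var)

text \<open>Membership in \<open>series {1..n}\<close> excludes the variable of index 0, which
  \<open>in_xy 1\<close> sends to the x-side and \<open>in_y\<close> to the y-side.\<close>

lemma in_xy_1: "f \<in> series {1..n} \<Longrightarrow> in_xy 1 f = in_y f"
  unfolding in_xy_def in_y_def
  by (rule subst_cong[where V = "{1..n}"]) (auto intro!: finite_fibres_inj simp: inj_def)

lemma in_xy_Suc: "f \<in> series {1..n} \<Longrightarrow> in_xy (Suc n) f = in_x f"
  unfolding in_xy_def in_x_def by (rule subst_cong) auto

lemma diagonal_in_x [simp]: "diagonal (in_x f) = f"
  by (simp add: diagonal_def in_x_def subst_subst comp_def) (simp flip: id_def)

lemma diagonal_scale_y_in_x [simp]: "diagonal (scale_y t (in_x f)) = f"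
  by (simp add: diagonal_def in_x_def scale_y_def subst_subst comp_def) (simp flip: id_def)

lemma diagonal_scale_y_in_y [simp]: "diagonal (scale_y t (in_y f)) = scale t f"
  by (simp add: diagonal_def in_y_def scale_y_def scale_def subst_subst comp_def) (simp flip: id_def)

text \<open>For i > l nothing is scaled, and for i \<le> l the scaled variables are killed by
  \<open>vanish\<close>.\<close>

lemma vanish_scale_y:
  assumes "f \<in> series (vars_e n)" "\<And>i. i \<in> {l+1..n} \<Longrightarrow> t i = 1"
  shows "vanish l (diagonal (scale_y t f)) = vanish l (diagonal f)"
  unfolding vanish_def scale_def scale_y_def diagonal_def
  using assms by (auto simp: subst_subst intro!: subst_cong split: sum.splits)

lemma deriv_vanish: "l < i \<Longrightarrow> mps_deriv i (vanish l f) = vanish l (mps_deriv i f)"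
  using deriv_subst_inj[of id "\<lambda>i. if i \<le> l then 0 else 1" i f] by (simp add: vanish_def scale_def)

lemma series_vanish: "f \<in> series {1..n} \<Longrightarrow> vanish l f \<in> series {l+1..n}"
  unfolding vanish_def scale_def by (rule series_subst) auto

section \<open>Matrix factorizations\<close>

lemma mat_mult_nonzero:
  assumes "mat_mult B \<psi> \<phi> d b \<noteq> 0"
  obtains c where "c \<in> B" "\<psi> d c \<noteq> 0" "\<phi> c b \<noteq> 0"
proof -
  from assms obtain c where "c \<in> B" "\<psi> d c * \<phi> c b \<noteq> 0"
    unfolding mat_mult_def by (auto elim: sum.not_neutral_contains_not_neutral)
  then have "\<psi> d c \<noteq> 0" "\<phi> c b \<noteq> 0" by auto
  with \<open>c \<in> B\<close> show ?thesis by (rule that)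
qed

lemma mat_mult_assoc:
  "mat_mult B (mat_mult C \<chi> \<psi>) \<phi> = mat_mult C \<chi> (mat_mult B \<psi> \<phi>)"
  by (auto simp: mat_mult_def fun_eq_iff sum_distrib_left sum_distrib_right mult.assoc
      intro: sum.swap)

lemma mat_mult_add_left:
  "mat_mult B (\<lambda>c b. \<psi> c b + \<psi>' c b) \<phi> = (\<lambda>c b. mat_mult B \<psi> \<phi> c b + mat_mult B \<psi>' \<phi> c b)"
  by (simp add: mat_mult_def distrib_right sum.distrib)

lemma mat_mult_add_right:
  "mat_mult B \<psi> (\<lambda>c b. \<phi> c b + \<phi>' c b) = (\<lambda>c b. mat_mult B \<psi> \<phi> c b + mat_mult B \<psi> \<phi>' c b)"
  by (simp add: mat_mult_def distrib_left sum.distrib)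

lemma mat_mult_diff_left:
  "mat_mult B (\<lambda>c b. \<psi> c b - \<psi>' c b) \<phi> = (\<lambda>c b. mat_mult B \<psi> \<phi> c b - mat_mult B \<psi>' \<phi> c b)"
  by (simp add: mat_mult_def left_diff_distrib sum_subtractf)

lemma mat_mult_diff_right:
  "mat_mult B \<psi> (\<lambda>c b. \<phi> c b - \<phi>' c b) = (\<lambda>c b. mat_mult B \<psi> \<phi> c b - mat_mult B \<psi> \<phi>' c b)"
  by (simp add: mat_mult_def right_diff_distrib sum_subtractf)

lemma mat_mult_scale_left:
  "mat_mult B (\<lambda>c b. r * \<psi> c b) \<phi> = (\<lambda>c b. r * mat_mult B \<psi> \<phi> c b)"
  by (simp add: mat_mult_def mult.assoc sum_distrib_left)

lemma mat_mult_scale_right: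
  "mat_mult B \<psi> (\<lambda>c b. r * \<phi> c b) = (\<lambda>c b. r * mat_mult B \<psi> \<phi> c b)"
  by (simp add: mat_mult_def mult.left_commute sum_distrib_left)

lemma mat_mult_uminus_left:
  "mat_mult B (\<lambda>c b. - \<psi> c b) \<phi> = (\<lambda>c b. - mat_mult B \<psi> \<phi> c b)"
  by (simp add: mat_mult_def sum_negf)

lemma mat_mult_sum_right:
  "mat_mult B \<psi> (\<lambda>c b. \<Sum>i\<in>I. \<phi> i c b) = (\<lambda>c b. \<Sum>i\<in>I. mat_mult B \<psi> (\<phi> i) c b)"
  by (auto simp: mat_mult_def fun_eq_iff sum_distrib_left intro: sum.swap)

text \<open>The scalar matrix is cut off outside B, so it acts as a scalar only on matrices whose
  rows outside B vanish.\<close>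

lemma mat_mult_scalar_left:
  assumes "finite B" "\<And>c b. \<phi> c b \<noteq> 0 \<Longrightarrow> c \<in> B"
  shows "mat_mult B (\<lambda>c b. if c = b \<and> b \<in> B then r else 0) \<phi> = (\<lambda>c b. r * \<phi> c b)"
proof (intro ext)
  fix c b
  have "mat_mult B (\<lambda>c b. if c = b \<and> b \<in> B then r else 0) \<phi> c b
      = (\<Sum>c'\<in>B. if c' = c then r * \<phi> c b else 0)"
    unfolding mat_mult_def by (rule sum.cong) auto
  then show "mat_mult B (\<lambda>c b. if c = b \<and> b \<in> B then r else 0) \<phi> c b = r * \<phi> c b"
    using assms by (cases "\<phi> c b = 0") auto
qed

lemma mat_mult_scalar_right:
  assumes "finite B" "\<And>c b. \<phi> c b \<noteq> 0 \<Longrightarrow> b \<in> B"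
  shows "mat_mult B \<phi> (\<lambda>c b. if c = b \<and> b \<in> B then r else 0) = (\<lambda>c b. r * \<phi> c b)"
proof (intro ext)
  fix c b
  have "mat_mult B \<phi> (\<lambda>c b. if c = b \<and> b \<in> B then r else 0) c b
      = (\<Sum>c'\<in>B. if c' = b then r * \<phi> c b else 0)"
    unfolding mat_mult_def by (rule sum.cong) auto
  then show "mat_mult B \<phi> (\<lambda>c b. if c = b \<and> b \<in> B then r else 0) c b = r * \<phi> c b"
    using assms by (cases "\<phi> c b = 0") auto
qed

section \<open>Morphisms and their differential\<close>

lemma mat_mult_homs:
  assumes "\<psi> \<in> homs V Y Z" "\<phi> \<in> homs V X Y"
  shows "mat_mult (mf_basis Y) \<psi> \<phi> \<in> homs V X Z"
proof -
  have "mat_mult (mf_basis Y) \<psi> \<phi> d b \<in> series V" for d b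
    using assms unfolding mat_mult_def homs_def by (auto intro!: series_sum series_mult)
  moreover have "d \<in> mf_basis Z \<and> b \<in> mf_basis X" if "mat_mult (mf_basis Y) \<psi> \<phi> d b \<noteq> 0" for d b
    using that assms by (elim mat_mult_nonzero) (auto simp: homs_def)
  ultimately show ?thesis by (simp add: homs_def)
qed

lemma homs_add: "\<phi> \<in> homs V X Y \<Longrightarrow> \<psi> \<in> homs V X Y \<Longrightarrow> (\<lambda>c b. \<phi> c b + \<psi> c b) \<in> homs V X Y"
  unfolding homs_def by (auto intro: series_add) (metis add_0)+

lemma homs_diff: "\<phi> \<in> homs V X Y \<Longrightarrow> \<psi> \<in> homs V X Y \<Longrightarrow> (\<lambda>c b. \<phi> c b - \<psi> c b) \<in> homs V X Y"
  unfolding homs_def by (auto intro: series_diff) (metis diff_self)+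

lemma even_homs_add:
  "\<phi> \<in> even_homs V X Y \<Longrightarrow> \<psi> \<in> even_homs V X Y \<Longrightarrow> (\<lambda>c b. \<phi> c b + \<psi> c b) \<in> even_homs V X Y"
  unfolding even_homs_def by (auto intro: homs_add) (metis add_0)+

lemma even_homs_diff:
  "\<phi> \<in> even_homs V X Y \<Longrightarrow> \<psi> \<in> even_homs V X Y \<Longrightarrow> (\<lambda>c b. \<phi> c b - \<psi> c b) \<in> even_homs V X Y"
  unfolding even_homs_def by (auto intro: homs_diff) (metis diff_self)+

lemma odd_homs_add:
  "\<phi> \<in> odd_homs V X Y \<Longrightarrow> \<psi> \<in> odd_homs V X Y \<Longrightarrow> (\<lambda>c b. \<phi> c b + \<psi> c b) \<in> odd_homs V X Y"
  unfolding odd_homs_def by (auto intro: homs_add) (metis add_0)+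

lemma odd_homs_diff:
  "\<phi> \<in> odd_homs V X Y \<Longrightarrow> \<psi> \<in> odd_homs V X Y \<Longrightarrow> (\<lambda>c b. \<phi> c b - \<psi> c b) \<in> odd_homs V X Y"
  unfolding odd_homs_def by (auto intro: homs_diff) (metis diff_self)+

lemma homs_zero: "(\<lambda>_ _. 0) \<in> homs V X Y"
  by (simp add: homs_def)

lemma odd_homs_zero: "(\<lambda>_ _. 0) \<in> odd_homs V X Y"
  by (simp add: odd_homs_def homs_zero)

lemma hom_diff_add:
  "hom_diff X Y (\<lambda>c b. \<phi> c b + \<psi> c b) = (\<lambda>c b. hom_diff X Y \<phi> c b + hom_diff X Y \<psi> c b)"
  by (simp add: hom_diff_def mat_mult_def distrib_left distrib_right sum.distrib fun_eq_iff algebra_simps)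

lemma hom_diff_diff:
  "hom_diff X Y (\<lambda>c b. \<phi> c b - \<psi> c b) = (\<lambda>c b. hom_diff X Y \<phi> c b - hom_diff X Y \<psi> c b)"
  by (simp add: hom_diff_def mat_mult_def left_diff_distrib right_diff_distrib sum_subtractf fun_eq_iff
      algebra_simps sum.distrib sum_negf)

lemma hom_diff_zero [simp]: "hom_diff X Y (\<lambda>_ _. 0) = (\<lambda>_ _. 0)"
  by (simp add: hom_diff_def mat_mult_def)

lemma hom_diff_even:
  assumes "\<phi> \<in> even_homs V X Y"
  shows "hom_diff X Y \<phi> = (\<lambda>c b. mat_mult (mf_basis Y) (mf_diff Y) \<phi> c b
    - mat_mult (mf_basis X) \<phi> (mf_diff X) c b)"
proof -
  have "(\<lambda>c b. parity_sign (mf_odd Y c \<noteq> mf_odd X b) * \<phi> c b) = \<phi>"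
  proof (intro ext)
    fix c b
    show "parity_sign (mf_odd Y c \<noteq> mf_odd X b) * \<phi> c b = \<phi> c b"
      using assms by (cases "\<phi> c b = 0") (auto simp: even_homs_def)
  qed
  then show ?thesis by (simp add: hom_diff_def)
qed

lemma hom_diff_odd:
  assumes "\<phi> \<in> odd_homs V X Y"
  shows "hom_diff X Y \<phi> = (\<lambda>c b. mat_mult (mf_basis Y) (mf_diff Y) \<phi> c b
    + mat_mult (mf_basis X) \<phi> (mf_diff X) c b)"
proof -
  have "(\<lambda>c b. parity_sign (mf_odd Y c \<noteq> mf_odd X b) * \<phi> c b) = (\<lambda>c b. - \<phi> c b)"
  proof (intro ext)
    fix c b
    show "parity_sign (mf_odd Y c \<noteq> mf_odd X b) * \<phi> c b = - \<phi> c b"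
      using assms by (cases "\<phi> c b = 0") (auto simp: odd_homs_def)
  qed
  then show ?thesis by (simp add: hom_diff_def mat_mult_uminus_left)
qed

lemma is_mfD:
  assumes "is_mf V f X"
  shows "finite (mf_basis X)" "mf_diff X \<in> odd_homs V X X" "mf_diff X \<in> homs V X X"
    "mf_diff X c b \<in> series V" "mf_diff X c b \<noteq> 0 \<Longrightarrow> c \<in> mf_basis X"
    "mf_diff X c b \<noteq> 0 \<Longrightarrow> b \<in> mf_basis X"
    "mf_diff X c b \<noteq> 0 \<Longrightarrow> mf_odd X c \<longleftrightarrow> \<not> mf_odd X b"
    "mat_mult (mf_basis X) (mf_diff X) (mf_diff X)
      = (\<lambda>c b. if c = b \<and> b \<in> mf_basis X then f else 0)"
  using assms by (auto simp: is_mf_def odd_homs_def homs_def)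

text \<open>Left and right composition with the differentials, L and R, commute and both square to
  multiplication by f. On an odd morphism the differential is L + R, on the resulting even one L -
  R, and the composite of the two is 0.\<close>

lemma hom_diff_closed:
  assumes X: "is_mf V f X" and Y: "is_mf V f Y" and \<phi>: "\<phi> \<in> odd_homs V X Y"
  shows "hom_diff X Y \<phi> \<in> closed_homs V X Y" "hom_diff X Y \<phi> \<in> even_homs V X Y"
proof -
  note X' = is_mfD[OF X] and Y' = is_mfD[OF Y]
  let ?L = "mat_mult (mf_basis Y) (mf_diff Y)" and ?R = "\<lambda>\<phi>. mat_mult (mf_basis X) \<phi> (mf_diff X)"
  have \<phi>': "\<phi> \<in> homs V X Y" using \<phi> by (simp add: odd_homs_def)
  have supp: "c \<in> mf_basis Y" "b \<in> mf_basis X" if "\<phi> c b \<noteq> 0" for c b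
    using that \<phi>' by (auto simp: homs_def)
  have L: "?L \<phi> \<in> homs V X Y" and R: "?R \<phi> \<in> homs V X Y"
    using mat_mult_homs X'(3) Y'(3) \<phi>' by blast+
  have "mf_odd Y c = mf_odd X b" if nz: "hom_diff X Y \<phi> c b \<noteq> 0" for c b
  proof -
    from nz have "?L \<phi> c b \<noteq> 0 \<or> ?R \<phi> c b \<noteq> 0"
      by (auto simp: hom_diff_odd[OF \<phi>])
    then show ?thesis
    proof
      assume "?L \<phi> c b \<noteq> 0"
      then obtain c' where "mf_diff Y c c' \<noteq> 0" "\<phi> c' b \<noteq> 0" by (rule mat_mult_nonzero)
      then show ?thesis using Y'(7) \<phi> unfolding odd_homs_def by blast
    next
      assume "?R \<phi> c b \<noteq> 0"
      then obtain b' where "\<phi> c b' \<noteq> 0" "mf_diff X b' b \<noteq> 0" by (rule mat_mult_nonzero)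
      then show ?thesis using X'(7) \<phi> unfolding odd_homs_def by blast
    qed
  qed
  moreover have "hom_diff X Y \<phi> \<in> homs V X Y"
    unfolding hom_diff_odd[OF \<phi>] by (rule homs_add[OF L R])
  ultimately show ev: "hom_diff X Y \<phi> \<in> even_homs V X Y"
    by (simp add: even_homs_def)
  have "?L (?L \<phi>) = (\<lambda>c b. f * \<phi> c b)"
    by (simp add: mat_mult_assoc[symmetric] Y' mat_mult_scalar_left supp)
  moreover have "?R (?R \<phi>) = (\<lambda>c b. f * \<phi> c b)"
    by (simp add: mat_mult_assoc X' mat_mult_scalar_right supp)
  ultimately have "hom_diff X Y (hom_diff X Y \<phi>) = (\<lambda>_ _. 0)"
    unfolding hom_diff_even[OF ev] unfolding hom_diff_odd[OF \<phi>]
    by (simp add: mat_mult_add_left mat_mult_add_right mat_mult_assoc)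
  with ev show "hom_diff X Y \<phi> \<in> closed_homs V X Y"
    by (simp add: closed_homs_def even_homs_def)
qed

section \<open>Base change, dual and tensor product\<close>

lemma is_mf_map:
  assumes "is_mf V f X" "unital_ring_hom \<theta>" "\<And>g. g \<in> series V \<Longrightarrow> \<theta> g \<in> series W"
  shows "is_mf W (\<theta> f) (mf_map \<theta> X)"
proof -
  interpret unital_ring_hom \<theta> by fact
  note X = is_mfD[OF assms(1)]
  have "mat_mult (mf_basis X) (\<lambda>c b. \<theta> (mf_diff X c b)) (\<lambda>c b. \<theta> (mf_diff X c b))
      = (\<lambda>c b. \<theta> (mat_mult (mf_basis X) (mf_diff X) (mf_diff X) c b))"
    by (simp add: mat_mult_def hom_sum hom_mult)
  then have "mat_mult (mf_basis X) (\<lambda>c b. \<theta> (mf_diff X c b)) (\<lambda>c b. \<theta> (mf_diff X c b))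
      = (\<lambda>c b. if c = b \<and> b \<in> mf_basis X then \<theta> f else 0)"
    by (simp add: X(8) hom_if_zero)
  moreover have "c \<in> mf_basis X \<and> b \<in> mf_basis X \<and> mf_odd X c \<noteq> mf_odd X b"
    if "\<theta> (mf_diff X c b) \<noteq> 0" for c b
  proof -
    from that have "mf_diff X c b \<noteq> 0" by auto
    then show ?thesis using X(5-7) by blast
  qed
  moreover have "\<theta> (mf_diff X c b) \<in> series W" for c b
    using X(4) assms(3) by blast
  ultimately show ?thesis
    using X(1) unfolding is_mf_def mf_map_def odd_homs_def homs_def by simp
qed

text \<open>A nonzero entry of the differential joins basis vectors of opposite parity, so the two
  signs met in the square multiply to -1, which turns f into -f.\<close>

lemma is_mf_dual:
  assumes "is_mf V f X"
  shows "is_mf V (- f) (mf_dual X)"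
proof -
  note X = is_mfD[OF assms]
  let ?d = "mf_diff X" and ?s = "\<lambda>b. parity_sign (mf_odd X b)"
  have sign: "(- ?s a * ?d a c) * (- ?s b * ?d b a) = - (?d b a * ?d a c)" for a b c
    using X(7)[of b a] by (cases "?d b a = 0") auto
  have "mat_mult (mf_basis X) (\<lambda>c b. - ?s b * ?d b c) (\<lambda>c b. - ?s b * ?d b c) c b
      = - mat_mult (mf_basis X) ?d ?d b c" for c b
    unfolding mat_mult_def sum_negf[symmetric] by (rule sum.cong[OF refl sign])
  then have "mat_mult (mf_basis X) (\<lambda>c b. - ?s b * ?d b c) (\<lambda>c b. - ?s b * ?d b c)
      = (\<lambda>c b. if c = b \<and> b \<in> mf_basis X then - f else 0)"
    by (auto simp: X(8) fun_eq_iff)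
  then show ?thesis
    using X by (auto simp: is_mf_def mf_dual_def odd_homs_def homs_def intro: series_uminus)
qed

text \<open>This form serves morphisms out of a tensor product; \<open>tensor_row\<close> serves its
  elements.\<close>

lemma tensor_column:
  assumes "finite (mf_basis X)" "finite (mf_basis Y)" "b \<in> mf_basis X" "c \<in> mf_basis Y"
  shows "(\<Sum>q\<in>mf_basis (mf_tensor X Y). \<phi> q * mf_diff (mf_tensor X Y) q (b, c)) =
    (\<Sum>b'\<in>mf_basis X. \<phi> (b', c) * mf_diff X b' b) +
    parity_sign (mf_odd X b) * (\<Sum>c'\<in>mf_basis Y. \<phi> (b, c') * mf_diff Y c' c)"
proof -
  have "(\<Sum>q\<in>mf_basis (mf_tensor X Y). \<phi> q * mf_diff (mf_tensor X Y) q (b, c))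
      = (\<Sum>b'\<in>mf_basis X. \<Sum>c'\<in>mf_basis Y. (if c' = c then \<phi> (b', c) * mf_diff X b' b else 0)
        + (if b' = b then parity_sign (mf_odd X b) * (\<phi> (b, c') * mf_diff Y c' c) else 0))"
    unfolding sum.cartesian_product using assms(3,4)
    by (intro sum.cong) (auto simp: mf_tensor_def distrib_left right_diff_distrib)
  also have "\<dots> = (\<Sum>b'\<in>mf_basis X. \<phi> (b', c) * mf_diff X b' b) +
    parity_sign (mf_odd X b) * (\<Sum>c'\<in>mf_basis Y. \<phi> (b, c') * mf_diff Y c' c)"
    unfolding sum.distrib using assms
    by (intro arg_cong2[where f = "(+)"])
      (simp_all add: sum.swap[of _ "mf_basis Y"] sum_distrib_left)
  finally show ?thesis .
qed

lemma tensor_row: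
  assumes "finite (mf_basis X)" "finite (mf_basis Y)" "b \<in> mf_basis X" "c \<in> mf_basis Y"
  shows "(\<Sum>q\<in>mf_basis (mf_tensor X Y). mf_diff (mf_tensor X Y) (b, c) q * \<phi> q) =
    (\<Sum>b'\<in>mf_basis X. mf_diff X b b' * \<phi> (b', c)) +
    parity_sign (mf_odd X b) * (\<Sum>c'\<in>mf_basis Y. mf_diff Y c c' * \<phi> (b, c'))"
proof -
  have "(\<Sum>q\<in>mf_basis (mf_tensor X Y). mf_diff (mf_tensor X Y) (b, c) q * \<phi> q)
      = (\<Sum>b'\<in>mf_basis X. \<Sum>c'\<in>mf_basis Y. (if c' = c then mf_diff X b b' * \<phi> (b', c) else 0)
        + (if b' = b then parity_sign (mf_odd X b) * (mf_diff Y c c' * \<phi> (b, c')) else 0))"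
    unfolding sum.cartesian_product using assms(3,4)
    by (intro sum.cong) (auto simp: mf_tensor_def distrib_right left_diff_distrib)
  also have "\<dots> = (\<Sum>b'\<in>mf_basis X. mf_diff X b b' * \<phi> (b', c)) +
    parity_sign (mf_odd X b) * (\<Sum>c'\<in>mf_basis Y. mf_diff Y c c' * \<phi> (b, c'))"
    unfolding sum.distrib using assms
    by (intro arg_cong2[where f = "(+)"])
      (simp_all add: sum.swap[of _ "mf_basis Y"] sum_distrib_left)
  finally show ?thesis .
qed

lemma is_mf_tensor:
  assumes X: "is_mf V f X" and Y: "is_mf V g Y"
  shows "is_mf V (f + g) (mf_tensor X Y)"
proof -
  note X' = is_mfD[OF X] and Y' = is_mfD[OF Y]
  let ?T = "mf_tensor X Y" and ?s = "\<lambda>b. parity_sign (mf_odd X b)"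
  let ?d = "mf_diff ?T"
  have supp: "b' \<in> mf_basis X \<and> c' \<in> mf_basis Y \<and> b \<in> mf_basis X \<and> c \<in> mf_basis Y"
    if "?d (b', c') (b, c) \<noteq> 0" for b' c' b c
    using that X'(5,6) Y'(5,6) by (auto simp: mf_tensor_def split: if_splits)
  have odd: "mf_odd ?T q \<noteq> mf_odd ?T q'" if "?d q q' \<noteq> 0" for q q'
  proof -
    have "mf_diff X a a = 0" "mf_diff Y a' a' = 0" for a a'
      using X'(7)[of a a] Y'(7)[of a' a'] by auto
    then show ?thesis
      using that X'(7) Y'(7) by (cases q; cases q') (auto simp: mf_tensor_def split: if_splits)
  qed
  have ser: "?d q q' \<in> series V" for q q'
    using X'(4) Y'(4) by (cases q; cases q') (auto simp: mf_tensor_def intro!: series_add series_diff series_uminus)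
  have sq: "mat_mult (mf_basis ?T) ?d ?d (b', c') (b, c)
      = (if (b', c') = (b, c) \<and> (b, c) \<in> mf_basis ?T then f + g else 0)" for b' c' b c
  proof (cases "b' \<in> mf_basis X \<and> c' \<in> mf_basis Y \<and> b \<in> mf_basis X \<and> c \<in> mf_basis Y")
    case False
    have "mat_mult (mf_basis ?T) ?d ?d (b', c') (b, c) = 0"
    proof (rule ccontr)
      assume "mat_mult (mf_basis ?T) ?d ?d (b', c') (b, c) \<noteq> 0"
      then obtain q where "?d (b', c') q \<noteq> 0" "?d q (b, c) \<noteq> 0" by (rule mat_mult_nonzero)
      with False show False using supp by (cases q) blast
    qed
    then show ?thesis using False by (auto simp: mf_tensor_def)
  next
    case True
    have "mat_mult (mf_basis ?T) ?d ?d (b', c') (b, c)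
      = (\<Sum>p\<in>mf_basis X. ?d (b', c') (p, c) * mf_diff X p b) +
        ?s b * (\<Sum>p\<in>mf_basis Y. ?d (b', c') (b, p) * mf_diff Y p c)"
      unfolding mat_mult_def using True X' Y' by (intro tensor_column) auto
    also have "(\<Sum>p\<in>mf_basis X. ?d (b', c') (p, c) * mf_diff X p b)
      = (if c' = c then mat_mult (mf_basis X) (mf_diff X) (mf_diff X) b' b else 0)
        + ?s b' * mf_diff Y c' c * mf_diff X b' b"
    proof -
      have "(\<Sum>p\<in>mf_basis X. ?d (b', c') (p, c) * mf_diff X p b)
        = (\<Sum>p\<in>mf_basis X. (if c' = c then mf_diff X b' p * mf_diff X p b else 0)
          + (if p = b' then ?s b' * mf_diff Y c' c * mf_diff X b' b else 0))"
        using True by (intro sum.cong) (auto simp: mf_tensor_def distrib_right)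
      then show ?thesis using True X'(1) by (simp add: sum.distrib mat_mult_def)
    qed
    also have "(\<Sum>p\<in>mf_basis Y. ?d (b', c') (b, p) * mf_diff Y p c)
      = mf_diff X b' b * mf_diff Y c' c
        + (if b' = b then ?s b * mat_mult (mf_basis Y) (mf_diff Y) (mf_diff Y) c' c else 0)"
    proof -
      have "(\<Sum>p\<in>mf_basis Y. ?d (b', c') (b, p) * mf_diff Y p c)
        = (\<Sum>p\<in>mf_basis Y. (if p = c' then mf_diff X b' b * mf_diff Y c' c else 0)
          + (if b' = b then ?s b * (mf_diff Y c' p * mf_diff Y p c) else 0))"
        using True by (intro sum.cong) (auto simp: mf_tensor_def distrib_right)
      then show ?thesis using True Y'(1) by (simp add: sum.distrib mat_mult_def sum_distrib_left)
    qed
    also have "(if c' = c then mat_mult (mf_basis X) (mf_diff X) (mf_diff X) b' b else 0)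
        + ?s b' * mf_diff Y c' c * mf_diff X b' b
        + ?s b * (mf_diff X b' b * mf_diff Y c' c
        + (if b' = b then ?s b * mat_mult (mf_basis Y) (mf_diff Y) (mf_diff Y) c' c else 0))
      = (if (b', c') = (b, c) \<and> (b, c) \<in> mf_basis ?T then f + g else 0)"
    proof -
      \<comment> \<open>The mixed terms cancel: a nonzero entry of \<open>mf_diff X\<close> changes
        the parity in the first factor, so the two signs are opposite.\<close>
      have "?s b' * mf_diff Y c' c * mf_diff X b' b + ?s b * (mf_diff X b' b * mf_diff Y c' c) = 0"
        using X'(7)[of b' b] by (cases "mf_diff X b' b = 0") (auto simp: mult.commute)
      then show ?thesis using True
        by (auto simp: X'(8) Y'(8) mf_tensor_def algebra_simps)
    qed
    finally show ?thesis .
  qed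
  have supp': "q \<in> mf_basis ?T \<and> q' \<in> mf_basis ?T" if "?d q q' \<noteq> 0" for q q'
    using supp[of "fst q" "snd q" "fst q'" "snd q'"] that
    by (cases q; cases q') (simp add: mf_tensor_def)
  have sq': "mat_mult (mf_basis ?T) ?d ?d
      = (\<lambda>q' q. if q' = q \<and> q \<in> mf_basis ?T then f + g else 0)"
  proof (intro ext)
    fix q' q
    show "mat_mult (mf_basis ?T) ?d ?d q' q = (if q' = q \<and> q \<in> mf_basis ?T then f + g else 0)"
      using sq[of "fst q'" "snd q'" "fst q" "snd q"] by (simp only: prod.collapse)
  qed
  have "finite (mf_basis ?T)" using X'(1) Y'(1) by (simp add: mf_tensor_def)
  moreover have "?d \<in> odd_homs V ?T ?T"
    unfolding odd_homs_def homs_def using odd ser supp' by blast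
  ultimately show ?thesis unfolding is_mf_def using sq' by blast
qed

section \<open>Koszul matrix factorizations\<close>

definition koszul_sign :: "nat \<Rightarrow> nat set \<Rightarrow> 'r::comm_ring_1" where
  "koszul_sign i J = (- 1) ^ card {j \<in> J. j < i}"

text \<open>Wedging with e_i and contracting with its dual both toggle i in the index set, so one
  involution treats both halves of the Koszul differential.\<close>

definition flip :: "'i \<Rightarrow> 'i set \<Rightarrow> 'i set" where
  "flip i J = (if i \<in> J then J - {i} else insert i J)"

text \<open>The Koszul differential seen from its output: the coefficient at J comes from
  \<open>flip i J\<close>, through the wedge with e_i if i is in J and through the contraction
  otherwise.\<close>

definition koszul_op ::
    "nat set \<Rightarrow> (nat \<Rightarrow> 'r) \<Rightarrow> (nat \<Rightarrow> 'r) \<Rightarrow> (nat set \<Rightarrow> 'r) \<Rightarrow> nat set \<Rightarrow> 'r::comm_ring_1" where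
  "koszul_op I a b z J =
    (\<Sum>i\<in>I. koszul_sign i J * ((if i \<in> J then a i else b i) * z (flip i J)))"

lemma flip_flip [simp]: "flip i (flip i J) = J"
  by (auto simp: flip_def)

lemma flip_commute: "flip i (flip k J) = flip k (flip i J)"
  by (auto simp: flip_def)

lemma mem_flip: "k \<in> flip i J \<longleftrightarrow> (if k = i then i \<notin> J else k \<in> J)"
  by (auto simp: flip_def)

lemma flip_subset: "i \<in> I \<Longrightarrow> flip i J \<subseteq> I \<longleftrightarrow> J \<subseteq> I"
  by (auto simp: flip_def)

lemma koszul_sign_squared: "koszul_sign i J * koszul_sign i J = 1"
  by (simp add: koszul_sign_def power_add[symmetric] mult_2[symmetric])

lemma koszul_sign_flip_ge: "k \<le> i \<Longrightarrow> koszul_sign k (flip i J) = koszul_sign k J"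
proof -
  assume "k \<le> i"
  then have "{j \<in> flip i J. j < k} = {j \<in> J. j < k}" by (auto simp: flip_def split: if_splits)
  then show ?thesis by (simp add: koszul_sign_def)
qed

text \<open>Toggling a smaller index changes by one the number of indices to be passed; this is the
  anticommutativity of the exterior algebra.\<close>

lemma koszul_sign_flip_less:
  assumes "i < k"
  shows "koszul_sign k (flip i J) = - koszul_sign k J"
proof (cases "i \<in> J")
  case True
  then have "{j \<in> J. j < k} = insert i {j \<in> flip i J. j < k}" "i \<notin> {j \<in> flip i J. j < k}"
    using assms by (auto simp: flip_def)
  then have "card {j \<in> J. j < k} = Suc (card {j \<in> flip i J. j < k})" by simp
  then show ?thesis by (simp add: koszul_sign_def)
next
  case False
  then have "{j \<in> flip i J. j < k} = insert i {j \<in> J. j < k}" "i \<notin> {j \<in> J. j < k}"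
    using assms by (auto simp: flip_def)
  then have "card {j \<in> flip i J. j < k} = Suc (card {j \<in> J. j < k})" by simp
  then show ?thesis by (simp add: koszul_sign_def)
qed

lemma odd_card_flip:
  assumes "finite J"
  shows "odd (card (flip i J)) \<longleftrightarrow> even (card J)"
proof (cases "i \<in> J")
  case True
  then have "card J = Suc (card (J - {i}))" using assms by (metis card_Suc_Diff1)
  with True show ?thesis by (simp add: flip_def)
next
  case False
  then show ?thesis using assms by (simp add: flip_def)
qed

text \<open>The terms (i, k) and (k, i) with i < k toggle the same two indices, and only the sign of
  the larger index sees the other toggle, so they cancel. In a term (i, i) one of the two toggles is
  a wedge and the other a contraction, which gives \<open>a i * b i\<close>.\<close>

lemma koszul_op_koszul_op:
  assumes "finite I"
  shows "koszul_op I a b (koszul_op I a b z) J = (\<Sum>i\<in>I. a i * b i) * z J"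
proof -
  define s :: "nat \<Rightarrow> nat set \<Rightarrow> 'a" where "s = koszul_sign"
  define \<kappa> where "\<kappa> i = (if i \<in> J then a i else b i)" for i
  define T where "T i k = s i J * \<kappa> i * (s k (flip i J) * (if k \<in> flip i J then a k else b k)
    * z (flip k (flip i J)))" for i k
  have "koszul_op I a b (koszul_op I a b z) J = (\<Sum>i\<in>I. \<Sum>k\<in>I. T i k)"
    unfolding koszul_op_def T_def s_def \<kappa>_def sum_distrib_left mult.assoc by (rule refl)
  also have "\<dots> = (\<Sum>i\<in>I. T i i) + (\<Sum>(i, k) | i \<in> I \<and> k \<in> I \<and> i < k. T i k)
      + (\<Sum>(i, k) | i \<in> I \<and> k \<in> I \<and> k < i. T i k)"
  proof -
    have fin: "finite {(i, k). i \<in> I \<and> k \<in> I \<and> P i k}" for P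
      by (rule finite_subset[of _ "I \<times> I"]) (use assms in auto)
    have "I \<times> I = (\<lambda>i. (i, i)) ` I \<union> {(i, k). i \<in> I \<and> k \<in> I \<and> i < k}
        \<union> {(i, k). i \<in> I \<and> k \<in> I \<and> k < i}"
      by auto
    then have "(\<Sum>i\<in>I. \<Sum>k\<in>I. T i k) = (\<Sum>(i, k)\<in>(\<lambda>i. (i, i)) ` I
        \<union> {(i, k). i \<in> I \<and> k \<in> I \<and> i < k} \<union> {(i, k). i \<in> I \<and> k \<in> I \<and> k < i}. T i k)"
      by (simp add: sum.cartesian_product)
    also have "\<dots> = (\<Sum>(i, k)\<in>(\<lambda>i. (i, i)) ` I \<union> {(i, k). i \<in> I \<and> k \<in> I \<and> i < k}. T i k)
        + (\<Sum>(i, k) | i \<in> I \<and> k \<in> I \<and> k < i. T i k)"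
      using assms fin by (intro sum.union_disjoint) auto
    also have "(\<Sum>(i, k)\<in>(\<lambda>i. (i, i)) ` I \<union> {(i, k). i \<in> I \<and> k \<in> I \<and> i < k}. T i k)
        = (\<Sum>(i, k)\<in>(\<lambda>i. (i, i)) ` I. T i k) + (\<Sum>(i, k) | i \<in> I \<and> k \<in> I \<and> i < k. T i k)"
      using assms fin by (intro sum.union_disjoint) auto
    also have "(\<Sum>(i, k)\<in>(\<lambda>i. (i, i)) ` I. T i k) = (\<Sum>i\<in>I. T i i)"
      by (simp add: sum.reindex inj_on_def)
    finally show ?thesis .
  qed
  also have "(\<Sum>(i, k) | i \<in> I \<and> k \<in> I \<and> k < i. T i k)
      = - (\<Sum>(i, k) | i \<in> I \<and> k \<in> I \<and> i < k. T i k)"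
  proof -
    have "(\<Sum>(i, k) | i \<in> I \<and> k \<in> I \<and> k < i. T i k)
        = (\<Sum>(i, k) | i \<in> I \<and> k \<in> I \<and> i < k. - T i k)"
      by (rule sum.reindex_bij_witness[where i = "\<lambda>(i, k). (k, i)" and j = "\<lambda>(i, k). (k, i)"])
        (auto simp: T_def s_def \<kappa>_def mem_flip koszul_sign_flip_less koszul_sign_flip_ge
          flip_commute ac_simps)
    also have "\<dots> = - (\<Sum>(i, k) | i \<in> I \<and> k \<in> I \<and> i < k. T i k)"
      by (simp add: sum_negf case_prod_unfold)
    finally show ?thesis .
  qed
  also have "(\<Sum>i\<in>I. T i i) = (\<Sum>i\<in>I. a i * b i) * z J"
  proof -
    have "T i i = s i J * s i J * (a i * b i * z J)" for i
      by (auto simp: T_def s_def \<kappa>_def mem_flip koszul_sign_flip_ge ac_simps)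
    then show ?thesis by (simp add: s_def koszul_sign_squared sum_distrib_right)
  qed
  finally show ?thesis by simp
qed

lemma koszul_simps:
  "mf_basis (koszul I a b) = Pow I" "mf_odd (koszul I a b) J = odd (card J)"
  by (simp_all add: koszul_def)

text \<open>The sign counts indices below i only, so it may be taken at the target \<open>J'\<close>
  instead of the source J, as \<open>koszul_op\<close> does.\<close>

lemma koszul_entry:
  "mf_diff (koszul I a b) J' J = (if J \<subseteq> I
    then \<Sum>i\<in>I. if J' = flip i J then koszul_sign i J' * (if i \<in> J' then a i else b i) else 0
    else 0)"
proof -
  have "(- 1) ^ card {j \<in> J. j < i} * ((if i \<notin> J \<and> J' = insert i J then a i else 0) +
      (if i \<in> J \<and> J' = J - {i} then b i else 0))
    = (if J' = flip i J then koszul_sign i J' * (if i \<in> J' then a i else b i) else 0)" for i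
  proof (cases "J' = flip i J")
    case True
    then have sign: "(- 1) ^ card {j \<in> J. j < i} = (koszul_sign i J' :: ('a, 'b) mps)"
      by (simp add: koszul_sign_flip_ge) (simp add: koszul_sign_def)
    show ?thesis unfolding sign using True by (cases "i \<in> J") (simp_all add: flip_def)
  next
    case False
    then show ?thesis by (cases "i \<in> J") (simp_all add: flip_def)
  qed
  then show ?thesis by (simp add: koszul_def)
qed

lemma koszul_row:
  assumes "finite I" "J \<subseteq> I"
  shows "(\<Sum>K\<in>Pow I. mf_diff (koszul I a b) J K * z K) = koszul_op I a b z J"
proof -
  have "(\<Sum>K\<in>Pow I. mf_diff (koszul I a b) J K * z K)
    = (\<Sum>K\<in>Pow I. \<Sum>i\<in>I. if K = flip i J
        then koszul_sign i J * ((if i \<in> J then a i else b i) * z K) else 0)"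
    by (intro sum.cong) (auto simp: koszul_entry sum_distrib_right mult.assoc intro!: sum.cong)
  also have "\<dots> = koszul_op I a b z J"
    unfolding koszul_op_def using assms
    by (subst sum.swap) (auto simp: flip_subset intro!: sum.cong)
  finally show ?thesis .
qed

lemma koszul_nonzero:
  assumes "finite I" "mf_diff (koszul I a b) J' J \<noteq> 0"
  shows "J' \<subseteq> I" "J \<subseteq> I" "odd (card J') \<longleftrightarrow> even (card J)"
proof -
  from assms(2) show J: "J \<subseteq> I" by (auto simp: koszul_entry split: if_splits)
  with assms(2) obtain i where i: "i \<in> I" "J' = flip i J"
    unfolding koszul_entry by (auto elim!: sum.not_neutral_contains_not_neutral split: if_splits)
  with J show "J' \<subseteq> I" by (simp add: flip_subset)
  show "odd (card J') \<longleftrightarrow> even (card J)"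
    using odd_card_flip[of J i] J assms(1) i(2) finite_subset by blast
qed

lemma is_mf_koszul:
  assumes "finite I" "\<And>i. i \<in> I \<Longrightarrow> a i \<in> series V" "\<And>i. i \<in> I \<Longrightarrow> b i \<in> series V"
  shows "is_mf V (\<Sum>i\<in>I. a i * b i) (koszul I a b)"
proof -
  let ?K = "koszul I a b"
  note nz = koszul_nonzero[OF assms(1)]
  have ser: "mf_diff ?K J' J \<in> series V" for J' J
    using assms(2,3) unfolding koszul_entry koszul_sign_def
    by (auto intro!: series_sum series_mult series_sign)
  have sq: "mat_mult (mf_basis ?K) (mf_diff ?K) (mf_diff ?K) J' J
      = (if J' = J \<and> J \<in> mf_basis ?K then \<Sum>i\<in>I. a i * b i else 0)" for J' J
  proof (cases "J' \<subseteq> I \<and> J \<subseteq> I")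
    case True
    \<comment> \<open>The basis vector with index J. Its image is column J of the matrix, so the
      square of the matrix is read off from applying \<open>koszul_op\<close> twice to z.\<close>
    define z where "z L = (if L = J then 1 else 0 :: ('a, 'b) mps)" for L
    have col: "mf_diff ?K L J = koszul_op I a b z L" if "L \<subseteq> I" for L
    proof -
      have "koszul_op I a b z L = (\<Sum>K\<in>Pow I. if K = J then mf_diff ?K L J else 0)"
        unfolding koszul_row[OF assms(1) that, symmetric] z_def by (intro sum.cong) auto
      then show ?thesis using True assms(1) by simp
    qed
    have "mat_mult (mf_basis ?K) (mf_diff ?K) (mf_diff ?K) J' J
        = koszul_op I a b (\<lambda>L. mf_diff ?K L J) J'"
      using True by (simp add: mat_mult_def koszul_simps koszul_row[OF assms(1)])
    also have "\<dots> = koszul_op I a b (koszul_op I a b z) J'"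
      unfolding koszul_op_def[of I a b "\<lambda>L. mf_diff ?K L J"]
        koszul_op_def[of I a b "koszul_op I a b z"]
      using True by (intro sum.cong) (simp_all add: col flip_subset)
    also have "\<dots> = (\<Sum>i\<in>I. a i * b i) * z J'"
      by (rule koszul_op_koszul_op[OF assms(1)])
    finally show ?thesis using True by (simp add: z_def koszul_simps)
  next
    case False
    have "mat_mult (mf_basis ?K) (mf_diff ?K) (mf_diff ?K) J' J = 0"
    proof (rule ccontr)
      assume "mat_mult (mf_basis ?K) (mf_diff ?K) (mf_diff ?K) J' J \<noteq> 0"
      then obtain L where "mf_diff ?K J' L \<noteq> 0" "mf_diff ?K L J \<noteq> 0" by (rule mat_mult_nonzero)
      with False show False using nz by blast
    qed
    then show ?thesis using False by (auto simp: koszul_simps)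
  qed
  have "J' \<subseteq> I \<and> J \<subseteq> I \<and> odd (card J') \<noteq> odd (card J)" if "mf_diff ?K J' J \<noteq> 0" for J' J
    using nz[OF that] by blast
  then have "mf_diff ?K \<in> odd_homs V ?K ?K"
    using ser unfolding odd_homs_def homs_def koszul_simps by simp
  moreover have "finite (mf_basis ?K)" using assms(1) by (simp add: koszul_simps)
  moreover have "mat_mult (mf_basis ?K) (mf_diff ?K) (mf_diff ?K)
      = (\<lambda>J' J. if J' = J \<and> J \<in> mf_basis ?K then \<Sum>i\<in>I. a i * b i else 0)"
    by (intro ext) (rule sq)
  ultimately show ?thesis
    unfolding is_mf_def by blast
qed

section \<open>The diagonal kernel and the box product as matrix factorizations\<close>

lemma sum_difference_quot:
  assumes "f \<in> series {1..n}"
  shows "(\<Sum>i=1..n. difference_quot i f * (mps_var (Inr i) - mps_var (Inl i))) = in_y f - in_x f"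
proof -
  have "(\<Sum>i=1..m. difference_quot i f * (mps_var (Inr i) - mps_var (Inl i)))
      = in_xy 1 f - in_xy (Suc m) f" for m
    by (induction m) (simp_all add: mult.commute[of "difference_quot _ _"] difference_quot_mult)
  then show ?thesis by (simp only: in_xy_1[OF assms] in_xy_Suc[OF assms])
qed

lemma is_mf_diag_kernel:
  assumes "w \<in> series {1..n}"
  shows "is_mf (vars_e n) (in_y w - in_x w) (diag_kernel n w)"
proof -
  have "is_mf (vars_e n)
      (\<Sum>i=1..n. difference_quot i w * (mps_var (Inr i) - mps_var (Inl i))) (diag_kernel n w)"
    unfolding diag_kernel_def using assms
    by (intro is_mf_koszul series_difference_quot series_koszul_var) auto
  then show ?thesis unfolding sum_difference_quot[OF assms] .
qed

lemma is_mf_dual_box_self: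
  assumes "is_mf {1..n} w E"
  shows "is_mf (vars_e n) (in_y w - in_x w) (dual_box_self E)"
proof -
  have "is_mf (vars_e n) (in_x (- w) + in_y w) (dual_box_self E)"
    unfolding dual_box_self_def using assms
    by (intro is_mf_tensor is_mf_map[OF is_mf_dual] is_mf_map[of "{1..n}" w E]
        in_x.unital_ring_hom_axioms in_y.unital_ring_hom_axioms series_in_x series_in_y)
  then show ?thesis by (simp add: in_x.hom_uminus)
qed

section \<open>The Koszul complex of the diagonal\<close>

text \<open>The guard \<open>0 < i\<close> makes \<open>restrict_var 0\<close> the identity also on
  the variable of index 0, so that consecutive restrictions differ in the single index m +
  1.\<close>

definition restrict_var :: "nat \<Rightarrow> nat + nat \<Rightarrow> nat + nat" where
  "restrict_var m v = (case v of Inl i \<Rightarrow> Inl i | Inr i \<Rightarrow> if 0 < i \<and> i \<le> m then Inl i else Inr i)"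

definition restrict_upto :: "nat \<Rightarrow> (nat + nat, 'a::comm_ring_1) mps \<Rightarrow> (nat + nat, 'a) mps" where
  "restrict_upto m = mps_subst (restrict_var m) (\<lambda>_. 1)"

lemma finite_fibres_restrict [simp]: "finite_fibres (restrict_var m)"
proof -
  have "restrict_var m -` {u} \<subseteq> {Inl (case_sum id id u), Inr (case_sum id id u)}" for u
    by (auto simp: restrict_var_def split: sum.splits if_splits)
  then show ?thesis unfolding finite_fibres_def by (meson finite.emptyI finite_insert finite_subset)
qed

interpretation restrict: unital_ring_hom "restrict_upto m" for m
  unfolding restrict_upto_def by (rule subst_hom) simp

lemma restrict_upto_0 [simp]: "restrict_upto 0 f = f"
proof -
  have "restrict_var 0 = id"
    by (auto simp: fun_eq_iff restrict_var_def split: sum.splits)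
  then show ?thesis by (simp add: restrict_upto_def)
qed

lemma identify_restrict:
  "identify (Inl (Suc m)) (Inr (Suc m)) (restrict_upto m f) = restrict_upto (Suc m) f"
proof -
  have "id(Inr (Suc m) := Inl (Suc m)) \<circ> restrict_var m = restrict_var (Suc m)"
    by (auto simp: fun_eq_iff restrict_var_def split: sum.splits)
  then show ?thesis by (simp add: identify_def restrict_upto_def subst_subst)
qed

lemma restrict_all:
  assumes "f \<in> series (vars_e n)"
  shows "restrict_upto n f = in_x (diagonal f)"
proof -
  have "finite_fibres (Inl \<circ> case_sum id id :: nat + nat \<Rightarrow> nat + nat)"
    by (intro finite_fibres_compose) simp_all
  then have "mps_subst (restrict_var n) (\<lambda>_. 1) f
      = mps_subst (Inl \<circ> case_sum id id) (\<lambda>_. 1) f"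
    using assms by (intro subst_cong[OF assms]) (auto simp: restrict_var_def)
  then show ?thesis by (simp add: restrict_upto_def in_x_def diagonal_def subst_subst)
qed

lemma restrict_koszul_var:
  "restrict_upto m (mps_var (Inr i) - mps_var (Inl i))
    = (if i \<in> {1..m} then 0 else mps_var (Inr i) - mps_var (Inl i))"
  by (simp add: restrict.hom_diff) (auto simp: restrict_upto_def subst_var restrict_var_def)

lemma identify_koszul_var:
  "i \<noteq> k \<Longrightarrow> identify (Inl k) (Inr k) (mps_var (Inr i) - mps_var (Inl i))
    = mps_var (Inr i) - mps_var (Inl i)"
  by (simp add: identify.hom_diff) (simp add: identify_def subst_var)

lemma series_restrict: "f \<in> series (vars_e n) \<Longrightarrow> restrict_upto m f \<in> series (vars_e n)"
  unfolding restrict_upto_def by (rule series_subst) (auto simp: restrict_var_def)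

text \<open>The contracting homotopy is the tensor product of the contractions given by the difference
  quotients on the Koszul complexes of the single elements \<open>y\<^sub>i - x\<^sub>i\<close>.\<close>

definition contraction ::
    "(nat set \<Rightarrow> (nat + nat, 'a::comm_ring_1) mps) \<Rightarrow> nat set \<Rightarrow> (nat + nat, 'a) mps" where
  "contraction z J = dquot (Inl (Min J)) (Inr (Min J)) (restrict_upto (Min J - 1) (z (J - {Min J})))"

abbreviation diag_boundary ::
    "nat \<Rightarrow> (nat set \<Rightarrow> (nat + nat, 'a::comm_ring_1) mps) \<Rightarrow> nat set \<Rightarrow> (nat + nat, 'a) mps" where
  "diag_boundary n \<equiv> koszul_op {1..n} (\<lambda>_. 0) (\<lambda>i. mps_var (Inr i) - mps_var (Inl i))"

text \<open>For nonempty J, boundary after contraction plus contraction after boundary is the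
  identity, and the cycle condition removes the second term; it enters only at J - {Min J}. For J =
  {} the telescoping sum runs through all indices and leaves z minus its restriction to the
  diagonal.\<close>

lemma diag_boundary_contraction:
  fixes z :: "nat set \<Rightarrow> (nat + nat, 'a::comm_ring_1) mps"
  assumes J: "J \<subseteq> {1..n}" and z: "\<And>J. z J \<in> series (vars_e n)"
    and cycle: "J \<noteq> {} \<Longrightarrow> diag_boundary n z (J - {Min J}) = 0"
    and zero: "J = {} \<Longrightarrow> diagonal (z {}) = 0"
  shows "diag_boundary n (contraction z) J = z J"
proof -
  let ?u = "\<lambda>i. mps_var (Inr i) - mps_var (Inl i) :: (nat + nat, 'a) mps"
  have finJ: "finite J" using J finite_subset by blast
  have dq: "?u i * dquot (Inl i) (Inr i) (restrict_upto (i - 1) f)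
      = restrict_upto (i - 1) f - restrict_upto i f" if "i \<ge> 1" for i f
    using that by (cases i) (simp_all add: dquot_mult identify_restrict)
  have tele: "(\<Sum>i=1..m. restrict_upto (i - 1) f - restrict_upto i f) = f - restrict_upto m f"
    for m and f :: "(nat + nat, 'a) mps"
    by (induction m) simp_all
  \<comment> \<open>An index below all of J becomes the minimum and has sign 1, so y_i - x_i cancels
    the quotient and a telescoping difference remains.\<close>
  have small: "koszul_sign i J * ((if i \<in> J then 0 else ?u i) * contraction z (flip i J))
      = restrict_upto (i - 1) (z J) - restrict_upto i (z J)"
    if "i \<ge> 1" "\<And>j. j \<in> J \<Longrightarrow> i < j" for i
  proof -
    have empty: "{j \<in> J. j < i} = {}" using that(2) by fastforce
    have "koszul_sign i J = (1 :: (nat + nat, 'a) mps)" unfolding koszul_sign_def empty by simp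
    moreover have "i \<notin> J" using that(2) by blast
    moreover have "Min (insert i J) = i"
      using that(2) finJ by (intro Min_eqI) (auto dest: less_imp_le)
    ultimately show ?thesis using dq[OF that(1), of "z J"]
      by (simp add: flip_def contraction_def)
  qed
  show ?thesis
  proof (cases "J = {}")
    case True
    then have "diag_boundary n (contraction z) J
        = (\<Sum>i=1..n. restrict_upto (i - 1) (z J) - restrict_upto i (z J))"
      unfolding koszul_op_def by (intro sum.cong small) auto
    also have "\<dots> = z J" using z zero True by (simp only: tele) (simp add: restrict_all)
    finally show ?thesis .
  next
    case False
    define m where "m = Min J"
    have m: "m \<in> J" "\<And>j. j \<in> J \<Longrightarrow> m \<le> j" "1 \<le> m" "m \<le> n"
    proof -
      show "m \<in> J" unfolding m_def using finJ False by (rule Min_in)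
      with J have "m \<in> {1..n}" by blast
      then show "1 \<le> m" "m \<le> n" by auto
      show "m \<le> j" if "j \<in> J" for j unfolding m_def using finJ that by (rule Min_le)
    qed
    define K where "K = J - {m}"
    let ?R = "restrict_upto (m - 1) :: (nat + nat, 'a) mps \<Rightarrow> (nat + nat, 'a) mps"
    let ?Q = "dquot (Inl m) (Inr m) :: (nat + nat, 'a) mps \<Rightarrow> (nat + nat, 'a) mps"
    have split: "{1..n} = {1..m - 1} \<union> ({m} \<union> {m<..n})" using m(3,4) by auto
    have sum_split: "sum g {1..n} = sum g {1..m - 1} + (g m + sum g {m<..n})"
      for g :: "nat \<Rightarrow> (nat + nat, 'a) mps"
      unfolding split using m(3) by (subst sum.union_disjoint; auto)+
    define X where "X = (\<Sum>i\<in>{m<..n}. koszul_sign i J * ((if i \<in> J then 0 else ?u i) * contraction z (flip i J)))"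
    have small_sum: "(\<Sum>i=1..m - 1. koszul_sign i J * ((if i \<in> J then 0 else ?u i) * contraction z (flip i J)))
        = z J - ?R (z J)"
      unfolding tele[symmetric] using m by (intro sum.cong small) force+
    have "diag_boundary n (contraction z) J = z J - ?R (z J) + X"
      unfolding koszul_op_def sum_split small_sum X_def using m(1) by simp
    moreover have "X = ?R (z J)"
    proof -
      \<comment> \<open>An index above m leaves the minimum at m. Its term is the contraction of a
        term in the boundary of z at K; the absence of m from K changes the sign.\<close>
      have high: "koszul_sign i J * ((if i \<in> J then 0 else ?u i) * contraction z (flip i J))
          = ?Q (?R (- (koszul_sign i K * ((if i \<in> K then 0 else ?u i) * z (flip i K)))))"
        if i: "i \<in> {m<..n}" for i
      proof (cases "i \<in> J")
        case True
        then show ?thesis using i by (simp add: K_def)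
      next
        case False
        have flip: "flip i J = insert i J" "flip i K = insert i J - {m}"
          using False i by (auto simp: flip_def K_def)
        have Min: "Min (insert i J) = m"
          using i finJ m by (intro Min_eqI) auto
        have sign: "koszul_sign i J = - (koszul_sign i K :: (nat + nat, 'a) mps)"
          using koszul_sign_flip_less[of m i K] m(1) i by (simp add: K_def flip_def insert_absorb)
        have Ru: "?R (?u i) = ?u i"
          using i by (auto simp: restrict_koszul_var)
        have "?Q (?R (- (koszul_sign i K * (?u i * f)))) = - (koszul_sign i K * (?u i * ?Q (?R f)))" for f
          unfolding koszul_sign_def restrict.hom_uminus restrict.hom_mult restrict.hom_sign Ru
            dquot_uminus dquot_sign
          using i by (subst dquot_linear) (auto simp: identify_koszul_var)
        with False show ?thesis
          by (simp add: flip contraction_def Min sign) (simp add: K_def)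
      qed
      define y where "y i = koszul_sign i K * ((if i \<in> K then 0 else ?u i) * z (flip i K))" for i
      have low: "?R (koszul_sign i K * ((if i \<in> K then 0 else ?u i) * z (flip i K))) = 0"
        if "i \<in> {1..m - 1}" for i
        using that by (simp add: restrict.hom_mult restrict_koszul_var)
      have mid: "koszul_sign m K * ((if m \<in> K then 0 else ?u m) * z (flip m K)) = ?u m * z J"
      proof -
        have "flip m K = J" using m(1) by (auto simp: flip_def K_def)
        moreover have empty: "{j \<in> K. j < m} = {}" using m(2) by (fastforce simp: K_def)
        moreover have "koszul_sign m K = (1 :: (nat + nat, 'a) mps)"
          unfolding koszul_sign_def empty by simp
        ultimately show ?thesis by (simp add: K_def)
      qed
      \<comment> \<open>The contraction is applied to the cycle condition at K: \<open>?R\<close>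
        kills y_i - x_i for i < m, the index m returns \<open>?R (z J)\<close> by
        \<open>dquot_cancel\<close>, and the indices above m give -X.\<close>
      have "0 = ?Q (?R (diag_boundary n z K))"
        using cycle False by (simp add: K_def m_def)
      also have "\<dots> = (\<Sum>i=1..m - 1. ?Q (?R (y i))) + (?Q (?R (y m)) + (\<Sum>i\<in>{m<..n}. ?Q (?R (y i))))"
        unfolding koszul_op_def y_def[symmetric] sum_split
        by (simp only: restrict.hom_add restrict.hom_sum dquot_add dquot_sum)
      also have "(\<Sum>i=1..m - 1. ?Q (?R (y i))) = 0"
        unfolding y_def by (intro sum.neutral ballI) (subst low, assumption, rule dquot_zero)
      also have "(\<Sum>i\<in>{m<..n}. ?Q (?R (y i))) = - X"
        unfolding X_def sum_negf[symmetric]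
        by (rule sum.cong[OF refl]) (simp add: high y_def restrict.hom_uminus dquot_uminus)
      also have "0 + (?Q (?R (y m)) + - X) = ?Q (?R (?u m * z J)) - X"
        by (simp add: y_def mid)
      also have "?R (?u m * z J) = ?u m * ?R (z J)"
        using m(3) by (auto simp: restrict.hom_mult restrict_koszul_var)
      also have "?Q (?u m * ?R (z J)) = ?R (z J)"
        by (simp add: dquot_cancel)
      finally show ?thesis by simp
    qed
    ultimately show ?thesis by simp
  qed
qed

lemma series_contraction:
  assumes "J \<subseteq> {1..n}" "J \<noteq> {}" "\<And>J. z J \<in> series (vars_e n)"
  shows "contraction z J \<in> series (vars_e n)"
proof -
  have "Min J \<in> {1..n}" using assms finite_subset by (metis Min_in finite_atLeastAtMost subsetD)
  then show ?thesis unfolding contraction_def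
    using assms(3) by (intro series_dquot series_restrict) auto
qed

section \<open>The canonical morphism\<close>

lemma diag_kernel_simps:
  "mf_basis (diag_kernel n w) = Pow {1..n}" "mf_odd (diag_kernel n w) J = odd (card J)"
  by (simp_all add: diag_kernel_def koszul_simps)

abbreviation diag_kernel_op ::
    "nat \<Rightarrow> (nat, 'a) mps \<Rightarrow> (nat set \<Rightarrow> (nat + nat, 'a::comm_ring_1) mps) \<Rightarrow>
      nat set \<Rightarrow> (nat + nat, 'a) mps" where
  "diag_kernel_op n w \<equiv>
    koszul_op {1..n} (\<lambda>i. difference_quot i w) (\<lambda>i. mps_var (Inr i) - mps_var (Inl i))"

lemma diag_kernel_row:
  "J \<subseteq> {1..n} \<Longrightarrow> mat_mult (mf_basis (diag_kernel n w)) (mf_diff (diag_kernel n w)) \<phi> J q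
    = diag_kernel_op n w (\<lambda>J. \<phi> J q) J"
  unfolding mat_mult_def diag_kernel_simps unfolding diag_kernel_def by (rule koszul_row) auto

lemma card_flip:
  assumes "finite J"
  shows "card (flip i J) = (if i \<in> J then card J - 1 else Suc (card J))"
  using assms by (simp add: flip_def)

text \<open>The homotopy h is put in exterior degree p + 1 alone. In degree p its differential is
  then just the contraction part applied to h: composing h with the differential of X stays in
  degree p + 1, and the wedge part leads to degree p + 2. The component of \<phi> in degree p is a
  cycle for the contraction part, so \<open>diag_boundary_contraction\<close> applies; for p = 0 the
  condition on the diagonal takes the place of the cycle condition.\<close>

lemma kill_lowest_degree:
  fixes w :: "(nat, 'a::comm_ring_1) mps" and n :: nat
  defines "Y \<equiv> diag_kernel n w" and "V \<equiv> vars_e n"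
  assumes \<phi>: "\<phi> \<in> closed_homs V X Y" "\<phi> \<in> even_homs V X Y"
    and low: "\<And>J q. card J < p \<Longrightarrow> \<phi> J q = 0"
    and diag: "\<And>q. p = 0 \<Longrightarrow> diagonal (\<phi> {} q) = 0"
  shows "\<exists>h\<in>odd_homs V X Y. \<forall>J q. card J < Suc p \<longrightarrow> \<phi> J q = hom_diff X Y h J q"
proof -
  define h where "h J q = (if J \<subseteq> {1..n} \<and> card J = Suc p
    then contraction (\<lambda>K. \<phi> K q) J else 0)" for J q
  have \<phi>V: "\<phi> J q \<in> series V" for J q using \<phi>(2) by (simp add: even_homs_def homs_def)
  have \<phi>0: "J \<subseteq> {1..n}" "q \<in> mf_basis X" "odd (card J) = mf_odd X q" if "\<phi> J q \<noteq> 0" for J q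
    using that \<phi>(2) by (auto simp: even_homs_def homs_def Y_def diag_kernel_simps)
  have fin: "finite J" if "J \<subseteq> {1..n}" for J using that finite_subset by blast
  have h: "h \<in> odd_homs V X Y"
  proof -
    have "h J q \<in> series V" for J q
    proof (cases "J \<subseteq> {1..n} \<and> card J = Suc p")
      case True
      then have "J \<noteq> {}" by auto
      then have "contraction (\<lambda>K. \<phi> K q) J \<in> series (vars_e n)"
        using True \<phi>V[unfolded V_def] by (intro series_contraction) simp_all
      then show ?thesis by (simp add: h_def V_def)
    qed (auto simp: h_def)
    moreover have "J \<subseteq> {1..n} \<and> q \<in> mf_basis X \<and> odd (card J) \<noteq> mf_odd X q" if nz: "h J q \<noteq> 0" for J q
    proof -
      from nz have J: "J \<subseteq> {1..n}" "card J = Suc p" and c: "contraction (\<lambda>K. \<phi> K q) J \<noteq> 0"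
        by (auto simp: h_def split: if_splits)
      from c have nz': "\<phi> (J - {Min J}) q \<noteq> 0"
        by (auto simp: contraction_def)
      have "J \<noteq> {}" using J(2) by auto
      then have "card (J - {Min J}) = p" using J fin by simp
      then show ?thesis using \<phi>0[OF nz'] J by auto
    qed
    ultimately show ?thesis
      unfolding odd_homs_def homs_def Y_def diag_kernel_simps by blast
  qed
  have "\<phi> J q = hom_diff X Y h J q" if J: "card J < Suc p" for J q
  proof (cases "J \<subseteq> {1..n}")
    case False
    have "mat_mult (mf_basis Y) (mf_diff Y) h J q = 0"
    proof (rule ccontr)
      assume "mat_mult (mf_basis Y) (mf_diff Y) h J q \<noteq> 0"
      then obtain K where "mf_diff Y J K \<noteq> 0" by (rule mat_mult_nonzero)
      with False show False unfolding Y_def diag_kernel_def using koszul_nonzero(1) by blast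
    qed
    moreover have "h J q' = 0" for q' using False by (simp add: h_def)
    ultimately show ?thesis using False \<phi>0(1)[of J q] by (auto simp: hom_diff_odd[OF h] mat_mult_def)
  next
    case True
    have finJ: "finite J" using True by (rule fin)
    have "h J q' = 0" for q' using J by (simp add: h_def)
    then have "hom_diff X Y h J q = diag_kernel_op n w (\<lambda>J. h J q) J"
      using True unfolding hom_diff_odd[OF h] by (simp add: Y_def diag_kernel_row) (simp add: mat_mult_def)
    also have "\<dots> = \<phi> J q"
    proof (cases "card J = p")
      case False
      with J have "card (flip i J) \<noteq> Suc p" for i using finJ by (auto simp: card_flip)
      then show ?thesis using J False low[of J q] by (simp add: koszul_op_def h_def)
    next
      case card: True
      have "diag_kernel_op n w (\<lambda>J. h J q) J = diag_boundary n (contraction (\<lambda>K. \<phi> K q)) J"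
        unfolding koszul_op_def using True card finJ
        by (intro sum.cong) (auto simp: h_def flip_subset card_flip)
      also have "\<dots> = \<phi> J q"
      proof (rule diag_boundary_contraction[OF True])
        show "\<phi> J q \<in> series (vars_e n)" for J using \<phi>V by (simp add: V_def)
        show "diagonal (\<phi> {} q) = 0" if "J = {}" using diag that card by simp
        assume ne: "J \<noteq> {}"
        define K where "K = J - {Min J}"
        have K: "K \<subseteq> {1..n}" "finite K" "Suc (card K) = p"
          using True finJ card card_Suc_Diff1[OF finJ Min_in[OF finJ ne]] by (auto simp: K_def)
        have K0: "\<phi> K q' = 0" for q' using K(3) by (intro low) simp
        \<comment> \<open>K has p - 1 elements. The terms of the closedness equation with \<phi> in
          degree p - 1 (composition with the differential of X) or p - 2 (wedge part) vanish, which
          leaves the contraction part.\<close>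
        have "0 = hom_diff X Y \<phi> K q" using \<phi>(1) by (simp add: closed_homs_def)
        also have "\<dots> = diag_kernel_op n w (\<lambda>J. \<phi> J q) K"
          using K(1) K0 unfolding hom_diff_even[OF \<phi>(2)]
          by (simp add: Y_def diag_kernel_row) (simp add: mat_mult_def)
        also have "\<dots> = diag_boundary n (\<lambda>J. \<phi> J q) K"
          unfolding koszul_op_def
        proof (rule sum.cong[OF refl])
          fix i
          have "\<phi> (flip i K) q = 0" if "i \<in> K"
            using K(2,3) that by (intro low) (simp add: card_flip)
          then show "koszul_sign i K * ((if i \<in> K then difference_quot i w
              else mps_var (Inr i) - mps_var (Inl i)) * \<phi> (flip i K) q)
            = koszul_sign i K * ((if i \<in> K then 0
              else mps_var (Inr i) - mps_var (Inl i)) * \<phi> (flip i K) q)"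
            by simp
        qed
        finally show "diag_boundary n (\<lambda>J. \<phi> J q) (J - {Min J}) = 0" by (simp add: K_def)
      qed
      finally show ?thesis .
    qed
    finally show ?thesis by simp
  qed
  with h show ?thesis by blast
qed

text \<open>Each round of \<open>kill_lowest_degree\<close> clears one more degree of \<phi> minus
  the boundaries found so far, and this difference stays closed and even. Degrees above n are empty,
  so n + 1 rounds suffice.\<close>

lemma null_homotopic:
  fixes w :: "(nat, 'a::comm_ring_1) mps" and n :: nat
  defines "Y \<equiv> diag_kernel n w" and "V \<equiv> vars_e n"
  assumes w: "w \<in> series {1..n}" and X: "is_mf V (in_y w - in_x w) X"
    and \<phi>: "\<phi> \<in> closed_homs V X Y" "\<phi> \<in> even_homs V X Y"
    and diag: "\<And>q. diagonal (\<phi> {} q) = 0"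
  shows "\<exists>h\<in>odd_homs V X Y. hom_diff X Y h = \<phi>"
proof -
  have Y: "is_mf V (in_y w - in_x w) Y"
    unfolding V_def Y_def by (rule is_mf_diag_kernel[OF w])
  have "\<exists>h\<in>odd_homs V X Y. \<forall>J q. card J < Suc p \<longrightarrow> \<phi> J q = hom_diff X Y h J q" for p
  proof (induction p)
    case 0
    show ?case unfolding Y_def V_def
      by (rule kill_lowest_degree) (use \<phi> diag in \<open>simp_all add: Y_def V_def\<close>)
  next
    case (Suc p)
    then obtain h where h: "h \<in> odd_homs V X Y"
      and eq: "\<And>J q. card J < Suc p \<Longrightarrow> \<phi> J q = hom_diff X Y h J q" by blast
    let ?\<psi> = "\<lambda>J q. \<phi> J q - hom_diff X Y h J q"
    note dh = hom_diff_closed[OF X Y h]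
    have ev: "?\<psi> \<in> even_homs V X Y" by (rule even_homs_diff[OF \<phi>(2) dh(2)])
    have "hom_diff X Y ?\<psi> = (\<lambda>_ _. 0)"
      using \<phi>(1) dh(1) by (simp add: hom_diff_diff closed_homs_def)
    with ev have cl: "?\<psi> \<in> closed_homs V X Y" by (simp add: closed_homs_def even_homs_def)
    have "\<exists>h'\<in>odd_homs V X Y. \<forall>J q. card J < Suc (Suc p) \<longrightarrow> ?\<psi> J q = hom_diff X Y h' J q"
      unfolding Y_def V_def
      by (rule kill_lowest_degree) (use cl ev eq in \<open>simp_all add: Y_def V_def\<close>)
    then obtain h' where h': "h' \<in> odd_homs V X Y"
      and eq': "\<And>J q. card J < Suc (Suc p) \<Longrightarrow> ?\<psi> J q = hom_diff X Y h' J q" by blast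
    have "(\<lambda>J q. h J q + h' J q) \<in> odd_homs V X Y" by (rule odd_homs_add[OF h h'])
    moreover have "\<phi> J q = hom_diff X Y (\<lambda>J q. h J q + h' J q) J q" if "card J < Suc (Suc p)" for J q
      using eq'[OF that, of q] by (simp add: hom_diff_add algebra_simps)
    ultimately show ?case by blast
  qed
  then obtain h where h: "h \<in> odd_homs V X Y"
    and eq: "\<And>J q. card J < Suc n \<Longrightarrow> \<phi> J q = hom_diff X Y h J q" by blast
  have "hom_diff X Y h J q = \<phi> J q" for J q
  proof (cases "J \<subseteq> {1..n}")
    case True
    then have "card J \<le> n" using card_mono[of "{1..n}" J] by simp
    then show ?thesis using eq by simp
  next
    case False
    have "hom_diff X Y h \<in> homs V X Y" "\<phi> \<in> homs V X Y"
      using hom_diff_closed(2)[OF X Y h] \<phi>(2) by (simp_all add: even_homs_def)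
    with False have "hom_diff X Y h J q = 0" "\<phi> J q = 0"
      unfolding homs_def Y_def diag_kernel_simps by blast+
    then show ?thesis by simp
  qed
  with h show ?thesis by blast
qed

text \<open>Only contractions by y_i - x_i reach exterior degree 0, and they vanish on the diagonal.
  What remains is the boundary term of \<open>lifts_evaluation\<close>.\<close>

lemma diagonal_hom_diff:
  assumes "h \<in> odd_homs V X (diag_kernel n w)"
  shows "diagonal (hom_diff X (diag_kernel n w) h {} q)
    = (\<Sum>q'\<in>mf_basis X. diagonal (h {} q') * diagonal (mf_diff X q' q))"
proof -
  have "diagonal (diag_kernel_op n w (\<lambda>J. h J q) {}) = 0"
    by (simp add: koszul_op_def diagonal.hom_sum diagonal.hom_mult)
  then show ?thesis
    unfolding hom_diff_odd[OF assms]
    by (simp add: diag_kernel_row diagonal.hom_add) (simp add: mat_mult_def diagonal.hom_sum diagonal.hom_mult)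
qed

text \<open>A competitor \<phi> agrees with the evaluation only up to a homotopy h with values in R.
  Lifting h to a morphism g into exterior degree 0 makes \<phi> - c - d(g) vanish there on the
  diagonal, so it is null-homotopic. Conversely, a homotopy added to c provides, by its degree 0
  part on the diagonal, the homotopy asked for in \<open>lifts_evaluation\<close>.\<close>

lemma canonical_morphism_eq:
  fixes w :: "(nat, 'a::comm_ring_1) mps" and n :: nat and E :: "('b, nat, 'a) mf"
  defines "X \<equiv> dual_box_self E" and "Y \<equiv> diag_kernel n w" and "V \<equiv> vars_e n"
  assumes w: "w \<in> series {1..n}" and E: "is_mf {1..n} w E"
    and c: "c \<in> closed_homs V X Y" "c \<in> even_homs V X Y"
    and eval: "\<And>q. q \<in> mf_basis X \<Longrightarrow> diagonal (c {} q) = (if fst q = snd q then 1 else 0)"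
  shows "canonical_morphism n w E
    = {\<lambda>J q. c J q + hom_diff X Y h J q | h. h \<in> odd_homs V X Y}"
proof -
  have X: "is_mf V (in_y w - in_x w) X" unfolding V_def X_def by (rule is_mf_dual_box_self[OF E])
  have Y: "is_mf V (in_y w - in_x w) Y" unfolding V_def Y_def by (rule is_mf_diag_kernel[OF w])
  let ?cls = "\<lambda>\<phi>. {\<lambda>J q. \<phi> J q + hom_diff X Y h J q | h. h \<in> odd_homs V X Y}"
  let ?ev = "\<lambda>q :: 'b \<times> 'b. if fst q = snd q then 1 else 0 :: (nat, 'a) mps"
  have cls_eq: "?cls \<phi> \<subseteq> ?cls \<psi>" if h: "h \<in> odd_homs V X Y" and eq: "\<And>J q. \<phi> J q = \<psi> J q + hom_diff X Y h J q"
    for \<phi> \<psi> h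
  proof
    fix \<chi> assume "\<chi> \<in> ?cls \<phi>"
    then obtain g where g: "g \<in> odd_homs V X Y" "\<chi> = (\<lambda>J q. \<phi> J q + hom_diff X Y g J q)" by blast
    have "\<chi> = (\<lambda>J q. \<psi> J q + hom_diff X Y (\<lambda>J q. h J q + g J q) J q)"
      unfolding g(2) eq hom_diff_add by (simp add: add.assoc)
    with odd_homs_add[OF h g(1)] show "\<chi> \<in> ?cls \<psi>" by blast
  qed
  have "canonical_morphism n w E = (THE C. C \<in> ho_homs V X Y \<and> (\<forall>c\<in>C. lifts_evaluation n E c))"
    by (simp add: canonical_morphism_def X_def Y_def V_def)
  also have "\<dots> = ?cls c"
  proof (rule the_equality)
    have "lifts_evaluation n E (\<lambda>J q. c J q + hom_diff X Y h J q)" if h: "h \<in> odd_homs V X Y" for h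
      unfolding lifts_evaluation_def
    proof (intro exI[of _ "\<lambda>q. diagonal (h {} q)"] conjI allI ballI impI)
      show "diagonal (h {} q) \<in> series {1..n}" for q
        by (cases q, rule series_diagonal) (use h in \<open>simp add: odd_homs_def homs_def V_def\<close>)
      show "mf_odd (dual_box_self E) q" if "diagonal (h {} q) \<noteq> 0" for q
      proof -
        have "h {} q \<noteq> 0" using that by auto
        then have "mf_odd Y {} \<noteq> mf_odd X q" using h unfolding odd_homs_def by blast
        then show ?thesis by (simp add: Y_def diag_kernel_simps X_def)
      qed
      show "diagonal (c {} q + hom_diff X Y h {} q) = ?ev q +
          (\<Sum>q'\<in>mf_basis (dual_box_self E). diagonal (h {} q') * diagonal (mf_diff (dual_box_self E) q' q))"
        if "q \<in> mf_basis (dual_box_self E)" for q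
        using eval[of q] that diagonal_hom_diff[OF h[unfolded Y_def], of q]
        by (simp add: diagonal.hom_add X_def Y_def)
    qed
    then show "?cls c \<in> ho_homs V X Y \<and> (\<forall>c\<in>?cls c. lifts_evaluation n E c)"
      using c unfolding ho_homs_def by blast
  next
    fix C assume C: "C \<in> ho_homs V X Y \<and> (\<forall>c\<in>C. lifts_evaluation n E c)"
    then obtain \<phi> where \<phi>: "\<phi> \<in> closed_homs V X Y" "\<phi> \<in> even_homs V X Y" and C_eq: "C = ?cls \<phi>"
      unfolding ho_homs_def by blast
    have "(\<lambda>J q. \<phi> J q + hom_diff X Y (\<lambda>_ _. 0) J q) \<in> ?cls \<phi>" using odd_homs_zero by blast
    then have "lifts_evaluation n E \<phi>" using C C_eq by simp
    then obtain h where hV: "\<And>q. h q \<in> series {1..n}" and h_odd: "\<And>q. h q \<noteq> 0 \<Longrightarrow> mf_odd X q"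
      and h: "\<And>q. q \<in> mf_basis X \<Longrightarrow> diagonal (\<phi> {} q) = ?ev q
        + (\<Sum>q'\<in>mf_basis X. h q' * diagonal (mf_diff X q' q))"
      unfolding lifts_evaluation_def X_def by blast
    \<comment> \<open>\<open>in_x\<close> is a section of \<open>diagonal\<close>, so the boundary
      of g restricts to that of h. Since h lives on odd basis elements and \<open>{}\<close> has
      even parity, g is odd.\<close>
    define g where "g J q = (if J = {} \<and> q \<in> mf_basis X then in_x (h q) else 0)" for J :: "nat set" and q
    have g: "g \<in> odd_homs V X Y"
    proof -
      have "g J q \<in> series V" for J q
        using series_in_x[OF hV] by (simp add: g_def V_def)
      moreover have "J \<in> mf_basis Y \<and> q \<in> mf_basis X \<and> mf_odd Y J \<noteq> mf_odd X q"
        if "g J q \<noteq> 0" for J q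
      proof -
        from that have "J = {}" "q \<in> mf_basis X" "h q \<noteq> 0" by (auto simp: g_def split: if_splits)
        then show ?thesis using h_odd by (simp add: Y_def diag_kernel_simps)
      qed
      ultimately show ?thesis unfolding odd_homs_def homs_def by blast
    qed
    let ?\<psi> = "\<lambda>J q. \<phi> J q - c J q - hom_diff X Y g J q"
    note dg = hom_diff_closed[OF X Y g]
    have ev: "?\<psi> \<in> even_homs V X Y" by (intro even_homs_diff \<phi>(2) c(2) dg(2))
    have "hom_diff X Y ?\<psi> = (\<lambda>_ _. 0)"
      using \<phi>(1) c(1) dg(1) by (simp add: hom_diff_diff closed_homs_def)
    with ev have cl: "?\<psi> \<in> closed_homs V X Y" by (simp add: closed_homs_def even_homs_def)
    have "diagonal (?\<psi> {} q) = 0" for q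
    proof (cases "q \<in> mf_basis X")
      case True
      have "diagonal (hom_diff X Y g {} q) = (\<Sum>q'\<in>mf_basis X. h q' * diagonal (mf_diff X q' q))"
        unfolding Y_def diagonal_hom_diff[OF g[unfolded Y_def]] by (simp add: g_def)
      then show ?thesis using h[OF True] eval[OF True] by (simp add: diagonal.hom_diff)
    next
      case False
      have "?\<psi> \<in> homs V X Y" using ev by (simp add: even_homs_def)
      with False have "?\<psi> {} q = 0" unfolding homs_def by blast
      then show ?thesis by simp
    qed
    then obtain k where k: "k \<in> odd_homs V X Y" "hom_diff X Y k = ?\<psi>"
      using null_homotopic[OF w X[unfolded V_def], of ?\<psi>] cl ev unfolding V_def Y_def by blast
    have eq: "\<phi> J q = c J q + hom_diff X Y (\<lambda>J q. g J q + k J q) J q" for J q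
      unfolding hom_diff_add k(2) by simp
    have eq': "c J q = \<phi> J q + hom_diff X Y (\<lambda>J q. 0 - (g J q + k J q)) J q" for J q
      unfolding hom_diff_diff hom_diff_add k(2) by simp
    have gk: "(\<lambda>J q. g J q + k J q) \<in> odd_homs V X Y" by (rule odd_homs_add[OF g k(1)])
    show "C = ?cls c"
      unfolding C_eq
      using cls_eq[OF gk eq] cls_eq[OF odd_homs_diff[OF odd_homs_zero gk] eq'] by (rule equalityI)
  qed
  finally show ?thesis .
qed

section \<open>Telescoping products of difference quotients\<close>

text \<open>The product of \<open>D j\<close> over the j in J up to m, larger indices on the left.
  Recursion on the bound m instead of on J fixes the order and confines the effect of toggling one
  index to a single step; index 0 is never visited.\<close>

primrec ordered_product ::
    "'b set \<Rightarrow> (nat \<Rightarrow> 'b \<Rightarrow> 'b \<Rightarrow> 'r) \<Rightarrow> nat set \<Rightarrow> nat \<Rightarrow> 'b \<Rightarrow> 'b \<Rightarrow> 'r::comm_ring_1" where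
  "ordered_product B D J 0 = (\<lambda>c b. if c = b \<and> b \<in> B then 1 else 0)"
| "ordered_product B D J (Suc m) = (if Suc m \<in> J
    then mat_mult B (D (Suc m)) (ordered_product B D J m) else ordered_product B D J m)"

lemma ordered_product_cong:
  "(\<And>i. 0 < i \<Longrightarrow> i \<le> m \<Longrightarrow> i \<in> J \<longleftrightarrow> i \<in> J') \<Longrightarrow> ordered_product B D J m = ordered_product B D J' m"
  by (induction m) auto

lemma ordered_product_flip:
  "m < i \<Longrightarrow> ordered_product B D (flip i J) m = ordered_product B D J m"
  by (rule ordered_product_cong) (simp add: mem_flip)

lemma ordered_product_supported:
  assumes "\<And>i c b. i \<in> J \<Longrightarrow> D i c b \<noteq> 0 \<Longrightarrow> c \<in> B"
  shows "ordered_product B D J m c b \<noteq> 0 \<Longrightarrow> c \<in> B \<and> b \<in> B"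
proof (induction m arbitrary: c)
  case (Suc m)
  show ?case
  proof (cases "Suc m \<in> J")
    case True
    with Suc.prems have "mat_mult B (D (Suc m)) (ordered_product B D J m) c b \<noteq> 0" by simp
    then obtain c' where "D (Suc m) c c' \<noteq> 0" "ordered_product B D J m c' b \<noteq> 0"
      by (rule mat_mult_nonzero)
    then show ?thesis using Suc.IH assms True by blast
  qed (use Suc in simp)
qed (simp split: if_splits)

lemma ordered_product_series:
  assumes "\<And>i c b. i \<in> J \<Longrightarrow> D i c b \<in> series V"
  shows "ordered_product B D J m c b \<in> series V"
  using assms
  by (induction m arbitrary: c b) (auto simp: mat_mult_def intro!: series_sum series_mult)

lemma koszul_sign_Suc:
  "koszul_sign (Suc s) J = (if s \<in> J then - koszul_sign s J else koszul_sign s J)"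
proof (cases "s \<in> J")
  case True
  then have "{j \<in> J. j < Suc s} = insert s {j \<in> J. j < s}" by auto
  moreover have "card (insert s {j \<in> J. j < s}) = Suc (card {j \<in> J. j < s})"
    by (subst card_insert_disjoint) auto
  ultimately show ?thesis using True by (simp add: koszul_sign_def)
next
  case False
  then have "{j \<in> J. j < Suc s} = {j \<in> J. j < s}" by (auto simp: less_Suc_eq)
  with False show ?thesis by (simp add: koszul_sign_def)
qed

text \<open>The product skips index 0, whereas the cardinality would count it; hence the assumption
  \<open>0 \<notin> J\<close>.\<close>

lemma ordered_product_parity:
  fixes odd_at :: "'b \<Rightarrow> bool"
  assumes "0 \<notin> J" "\<And>i c b. i \<in> J \<Longrightarrow> D i c b \<noteq> 0 \<Longrightarrow> odd_at c \<noteq> odd_at b"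
  shows "ordered_product B D J m c b \<noteq> 0 \<Longrightarrow> (odd_at c \<noteq> odd_at b) = odd (card {j \<in> J. j < Suc m})"
proof (induction m arbitrary: c)
  case 0
  have empty: "{j \<in> J. j < Suc 0} = {}" using assms(1) by (auto simp: less_Suc_eq)
  from 0 have "c = b" by (simp split: if_splits)
  then show ?case unfolding empty by simp
next
  case (Suc m)
  show ?case
  proof (cases "Suc m \<in> J")
    case True
    with Suc.prems have "mat_mult B (D (Suc m)) (ordered_product B D J m) c b \<noteq> 0" by simp
    then obtain c' where c': "D (Suc m) c c' \<noteq> 0" "ordered_product B D J m c' b \<noteq> 0"
      by (rule mat_mult_nonzero)
    have "{j \<in> J. j < Suc (Suc m)} = insert (Suc m) {j \<in> J. j < Suc m}" using True by auto
    then have "card {j \<in> J. j < Suc (Suc m)} = Suc (card {j \<in> J. j < Suc m})" by simp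
    then show ?thesis using Suc.IH[OF c'(2)] assms(2)[OF True c'(1)] by auto
  next
    case False
    then have "{j \<in> J. j < Suc (Suc m)} = {j \<in> J. j < Suc m}" by (auto simp: less_Suc_eq)
    then show ?thesis using Suc False by simp
  qed
qed

lemma ordered_product_hom:
  assumes "unital_ring_hom h"
  shows "h (ordered_product B D J m c b) = ordered_product B (\<lambda>i c b. h (D i c b)) J m c b"
proof -
  interpret unital_ring_hom h by fact
  show ?thesis
    by (induction m arbitrary: c b) (simp_all add: mat_mult_def hom_sum hom_mult)
qed

text \<open>Moving \<open>\<delta>\<^sub>1\<close> through the product \<open>D\<^bsub>j\<^sub>r\<^esub> \<dots> D\<^bsub>j\<^sub>1\<^esub>\<close>: a missing index \<open>i\<close> contributes
  \<open>\<delta>\<^sub>i - \<delta>\<^bsub>i+1\<^esub> = u\<^sub>i D\<^sub>i\<close>, an index that is present contributes \<open>D\<^sub>i \<delta>\<^sub>i = a\<^sub>i - \<delta>\<^bsub>i+1\<^esub> D\<^sub>i\<close>.\<close>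

lemma ordered_product_commute:
  fixes \<delta> D :: "nat \<Rightarrow> 'b \<Rightarrow> 'b \<Rightarrow> 'r::comm_ring_1"
  assumes B: "finite B" and J: "0 \<notin> J"
    and supp: "\<And>i c b. \<delta> i c b \<noteq> 0 \<Longrightarrow> c \<in> B \<and> b \<in> B" "\<And>i c b. D i c b \<noteq> 0 \<Longrightarrow> c \<in> B"
    and diff: "\<And>i c b. \<delta> i c b = \<delta> (Suc i) c b + u i * D i c b"
    and anti: "\<And>i c b. mat_mult B (D i) (\<delta> i) c b + mat_mult B (\<delta> (Suc i)) (D i) c b
      = (if c = b \<and> b \<in> B then a i else 0)"
  shows "mat_mult B (ordered_product B D J m) (\<delta> 1) c b =
    koszul_sign (Suc m) J * mat_mult B (\<delta> (Suc m)) (ordered_product B D J m) c b +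
    (\<Sum>i=1..m. koszul_sign i J * ((if i \<in> J then a i else u i) * ordered_product B D (flip i J) m c b))"
proof (induction m arbitrary: c b)
  case 0
  have "{j \<in> J. j < Suc 0} = {}" using J by (auto simp: less_Suc_eq)
  then have "koszul_sign (Suc 0) J = (1 :: 'r)" by (simp only: koszul_sign_def card.empty power_0)
  moreover have "\<delta> (Suc 0) c b \<noteq> 0 \<Longrightarrow> c \<in> B" "\<delta> (Suc 0) c b \<noteq> 0 \<Longrightarrow> b \<in> B" for c b
    using supp by blast+
  ultimately show ?case
    by (simp add: mat_mult_scalar_left[OF B] mat_mult_scalar_right[OF B])
next
  case (Suc m)
  define s where "s = Suc m"
  let ?P = "ordered_product B D"
  have Psupp: "c \<in> B" if "?P J m c b \<noteq> 0" for c b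
    using ordered_product_supported[of J D B m c b] supp(2) that by blast
  have flips: "?P (flip s J) m = ?P J m" by (simp add: ordered_product_flip s_def)
  have sum_s: "(\<Sum>i=1..s. f i) = (\<Sum>i=1..m. f i) + f s" for f :: "nat \<Rightarrow> 'r"
    by (simp add: s_def)
  show ?case
  proof (cases "s \<in> J")
    case True
    have P: "?P J s = mat_mult B (D s) (?P J m)" using True by (simp add: s_def)
    \<comment> \<open>The minus sign coming from \<open>anti\<close> matches the sign change that s
      causes in \<open>koszul_sign (Suc s) J\<close>.\<close>
    have step: "mat_mult B (D s) (mat_mult B (\<delta> s) (?P J m)) c b
        = a s * ?P J m c b - mat_mult B (\<delta> (Suc s)) (?P J s) c b"
    proof -
      have scalar: "mat_mult B (\<lambda>c b. if c = b \<and> b \<in> B then a s else 0) (?P J m)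
          = (\<lambda>c b. a s * ?P J m c b)"
        by (rule mat_mult_scalar_left[OF B]) (rule Psupp)
      have "mat_mult B (mat_mult B (D s) (\<delta> s)) (?P J m)
          = mat_mult B (\<lambda>c b. (if c = b \<and> b \<in> B then a s else 0) - mat_mult B (\<delta> (Suc s)) (D s) c b) (?P J m)"
        unfolding anti[symmetric] by simp
      also have "\<dots> = (\<lambda>c b. a s * ?P J m c b - mat_mult B (\<delta> (Suc s)) (?P J s) c b)"
        unfolding mat_mult_diff_left scalar P by (simp add: mat_mult_assoc)
      finally show ?thesis by (simp add: mat_mult_assoc)
    qed
    have "mat_mult B (?P J s) (\<delta> 1) c b = mat_mult B (D s) (mat_mult B (?P J m) (\<delta> 1)) c b"
      by (simp add: P mat_mult_assoc)
    also have "\<dots> = mat_mult B (D s) (\<lambda>c b. koszul_sign s J * mat_mult B (\<delta> s) (?P J m) c b +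
        (\<Sum>i=1..m. koszul_sign i J * ((if i \<in> J then a i else u i) * ?P (flip i J) m c b))) c b"
      unfolding s_def by (subst Suc.IH[abs_def]) (rule refl)
    also have "\<dots> = koszul_sign s J * mat_mult B (D s) (mat_mult B (\<delta> s) (?P J m)) c b +
        (\<Sum>i=1..m. koszul_sign i J * ((if i \<in> J then a i else u i) * mat_mult B (D s) (?P (flip i J) m) c b))"
      by (simp only: mat_mult_add_right mat_mult_scale_right mat_mult_sum_right)
    also have "(\<Sum>i=1..m. koszul_sign i J * ((if i \<in> J then a i else u i) * mat_mult B (D s) (?P (flip i J) m) c b))
        = (\<Sum>i=1..m. koszul_sign i J * ((if i \<in> J then a i else u i) * ?P (flip i J) s c b))"
      using True by (intro sum.cong) (auto simp: s_def mem_flip)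
    finally have main: "mat_mult B (?P J s) (\<delta> 1) c b =
        koszul_sign s J * mat_mult B (D s) (mat_mult B (\<delta> s) (?P J m)) c b +
        (\<Sum>i=1..m. koszul_sign i J * ((if i \<in> J then a i else u i) * ?P (flip i J) s c b))" .
    \<comment> \<open>Without s the product is the shorter one, so the scalar \<open>a s\<close>
      yields the summand i = s.\<close>
    have flip_s: "?P (flip s J) s = ?P J m"
      using True flips by (simp add: s_def mem_flip)
    show ?thesis
      unfolding s_def[symmetric] main sum_s flip_s koszul_sign_Suc[of s] step
      using True by (simp add: algebra_simps)
  next
    case False
    have P: "?P J s = ?P J m" using False by (simp add: s_def)
    have flip_s: "?P (flip s J) s = mat_mult B (D s) (?P J m)"
      using False flips by (simp add: s_def mem_flip)
    have "mat_mult B (\<delta> s) (?P J m) c b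
        = mat_mult B (\<delta> (Suc s)) (?P J s) c b + u s * ?P (flip s J) s c b"
    proof -
      have "\<delta> s = (\<lambda>c b. \<delta> (Suc s) c b + u s * D s c b)" by (intro ext) (rule diff)
      then have "mat_mult B (\<delta> s) (?P J m)
          = mat_mult B (\<lambda>c b. \<delta> (Suc s) c b + u s * D s c b) (?P J m)" by (rule arg_cong)
      then show ?thesis by (simp add: mat_mult_add_left mat_mult_scale_left flip_s P)
    qed
    moreover have "(\<Sum>i=1..m. koszul_sign i J * ((if i \<in> J then a i else u i) * ?P (flip i J) m c b))
        = (\<Sum>i=1..m. koszul_sign i J * ((if i \<in> J then a i else u i) * ?P (flip i J) s c b))"
      using False by (intro sum.cong) (auto simp: s_def mem_flip)
    moreover note Suc.IH[of c b, folded s_def]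
    ultimately show ?thesis
      unfolding s_def[symmetric] sum_s koszul_sign_Suc[of s] P using False
      by (simp add: algebra_simps)
  qed
qed

section \<open>The explicit canonical morphism\<close>

abbreviation diff_quots :: "('b, nat, 'a) mf \<Rightarrow> nat \<Rightarrow> 'b \<Rightarrow> 'b \<Rightarrow> (nat + nat, 'a::comm_ring_1) mps" where
  "diff_quots E i c b \<equiv> difference_quot i (mf_diff E c b)"

text \<open>The entry at (a, b) is the functional dual to a, evaluated on the product applied to b.
  The sign (-1)^(|a| |J|) moves the |J| odd factors past that functional.\<close>

definition explicit_morphism ::
    "nat \<Rightarrow> ('b, nat, 'a) mf \<Rightarrow> nat set \<Rightarrow> 'b \<times> 'b \<Rightarrow> (nat + nat, 'a::comm_ring_1) mps" where
  "explicit_morphism n E J = (\<lambda>(a, b). if J \<subseteq> {1..n} then parity_sign (mf_odd E a) ^ card J *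
    ordered_product (mf_basis E) (diff_quots E) J n a b else 0)"

lemma dual_box_self_simps:
  "mf_basis (dual_box_self E) = mf_basis E \<times> mf_basis E"
  "mf_odd (dual_box_self E) (a, b) \<longleftrightarrow> mf_odd E a \<noteq> mf_odd E b"
  by (simp_all add: dual_box_self_def mf_tensor_def mf_map_def mf_dual_def)

text \<open>Write \<delta>_i for \<delta> under \<open>in_xy i\<close>. Multiplied by y_i - x_i, the
  left side becomes (\<delta>_i - \<delta>_{i+1}) \<delta>_i + \<delta>_{i+1} (\<delta>_i -
  \<delta>_{i+1}), the difference of the squares of \<delta>_i and \<delta>_{i+1}. These squares are
  w at stages i and i + 1, and y_i - x_i can be cancelled.\<close>

lemma diff_quots_anticommute:
  assumes E: "is_mf {1..n} w E"
  shows "mat_mult (mf_basis E) (diff_quots E i) (\<lambda>c b. in_xy i (mf_diff E c b)) c b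
    + mat_mult (mf_basis E) (\<lambda>c b. in_xy (Suc i) (mf_diff E c b)) (diff_quots E i) c b
    = (if c = b \<and> b \<in> mf_basis E then difference_quot i w else 0)"
    (is "mat_mult ?B ?D ?\<delta> c b + mat_mult ?B ?\<delta>' ?D c b = _")
proof -
  let ?u = "mps_var (Inr i) - mps_var (Inl i)"
  have hom: "mat_mult ?B (\<lambda>c b. in_xy j (mf_diff E c b)) (\<lambda>c b. in_xy j (mf_diff E c b)) c b
      = (if c = b \<and> b \<in> ?B then in_xy j w else 0)" for j
  proof -
    have "mat_mult ?B (\<lambda>c b. in_xy j (mf_diff E c b)) (\<lambda>c b. in_xy j (mf_diff E c b)) c b
      = in_xy j (mat_mult ?B (mf_diff E) (mf_diff E) c b)"
      by (simp add: mat_mult_def in_xy.hom_sum in_xy.hom_mult)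
    then show ?thesis by (simp add: is_mfD(8)[OF E])
  qed
  have u: "(\<lambda>c b. ?u * ?D c b) = (\<lambda>c b. ?\<delta> c b - ?\<delta>' c b)"
    by (simp add: difference_quot_mult)
  have "?u * (mat_mult ?B ?D ?\<delta> c b + mat_mult ?B ?\<delta>' ?D c b)
      = mat_mult ?B (\<lambda>c b. ?u * ?D c b) ?\<delta> c b + mat_mult ?B ?\<delta>' (\<lambda>c b. ?u * ?D c b) c b"
    by (simp only: mat_mult_scale_left mat_mult_scale_right distrib_left)
  also have "\<dots> = mat_mult ?B ?\<delta> ?\<delta> c b - mat_mult ?B ?\<delta>' ?\<delta>' c b"
    unfolding u by (simp add: mat_mult_diff_left mat_mult_diff_right)
  also have "\<dots> = ?u * (if c = b \<and> b \<in> ?B then difference_quot i w else 0)"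
    unfolding hom by (simp add: difference_quot_mult)
  finally show ?thesis by (rule var_diff_cancel[rotated]) simp
qed

lemma explicit_morphism_even:
  assumes E: "is_mf {1..n} w E"
  shows "explicit_morphism n E \<in> even_homs (vars_e n) (dual_box_self E) (diag_kernel n w)"
proof -
  let ?c = "explicit_morphism n E"
  let ?P = "\<lambda>J. ordered_product (mf_basis E) (diff_quots E) J n"
  note E' = is_mfD[OF E]
  have D0: "mf_diff E c b \<noteq> 0" if "diff_quots E i c b \<noteq> 0" for i c b using that by auto
  have nz: "J \<subseteq> {1..n} \<and> a \<in> mf_basis E \<and> b \<in> mf_basis E \<and> odd (card J) = (mf_odd E a \<noteq> mf_odd E b)"
    if "?c J (a, b) \<noteq> 0" for J a b
  proof -
    from that have J: "J \<subseteq> {1..n}" and P: "?P J a b \<noteq> 0"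
      by (auto simp: explicit_morphism_def split: if_splits)
    have "a \<in> mf_basis E \<and> b \<in> mf_basis E"
      using ordered_product_supported[OF _ P] E'(5) D0 by blast
    moreover have "(mf_odd E a \<noteq> mf_odd E b) = odd (card {j \<in> J. j < Suc n})"
      by (rule ordered_product_parity[OF _ _ P]) (use J E'(7) D0 in auto)
    moreover have "{j \<in> J. j < Suc n} = J" using J by auto
    ultimately show ?thesis using J by simp
  qed
  have ser: "?c J (a, b) \<in> series (vars_e n)" for J a b
  proof (cases "J \<subseteq> {1..n}")
    case True
    have "?P J a b \<in> series (vars_e n)"
      by (rule ordered_product_series, rule series_difference_quot) (use True E'(4) in auto)
    then show ?thesis using True by (auto simp: explicit_morphism_def intro!: series_mult series_sign)
  next
    case False
    then show ?thesis by (auto simp: explicit_morphism_def)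
  qed
  have nz': "J \<in> mf_basis (diag_kernel n w) \<and> q \<in> mf_basis (dual_box_self E)
      \<and> mf_odd (diag_kernel n w) J = mf_odd (dual_box_self E) q" if "?c J q \<noteq> 0" for J q
    using nz[of J "fst q" "snd q"] that
    by (cases q) (simp add: diag_kernel_simps dual_box_self_simps)
  moreover have "?c J q \<in> series (vars_e n)" for J q
    using ser by (cases q) simp
  ultimately show ?thesis unfolding even_homs_def homs_def by blast
qed

text \<open>At (a, b) and J, composition with either differential carries the common factor
  \<open>s a * s a ^ card J\<close>. The dual factor of the box contributes \<delta>(x) to the left
  of the product, the other one \<delta>(y) to its right, so \<open>ordered_product_commute\<close>
  is the remaining identity.\<close>

lemma explicit_morphism_closed:
  assumes w: "w \<in> series {1..n}" and E: "is_mf {1..n} w E"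
  shows "explicit_morphism n E \<in> closed_homs (vars_e n) (dual_box_self E) (diag_kernel n w)"
proof -
  let ?c = "explicit_morphism n E" and ?X = "dual_box_self E" and ?Y = "diag_kernel n w"
  let ?V = "vars_e n" and ?B = "mf_basis E"
  let ?P = "\<lambda>J. ordered_product (mf_basis E) (diff_quots E) J n"
  let ?u = "\<lambda>i. mps_var (Inr i) - mps_var (Inl i)"
  note ev = explicit_morphism_even[OF E] and E' = is_mfD[OF E]
  have c: "?c \<in> homs ?V ?X ?Y" using ev by (simp add: even_homs_def)
  have X: "mf_diff ?X \<in> homs ?V ?X ?X" by (rule is_mfD(3)[OF is_mf_dual_box_self[OF E]])
  have Y: "mf_diff ?Y \<in> homs ?V ?Y ?Y" by (rule is_mfD(3)[OF is_mf_diag_kernel[OF w]])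
  have dc: "hom_diff ?X ?Y ?c \<in> homs ?V ?X ?Y"
    unfolding hom_diff_even[OF ev] by (intro homs_diff mat_mult_homs[OF Y c] mat_mult_homs[OF c X])
  have "hom_diff ?X ?Y ?c J (a, b) = 0" for J a b
  proof (cases "J \<subseteq> {1..n} \<and> a \<in> ?B \<and> b \<in> ?B")
    case False
    then have "\<not> (J \<in> mf_basis ?Y \<and> (a, b) \<in> mf_basis ?X)"
      by (auto simp: diag_kernel_simps dual_box_self_simps)
    then show ?thesis using dc unfolding homs_def by blast
  next
    case True
    then have J: "J \<subseteq> {1..n}" and ab: "a \<in> ?B" "b \<in> ?B" by auto
    have finJ: "finite J" using J finite_subset by blast
    define s where "s a = (parity_sign (mf_odd E a) :: (nat + nat, 'a) mps)" for a
    have s2: "s a * s a = 1" for a by (simp add: s_def)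
    have c_eq: "?c K (a, b) = s a ^ card K * ?P K a b" if "K \<subseteq> {1..n}" for K a b
      using that by (simp add: explicit_morphism_def s_def)
    \<comment> \<open>\<open>s a\<close> squares to 1, so adding and removing an index have the same
      effect on the power.\<close>
    have sflip: "s a ^ card (flip i J) = s a * s a ^ card J" for i
    proof (cases "i \<in> J")
      case True
      then have "card J = Suc (card (J - {i}))" using finJ by (metis card_Suc_Diff1)
      then have "s a * s a ^ card J = s a ^ card (J - {i})"
        by (simp only: power_Suc mult.assoc[symmetric] s2 mult_1_left)
      with True show ?thesis by (simp add: flip_def)
    next
      case False
      then show ?thesis using finJ by (simp add: flip_def)
    qed
    have "mat_mult (mf_basis ?Y) (mf_diff ?Y) ?c J (a, b)
        = (\<Sum>i=1..n. koszul_sign i J * ((if i \<in> J then difference_quot i w else ?u i) * ?c (flip i J) (a, b)))"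
      unfolding diag_kernel_row[OF J] koszul_op_def ..
    also have "\<dots> = s a * s a ^ card J *
        (\<Sum>i=1..n. koszul_sign i J * ((if i \<in> J then difference_quot i w else ?u i) * ?P (flip i J) a b))"
      unfolding sum_distrib_left
    proof (rule sum.cong[OF refl])
      fix i assume "i \<in> {1..n}"
      then have "?c (flip i J) (a, b) = s a * s a ^ card J * ?P (flip i J) a b"
        using J c_eq sflip by (simp add: flip_subset)
      then show "koszul_sign i J * ((if i \<in> J then difference_quot i w else ?u i) * ?c (flip i J) (a, b))
        = s a * s a ^ card J * (koszul_sign i J * ((if i \<in> J then difference_quot i w else ?u i) * ?P (flip i J) a b))"
        by (simp only: mult.left_commute mult.assoc)
    qed
    finally have L: "mat_mult (mf_basis ?Y) (mf_diff ?Y) ?c J (a, b) = s a * s a ^ card J *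
        (\<Sum>i=1..n. koszul_sign i J * ((if i \<in> J then difference_quot i w else ?u i) * ?P (flip i J) a b))" .
    have "mat_mult (mf_basis ?X) ?c (mf_diff ?X) J (a, b)
        = (\<Sum>a'\<in>?B. ?c J (a', b) * in_x (- parity_sign (mf_odd E a) * mf_diff E a a'))
          + s a * (\<Sum>b'\<in>?B. ?c J (a, b') * in_y (mf_diff E b' b))"
      unfolding mat_mult_def dual_box_self_def
      by (subst tensor_column) (use E'(1) ab in \<open>simp_all add: mf_map_def mf_dual_def s_def\<close>)
    also have "(\<Sum>a'\<in>?B. ?c J (a', b) * in_x (- parity_sign (mf_odd E a) * mf_diff E a a'))
        = - (s a * s a ^ card J * ((- 1) ^ card J * mat_mult ?B (\<lambda>c b. in_x (mf_diff E c b)) (?P J) a b))"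
      unfolding mat_mult_def sum_distrib_left sum_negf[symmetric]
    proof (rule sum.cong[OF refl])
      fix a'
      show "?c J (a', b) * in_x (- parity_sign (mf_odd E a) * mf_diff E a a')
        = - (s a * s a ^ card J * ((- 1) ^ card J * (in_x (mf_diff E a a') * ?P J a' b)))"
      proof (cases "mf_diff E a a' = 0")
        case False
        \<comment> \<open>This turns \<open>s a' ^ card J\<close> into (-1)^|J| times
          \<open>s a ^ card J\<close>, the sign of moving \<delta> past |J| odd operators.\<close>
        then have "s a' = - s a" using E'(7)[of a a'] by (simp add: s_def)
        then have "?c J (a', b) = s a ^ card J * ((- 1) ^ card J * ?P J a' b)"
          using c_eq[OF J] by (simp add: power_minus[of "s a"] mult.left_commute)
        moreover have "in_x (- parity_sign (mf_odd E a) * mf_diff E a a') = - (s a * in_x (mf_diff E a a'))"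
          by (simp add: s_def in_x.hom_uminus)
        ultimately show ?thesis by (simp add: algebra_simps)
      qed simp
    qed
    also have "(\<Sum>b'\<in>?B. ?c J (a, b') * in_y (mf_diff E b' b))
        = s a ^ card J * mat_mult ?B (?P J) (\<lambda>c b. in_y (mf_diff E c b)) a b"
      unfolding mat_mult_def sum_distrib_left c_eq[OF J] mult.assoc ..
    finally have R: "mat_mult (mf_basis ?X) ?c (mf_diff ?X) J (a, b) = s a * s a ^ card J *
        (mat_mult ?B (?P J) (\<lambda>c b. in_y (mf_diff E c b)) a b
          - (- 1) ^ card J * mat_mult ?B (\<lambda>c b. in_x (mf_diff E c b)) (?P J) a b)"
      by (simp add: algebra_simps)
    \<comment> \<open>Taken at m = n, so that \<open>in_xy\<close> starts with all variables y at
      index 1 and ends with all variables x at index n + 1.\<close>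
    have "mat_mult ?B (?P J) (\<lambda>c b. in_xy 1 (mf_diff E c b)) a b =
        koszul_sign (Suc n) J * mat_mult ?B (\<lambda>c b. in_xy (Suc n) (mf_diff E c b)) (?P J) a b +
        (\<Sum>i=1..n. koszul_sign i J * ((if i \<in> J then difference_quot i w else ?u i) * ?P (flip i J) a b))"
    proof (rule ordered_product_commute[where \<delta> = "\<lambda>i c b. in_xy i (mf_diff E c b)"])
      show "c \<in> ?B \<and> b \<in> ?B" if "in_xy i (mf_diff E c b) \<noteq> 0" for i c b
      proof -
        have "mf_diff E c b \<noteq> 0" using that by auto
        then show ?thesis using E'(5,6) by blast
      qed
      show "c \<in> ?B" if "diff_quots E i c b \<noteq> 0" for i c b
      proof -
        have "mf_diff E c b \<noteq> 0" using that by auto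
        then show ?thesis using E'(5) by blast
      qed
      show "in_xy i (mf_diff E c b) = in_xy (Suc i) (mf_diff E c b) + ?u i * diff_quots E i c b" for i c b
        by (simp add: difference_quot_mult)
    qed (use J E'(1) diff_quots_anticommute[OF E] in auto)
    moreover have "koszul_sign (Suc n) J = ((- 1) ^ card J :: (nat + nat, 'a) mps)"
    proof -
      have "{j \<in> J. j < Suc n} = J" using J by auto
      then show ?thesis by (simp add: koszul_sign_def)
    qed
    ultimately have "mat_mult ?B (?P J) (\<lambda>c b. in_y (mf_diff E c b)) a b
        - (- 1) ^ card J * mat_mult ?B (\<lambda>c b. in_x (mf_diff E c b)) (?P J) a b
      = (\<Sum>i=1..n. koszul_sign i J * ((if i \<in> J then difference_quot i w else ?u i) * ?P (flip i J) a b))"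
      by (simp only: in_xy_1[OF E'(4)] in_xy_Suc[OF E'(4)]) simp
    then show ?thesis unfolding hom_diff_even[OF ev] L R by simp
  qed
  then have "hom_diff ?X ?Y ?c = (\<lambda>_ _. 0)" by (auto simp: fun_eq_iff)
  with c show ?thesis by (simp add: closed_homs_def)
qed

lemma explicit_morphism_eval:
  assumes "q \<in> mf_basis (dual_box_self E)"
  shows "diagonal (explicit_morphism n E {} q) = (if fst q = snd q then 1 else 0)"
proof -
  have "ordered_product (mf_basis E) (diff_quots E) {} m = (\<lambda>c b. if c = b \<and> b \<in> mf_basis E then 1 else 0)" for m
    by (induction m) simp_all
  then show ?thesis using assms by (auto simp: explicit_morphism_def dual_box_self_simps)
qed

section \<open>The Jacobian ideal\<close>

lemma jacobian_idealI:
  "f = (\<Sum>i\<in>V. g i * mps_deriv i v) \<Longrightarrow> \<forall>i\<in>V. g i \<in> series V \<Longrightarrow> f \<in> jacobian_ideal V v"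
  unfolding jacobian_ideal_def by (rule CollectI, rule exI, rule conjI)

lemma jacobian_ideal_zero: "0 \<in> jacobian_ideal V v"
  unfolding jacobian_ideal_def by (rule CollectI, rule exI[of _ "\<lambda>_. 0"]) simp

lemma jacobian_ideal_add:
  assumes "f \<in> jacobian_ideal V v" "g \<in> jacobian_ideal V v"
  shows "f + g \<in> jacobian_ideal V v"
proof -
  from assms obtain a b where a: "f = (\<Sum>i\<in>V. a i * mps_deriv i v)" "\<forall>i\<in>V. a i \<in> series V"
    and b: "g = (\<Sum>i\<in>V. b i * mps_deriv i v)" "\<forall>i\<in>V. b i \<in> series V"
    unfolding jacobian_ideal_def by blast
  then have "f + g = (\<Sum>i\<in>V. (a i + b i) * mps_deriv i v)" "\<forall>i\<in>V. a i + b i \<in> series V"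
    by (simp_all add: distrib_right sum.distrib series_add)
  then show ?thesis by (rule jacobian_idealI)
qed

lemma jacobian_ideal_mult:
  assumes "f \<in> jacobian_ideal V v" "r \<in> series V"
  shows "r * f \<in> jacobian_ideal V v"
proof -
  from assms(1) obtain a where a: "f = (\<Sum>i\<in>V. a i * mps_deriv i v)" "\<forall>i\<in>V. a i \<in> series V"
    unfolding jacobian_ideal_def by blast
  then have "r * f = (\<Sum>i\<in>V. (r * a i) * mps_deriv i v)" "\<forall>i\<in>V. r * a i \<in> series V"
    using assms(2) by (simp_all add: sum_distrib_left mult.assoc series_mult)
  then show ?thesis by (rule jacobian_idealI)
qed

lemma jacobian_ideal_uminus: "f \<in> jacobian_ideal V v \<Longrightarrow> - f \<in> jacobian_ideal V v"
  using jacobian_ideal_mult[of f V v "- 1"] by (simp add: series_uminus)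

lemma jacobian_ideal_sum:
  "(\<And>a. a \<in> A \<Longrightarrow> f a \<in> jacobian_ideal V v) \<Longrightarrow> sum f A \<in> jacobian_ideal V v"
  by (induction A rule: infinite_finite_induct) (auto intro: jacobian_ideal_zero jacobian_ideal_add)

lemma jacobian_ideal_deriv:
  assumes "finite V" "i \<in> V"
  shows "mps_deriv i v \<in> jacobian_ideal V v"
proof -
  have "mps_deriv i v = (\<Sum>j\<in>V. (if j = i then 1 else 0) * mps_deriv j v)"
    using assms by (simp add: if_distrib[of "\<lambda>x. x * _"] cong: if_cong)
  moreover have "\<forall>j\<in>V. (if j = i then 1 else 0) \<in> series V" by simp
  ultimately show ?thesis by (rule jacobian_idealI)
qed

lemma H_class_cong:
  assumes "f - g \<in> jacobian_ideal V v"
  shows "H_class V v f = H_class V v g"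
proof -
  have "h - f \<in> jacobian_ideal V v \<longleftrightarrow> h - g \<in> jacobian_ideal V v" for h
    using jacobian_ideal_add[OF _ assms, of "h - f"]
      jacobian_ideal_add[OF _ jacobian_ideal_uminus[OF assms], of "h - g"] by auto
  then show ?thesis by (simp add: H_class_def)
qed

section \<open>The trace pairing\<close>

definition graph_restrict :: "(nat \<Rightarrow> 'a) \<Rightarrow> (nat + nat, 'a::comm_ring_1) mps \<Rightarrow> (nat, 'a) mps" where
  "graph_restrict t f = diagonal (scale_y t f)"

interpretation graph_restrict: unital_ring_hom "graph_restrict t" for t
  unfolding graph_restrict_def
  using hom_compose[OF scale_y.unital_ring_hom_axioms[of t] diagonal.unital_ring_hom_axioms]
  by (simp add: comp_def)

lemma series_graph_restrict:
  "f \<in> series (vars_e n) \<Longrightarrow> graph_restrict t f \<in> series {1..n}"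
  unfolding graph_restrict_def by (intro series_diagonal series_scale_y)

text \<open>The J-coefficient of the trace of c on the element of the box given by \<beta>, as in
  \<open>boundary_bulk\<close>. It is additive in c and in \<beta>, so changes of the two
  representatives can be treated separately.\<close>

definition box_pairing ::
    "(nat \<Rightarrow> 'a) \<Rightarrow> ('b, nat, 'a) mf \<Rightarrow> (nat set \<Rightarrow> 'b \<times> 'b \<Rightarrow> (nat + nat, 'a) mps) \<Rightarrow>
      ('b \<Rightarrow> 'b \<Rightarrow> (nat, 'a) mps) \<Rightarrow> nat set \<Rightarrow> (nat, 'a::comm_ring_1) mps" where
  "box_pairing t E c \<beta> J =
    (\<Sum>q\<in>mf_basis (dual_box_self E). graph_restrict t (c J q) * hom_to_box E \<beta> q)"

lemma box_pairing_add_left: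
  "box_pairing t E (\<lambda>J q. c J q + d J q) \<beta> J = box_pairing t E c \<beta> J + box_pairing t E d \<beta> J"
  by (simp add: box_pairing_def graph_restrict.hom_add distrib_right sum.distrib)

lemma box_pairing_add_right:
  "box_pairing t E c (\<lambda>d b. \<beta> d b + \<gamma> d b) J = box_pairing t E c \<beta> J + box_pairing t E c \<gamma> J"
  by (simp add: box_pairing_def hom_to_box_def case_prod_unfold distrib_left sum.distrib)

lemma series_box_pairing:
  assumes "c \<in> homs (vars_e n) (dual_box_self E) Y" "\<And>d b. \<beta> d b \<in> series {1..n}"
  shows "box_pairing t E c \<beta> J \<in> series {1..n}"
proof -
  have "c J q \<in> series (vars_e n)" for q
    by (cases q) (use assms(1) in \<open>simp add: homs_def\<close>)
  moreover have "hom_to_box E \<beta> q \<in> series {1..n}" for q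
    using assms(2) by (cases q) (auto simp: hom_to_box_def intro: series_uminus)
  ultimately show ?thesis
    unfolding box_pairing_def by (intro series_sum series_mult series_graph_restrict)
qed

text \<open>Restriction to the graph leaves the dual factor alone and twists the other one, so the
  box becomes the tensor product whose elements are morphisms from E to its twist.\<close>

lemma graph_restrict_box:
  "graph_restrict t (mf_diff (dual_box_self E) q q')
    = mf_diff (mf_tensor (mf_dual E) (mf_map (scale t) E)) q q'"
  by (cases q; cases q')
    (simp add: dual_box_self_def mf_tensor_def mf_map_def mf_dual_def graph_restrict.hom_add
      graph_restrict.hom_uminus in_x.hom_uminus graph_restrict_def[of t "in_x _"]
      graph_restrict_def[of t "in_y _"])

text \<open>Nonzero entries of \<delta> join opposite parities. With this relation the signs from
  the dual, the tensor product and \<open>hom_to_box\<close> combine to the common sign (-1)^(|a|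
  |b|) at (a, b), times the sign in \<open>hom_diff\<close>.\<close>

lemma box_diff_hom_to_box:
  assumes E: "is_mf V w E" and q: "q \<in> mf_basis (dual_box_self E)"
  shows "(\<Sum>q'\<in>mf_basis (dual_box_self E).
      graph_restrict t (mf_diff (dual_box_self E) q q') * hom_to_box E \<beta> q')
    = hom_to_box E (hom_diff E (mf_map (scale t) E) \<beta>) q"
proof -
  note E' = is_mfD[OF E]
  obtain a b where q_eq: "q = (a, b)" by (cases q)
  with q have ab: "a \<in> mf_basis E" "b \<in> mf_basis E" by (simp_all add: dual_box_self_simps)
  let ?s = "\<lambda>p. parity_sign p :: (nat, 'a) mps" and ?o = "mf_odd E"
  let ?T = "mf_tensor (mf_dual E) (mf_map (scale t) E)"
  have basis: "mf_basis (dual_box_self E) = mf_basis ?T"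
    by (simp add: dual_box_self_def mf_tensor_def mf_map_def)
  have fin: "finite (mf_basis (mf_dual E))" "finite (mf_basis (mf_map (scale t) E))"
    "a \<in> mf_basis (mf_dual E)" "b \<in> mf_basis (mf_map (scale t) E)"
    using E'(1) ab by (simp_all add: mf_dual_def mf_map_def)
  have "(\<Sum>q'\<in>mf_basis (dual_box_self E).
      graph_restrict t (mf_diff (dual_box_self E) q q') * hom_to_box E \<beta> q')
    = (\<Sum>a'\<in>mf_basis E. - ?s (?o a') * mf_diff E a' a * (?s (?o a' \<and> ?o b) * \<beta> b a')) +
      ?s (?o a) * (\<Sum>b'\<in>mf_basis E. scale t (mf_diff E b b') * (?s (?o a \<and> ?o b') * \<beta> b' a))"
    unfolding graph_restrict_box basis q_eq tensor_row[OF fin]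
    by (simp add: mf_dual_def mf_map_def hom_to_box_def)
  also have "(\<Sum>a'\<in>mf_basis E. - ?s (?o a') * mf_diff E a' a * (?s (?o a' \<and> ?o b) * \<beta> b a'))
    = ?s (?o a \<and> ?o b) * - (\<Sum>a'\<in>mf_basis E. ?s (?o b \<noteq> ?o a') * \<beta> b a' * mf_diff E a' a)"
    unfolding sum_negf[symmetric] sum_distrib_left
  proof (rule sum.cong[OF refl])
    fix a'
    show "- ?s (?o a') * mf_diff E a' a * (?s (?o a' \<and> ?o b) * \<beta> b a')
      = ?s (?o a \<and> ?o b) * - (?s (?o b \<noteq> ?o a') * \<beta> b a' * mf_diff E a' a)"
      using E'(7)[of a' a] by (cases "mf_diff E a' a = 0") (auto simp: mult.commute)
  qed
  also have "?s (?o a) * (\<Sum>b'\<in>mf_basis E. scale t (mf_diff E b b') * (?s (?o a \<and> ?o b') * \<beta> b' a))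
    = ?s (?o a \<and> ?o b) * (\<Sum>b'\<in>mf_basis E. scale t (mf_diff E b b') * \<beta> b' a)"
    unfolding sum_distrib_left
  proof (rule sum.cong[OF refl])
    fix b'
    show "?s (?o a) * (scale t (mf_diff E b b') * (?s (?o a \<and> ?o b') * \<beta> b' a))
      = ?s (?o a \<and> ?o b) * (scale t (mf_diff E b b') * \<beta> b' a)"
      using E'(7)[of b b'] by (cases "mf_diff E b b' = 0") auto
  qed
  finally show ?thesis
    by (simp add: q_eq hom_to_box_def hom_diff_def mat_mult_def mf_map_def algebra_simps)
qed

text \<open>Associativity moves the box differential from c to \<beta>. Together with
  \<open>box_pairing_diff_compose\<close> it says that a closed even c induces a chain map on
  traces.\<close>

lemma box_pairing_compose_diff:
  assumes E: "is_mf V w E"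
  shows "box_pairing t E (mat_mult (mf_basis (dual_box_self E)) c (mf_diff (dual_box_self E))) \<beta> J
    = box_pairing t E c (hom_diff E (mf_map (scale t) E) \<beta>) J"
proof -
  let ?X = "dual_box_self E"
  have "box_pairing t E (mat_mult (mf_basis ?X) c (mf_diff ?X)) \<beta> J
    = (\<Sum>q'\<in>mf_basis ?X. \<Sum>q\<in>mf_basis ?X. graph_restrict t (c J q) *
        (graph_restrict t (mf_diff ?X q q') * hom_to_box E \<beta> q'))"
    by (simp add: box_pairing_def mat_mult_def graph_restrict.hom_sum graph_restrict.hom_mult
        sum_distrib_right mult.assoc)
  also have "\<dots> = (\<Sum>q\<in>mf_basis ?X. graph_restrict t (c J q) *
      (\<Sum>q'\<in>mf_basis ?X. graph_restrict t (mf_diff ?X q q') * hom_to_box E \<beta> q'))"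
    by (subst sum.swap) (simp add: sum_distrib_left)
  also have "\<dots> = box_pairing t E c (hom_diff E (mf_map (scale t) E) \<beta>) J"
    unfolding box_pairing_def by (intro sum.cong refl) (simp add: box_diff_hom_to_box[OF E])
  finally show ?thesis .
qed

lemma box_pairing_diff_compose:
  "box_pairing t E (mat_mult B D c) \<beta> J = (\<Sum>K\<in>B. graph_restrict t (D J K) * box_pairing t E c \<beta> K)"
  by (simp add: box_pairing_def mat_mult_def graph_restrict.hom_sum graph_restrict.hom_mult
      sum_distrib_right sum_distrib_left mult.assoc) (rule sum.swap)

text \<open>After restriction to the fixed locus the contraction part of the Koszul differential
  vanishes, and its wedge part is multiplication by partial derivatives of \<open>w\<^sub>t\<close>.\<close>

lemma trace_boundary_jacobian:
  assumes w: "w \<in> series {1..n}" and t: "\<And>i. i \<in> {l+1..n} \<Longrightarrow> t i = 1"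
    and z: "\<And>K. K \<subseteq> {1..n} \<Longrightarrow> z K \<in> series {1..n}"
  shows "vanish l (\<Sum>K\<in>Pow {1..n}. graph_restrict t (mf_diff (diag_kernel n w) {l+1..n} K) * z K)
    \<in> jacobian_ideal {l+1..n} (vanish l w)"
proof -
  let ?J = "jacobian_ideal {l+1..n} (vanish l w)" and ?V = "{l+1..n}"
  have fixed: "vanish l (graph_restrict t f) = vanish l (diagonal f)" if "f \<in> series (vars_e n)" for f
    unfolding graph_restrict_def using that t by (rule vanish_scale_y)
  have entry: "vanish l (graph_restrict t (koszul_sign i ?V * (if i \<in> ?V then difference_quot i w
      else mps_var (Inr i) - mps_var (Inl i)))) \<in> ?J" if i: "i \<in> {1..n}" for i
  proof -
    \<comment> \<open>In row V an index of V enters through the wedge part, and an index outside V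
      through the contraction, whose coefficient vanishes on the diagonal.\<close>
    have val: "vanish l (graph_restrict t (if i \<in> ?V then difference_quot i w
        else mps_var (Inr i) - mps_var (Inl i)))
      = (if i \<in> ?V then mps_deriv i (vanish l w) else 0)"
      using fixed[OF series_difference_quot[OF i w]] fixed[OF series_koszul_var[OF i]]
      by (simp add: deriv_vanish)
    have "(if i \<in> ?V then mps_deriv i (vanish l w) else 0) \<in> ?J"
      by (simp add: jacobian_ideal_deriv jacobian_ideal_zero)
    then show ?thesis
      unfolding koszul_sign_def graph_restrict.hom_mult graph_restrict.hom_sign vanish.hom_mult
        vanish.hom_sign val
      by (rule jacobian_ideal_mult[OF _ series_sign])
  qed
  have "vanish l (graph_restrict t (mf_diff (diag_kernel n w) ?V K)) \<in> ?J" for K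
  proof (cases "K \<subseteq> {1..n}")
    case True
    have "vanish l (graph_restrict t (if ?V = flip i K then koszul_sign i ?V *
        (if i \<in> ?V then difference_quot i w else mps_var (Inr i) - mps_var (Inl i)) else 0)) \<in> ?J"
      if "i \<in> {1..n}" for i
    proof (cases "?V = flip i K")
      case True
      show ?thesis unfolding if_P[OF True] by (rule entry[OF that])
    next
      case False
      show ?thesis unfolding if_not_P[OF False] by (simp add: jacobian_ideal_zero)
    qed
    then show ?thesis
      unfolding diag_kernel_def koszul_entry if_P[OF True] graph_restrict.hom_sum vanish.hom_sum
      by (rule jacobian_ideal_sum)
  next
    case False
    then show ?thesis
      unfolding diag_kernel_def koszul_entry by (simp add: jacobian_ideal_zero)
  qed
  then show ?thesis
    unfolding vanish.hom_sum vanish.hom_mult mult.commute[of "vanish l (graph_restrict _ _)"]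
    using z by (intro jacobian_ideal_sum jacobian_ideal_mult series_vanish) auto
qed

text \<open>\<open>fold\<close> applies the index l + 1 first, hence innermost, in the order of
  \<open>ordered_product\<close>, which is still the identity at bound l. That identity is cut off
  to the basis, whence the assumption on \<alpha>.\<close>

lemma deriv_comp_eq:
  assumes E: "is_mf {1..n} w E" and "\<And>c b. \<alpha> c b \<noteq> 0 \<Longrightarrow> c \<in> mf_basis E" and "l \<le> n"
  shows "deriv_comp n l E \<alpha> = mat_mult (mf_basis E)
    (ordered_product (mf_basis E) (\<lambda>i c b. mps_deriv i (mf_diff E c b)) {l+1..n} n) \<alpha>"
proof -
  let ?P = "ordered_product (mf_basis E) (\<lambda>i c b. mps_deriv i (mf_diff E c b)) {l+1..n}"
  have P_l: "?P l = (\<lambda>c b. if c = b \<and> b \<in> mf_basis E then 1 else 0)"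
  proof -
    have "?P l = ordered_product (mf_basis E) (\<lambda>i c b. mps_deriv i (mf_diff E c b)) {} l"
      by (rule ordered_product_cong) auto
    also have "ordered_product (mf_basis E) (\<lambda>i c b. mps_deriv i (mf_diff E c b)) {} m
      = (\<lambda>c b. if c = b \<and> b \<in> mf_basis E then 1 else 0)" for m
      by (induction m) simp_all
    finally show ?thesis .
  qed
  have "fold (\<lambda>i. mat_mult (mf_basis E) (\<lambda>c b. mps_deriv i (mf_diff E c b))) [l+1..<m+1] \<alpha>
      = mat_mult (mf_basis E) (?P m) \<alpha>" if "l \<le> m" "m \<le> n" for m
    using that
  proof (induction m rule: dec_induct)
    case base
    show ?case unfolding P_l
      by (subst mat_mult_scalar_left) (use is_mfD(1)[OF E] assms(2) in auto)
  next
    case (step m)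
    then show ?case by (simp add: mat_mult_assoc)
  qed
  then show ?thesis using assms(3) by (simp add: deriv_comp_def)
qed

lemma box_pairing_explicit:
  assumes E: "is_mf {1..n} w E" and l: "l \<le> n" and t: "\<And>i. i \<in> {l+1..n} \<Longrightarrow> t i = 1"
    and \<alpha>: "\<And>c b. \<alpha> c b \<noteq> 0 \<Longrightarrow> c \<in> mf_basis E"
  shows "vanish l (box_pairing t E (explicit_morphism n E) \<alpha> {l+1..n})
    = supertrace E (\<lambda>c b. vanish l (deriv_comp n l E \<alpha> c b))"
proof -
  let ?B = "mf_basis E" and ?V = "{l+1..n}" and ?o = "mf_odd E"
  let ?s = "\<lambda>p. parity_sign p :: (nat, 'a) mps"
  let ?M = "ordered_product ?B (\<lambda>i c b. mps_deriv i (mf_diff E c b)) ?V n"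
  note E' = is_mfD[OF E]
  have V: "?V \<subseteq> {1..n}" by auto
  have D0: "mf_diff E c b \<noteq> 0" if "mps_deriv i (mf_diff E c b) \<noteq> 0" for i c b
    using that by auto
  have parity: "(?o a \<noteq> ?o b) = odd (card ?V)" if "?M a b \<noteq> 0" for a b
  proof -
    have "(?o a \<noteq> ?o b) = odd (card {j \<in> ?V. j < Suc n})"
      by (rule ordered_product_parity[OF _ _ that]) (use E'(7) D0 in auto)
    moreover have "{j \<in> ?V. j < Suc n} = ?V" by auto
    ultimately show ?thesis by (simp only:)
  qed
  have c: "vanish l (graph_restrict t (explicit_morphism n E ?V (a, b)))
      = vanish l (?s (?o a) ^ card ?V * ?M a b)" for a b
  proof -
    have "explicit_morphism n E ?V (a, b) \<in> series (vars_e n)"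
      using explicit_morphism_even[OF E] by (simp add: even_homs_def homs_def)
    moreover have "diagonal (explicit_morphism n E ?V (a, b)) = ?s (?o a) ^ card ?V * ?M a b"
      using V by (simp add: explicit_morphism_def diagonal.hom_mult diagonal.hom_sign
          ordered_product_hom[OF diagonal.unital_ring_hom_axioms])
    ultimately show ?thesis
      unfolding graph_restrict_def using vanish_scale_y[of _ n l t] t by metis
  qed
  \<comment> \<open>Since |a| + |b| and |V| agree modulo 2, the exponent |a| |V| + |a| |b| is
    congruent to the square of |a|, hence to |a|: only the supertrace sign remains.\<close>
  have sign: "?s (?o a) ^ card ?V * ?M a b * (?s (?o a \<and> ?o b) * \<alpha> b a)
      = ?s (?o a) * (?M a b * \<alpha> b a)" for a b
  proof (cases "?M a b = 0")
    case False
    then show ?thesis using parity[OF False]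
      by (cases "?o a"; cases "?o b"; cases "odd (card ?V)") simp_all
  qed simp
  have comp: "deriv_comp n l E \<alpha> = mat_mult ?B ?M \<alpha>"
    by (rule deriv_comp_eq[OF E _ l], erule \<alpha>)
  have "vanish l (box_pairing t E (explicit_morphism n E) \<alpha> ?V)
      = (\<Sum>a\<in>?B. \<Sum>b\<in>?B. vanish l (graph_restrict t (explicit_morphism n E ?V (a, b)))
          * vanish l (hom_to_box E \<alpha> (a, b)))"
    unfolding box_pairing_def dual_box_self_simps vanish.hom_sum vanish.hom_mult
    by (simp add: sum.cartesian_product)
  also have "\<dots> = (\<Sum>a\<in>?B. \<Sum>b\<in>?B. vanish l (?s (?o a) * (?M a b * \<alpha> b a)))"
    by (simp only: c vanish.hom_mult[symmetric] hom_to_box_def prod.case sign)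
  also have "\<dots> = supertrace E (\<lambda>c b. vanish l (deriv_comp n l E \<alpha> c b))"
    unfolding supertrace_def
  proof (rule sum.cong[OF refl])
    fix a
    have "(\<Sum>b\<in>?B. vanish l (?s (?o a) * (?M a b * \<alpha> b a)))
        = vanish l (?s (?o a)) * vanish l (\<Sum>b\<in>?B. ?M a b * \<alpha> b a)"
      by (simp only: vanish.hom_mult vanish.hom_sum sum_distrib_left)
    also have "(\<Sum>b\<in>?B. ?M a b * \<alpha> b a) = deriv_comp n l E \<alpha> a a"
      unfolding comp mat_mult_def ..
    also have "vanish l (?s (?o a)) = ?s (?o a)" by (simp add: vanish.hom_uminus)
    finally show "(\<Sum>b\<in>?B. vanish l (?s (?o a) * (?M a b * \<alpha> b a)))
        = ?s (?o a) * vanish l (deriv_comp n l E \<alpha> a a)" .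
  qed
  finally show ?thesis .
qed

theorem proposition3p13:
  fixes n l :: nat
    and w :: "(nat, 'k::field_char_0) mps"
    and t :: "nat \<Rightarrow> 'k"
    and E :: "('b, nat, 'k) mf"
    and \<alpha> :: "'b \<Rightarrow> 'b \<Rightarrow> (nat, 'k) mps"
  assumes "isolated_singularity {1..n} w"
    and "\<And>i. i \<in> {1..n} \<Longrightarrow> t i \<noteq> 0"
    and "scale t w = w"
    and "l \<le> n"
    and "\<And>i. i \<in> {1..l} \<Longrightarrow> t i \<noteq> 1"
    and "\<And>i. i \<in> {l+1..n} \<Longrightarrow> t i = 1"
    and "is_mf {1..n} w E"
    and "\<alpha> \<in> closed_homs {1..n} E (mf_map (scale t) E)"
  shows "trace_iso n l w
           (boundary_bulk n w t E (hom_class {1..n} E (mf_map (scale t) E) \<alpha>)) =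
         H_class {l+1..n} (vanish l w)
           (supertrace E (\<lambda>c b. vanish l (deriv_comp n l E \<alpha> c b)))"
proof -
  have w: "w \<in> series {1..n}" using assms(1) by (simp add: isolated_singularity_def)
  note l = assms(4) and t = assms(6) and E = assms(7) and \<alpha> = assms(8)
  let ?X = "dual_box_self E" and ?Y = "diag_kernel n w" and ?tE = "mf_map (scale t) E"
  let ?V = "{l+1..n}" and ?e = "vars_e n"
  let ?J = "jacobian_ideal ?V (vanish l w)"
  let ?str = "supertrace E (\<lambda>c b. vanish l (deriv_comp n l E \<alpha> c b))"
  \<comment> \<open>The coefficient at V of the Koszul differential restricted to the graph. Every
    change of representative will appear as a value of \<open>?T\<close>.\<close>
  let ?T = "\<lambda>z. \<Sum>K\<in>Pow {1..n}. graph_restrict t (mf_diff ?Y ?V K) * z K"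
  let ?Z = "boundary_bulk n w t E (hom_class {1..n} E ?tE \<alpha>)"
  let ?val = "\<lambda>c \<beta>. mat_apply (mf_basis ?X) (\<lambda>J q. diagonal (scale_y t (c J q))) (hom_to_box E \<beta>)"
  note X = is_mf_dual_box_self[OF E] and Y = is_mf_diag_kernel[OF w]
  note c0 = explicit_morphism_closed[OF w E] explicit_morphism_even[OF E]
  have canonical: "canonical_morphism n w E
      = {\<lambda>J q. explicit_morphism n E J q + hom_diff ?X ?Y h J q | h. h \<in> odd_homs ?e ?X ?Y}"
    by (rule canonical_morphism_eq[OF w E c0], erule explicit_morphism_eval)
  have \<alpha>V: "\<alpha> c b \<in> series {1..n}" and \<alpha>B: "\<alpha> c b \<noteq> 0 \<Longrightarrow> c \<in> mf_basis E" for c b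
    using \<alpha> by (auto simp: closed_homs_def homs_def mf_map_def)
  have val: "?val c \<beta> J = box_pairing t E c \<beta> J" for c \<beta> J
    by (simp add: mat_apply_def box_pairing_def graph_restrict_def)
  have T: "vanish l (?T z) \<in> ?J" if "\<And>K. K \<subseteq> {1..n} \<Longrightarrow> z K \<in> series {1..n}" for z
    by (rule trace_boundary_jacobian[OF w], erule t, erule that)
  have explicit: "vanish l (box_pairing t E (explicit_morphism n E) \<alpha> ?V) = ?str"
    by (rule box_pairing_explicit[OF E l], erule t, erule \<alpha>B)
  \<comment> \<open>Changing \<alpha> by a coboundary: the differential on g moves to c, and
    closedness of c replaces it by the Koszul differential.\<close>
  have comp_diff: "vanish l (box_pairing t E c (hom_diff E ?tE g) ?V) \<in> ?J"
    if c: "c \<in> closed_homs ?e ?X ?Y" "c \<in> even_homs ?e ?X ?Y" and g: "g \<in> homs {1..n} E ?tE" for c g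
  proof -
    have "mat_mult (mf_basis ?X) c (mf_diff ?X) = mat_mult (mf_basis ?Y) (mf_diff ?Y) c"
    proof (intro ext)
      fix J q
      have "hom_diff ?X ?Y c J q = 0" using c(1) by (simp add: closed_homs_def)
      then show "mat_mult (mf_basis ?X) c (mf_diff ?X) J q = mat_mult (mf_basis ?Y) (mf_diff ?Y) c J q"
        by (simp add: hom_diff_even[OF c(2)])
    qed
    then have "box_pairing t E c (hom_diff E ?tE g) ?V = ?T (box_pairing t E c g)"
      unfolding box_pairing_compose_diff[OF E, symmetric]
      by (simp only: box_pairing_diff_compose diag_kernel_simps)
    moreover have "c \<in> homs ?e ?X ?Y" using c(2) by (simp add: even_homs_def)
    then have "vanish l (?T (box_pairing t E c g)) \<in> ?J"
      by (rule T[OF series_box_pairing]) (use g in \<open>simp add: homs_def\<close>)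
    ultimately show ?thesis by simp
  qed
  \<comment> \<open>Changing c by a homotopy h: the summand with the box differential moves to
    \<alpha> and vanishes since \<alpha> is closed; the Koszul summand remains.\<close>
  have diff_comp: "vanish l (box_pairing t E (hom_diff ?X ?Y h) \<alpha> ?V) \<in> ?J"
    if h: "h \<in> odd_homs ?e ?X ?Y" for h
  proof -
    have "hom_diff E ?tE \<alpha> = (\<lambda>_ _. 0)" using \<alpha> by (simp add: closed_homs_def)
    then have "box_pairing t E (mat_mult (mf_basis ?X) h (mf_diff ?X)) \<alpha> ?V = 0"
      unfolding box_pairing_compose_diff[OF E] by (simp add: box_pairing_def hom_to_box_def case_prod_unfold)
    then have "box_pairing t E (hom_diff ?X ?Y h) \<alpha> ?V = ?T (box_pairing t E h \<alpha>)"
      unfolding hom_diff_odd[OF h] box_pairing_add_left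
      by (simp only: box_pairing_diff_compose diag_kernel_simps add_0_right)
    moreover have "h \<in> homs ?e ?X ?Y" using h by (simp add: odd_homs_def)
    then have "vanish l (?T (box_pairing t E h \<alpha>)) \<in> ?J"
      by (rule T[OF series_box_pairing]) (rule \<alpha>V)
    ultimately show ?thesis by simp
  qed
  \<comment> \<open>An element of \<open>?Z\<close> involves three choices: h for the canonical
    morphism, g for \<alpha>, and \<xi> for the cohomology class of the result.\<close>
  have "vanish l (\<eta> ?V) - ?str \<in> ?J" if \<eta>: "\<eta> \<in> ?Z" for \<eta>
  proof -
    from \<eta> obtain c \<beta> \<xi> where c: "c \<in> canonical_morphism n w E"
      and \<beta>: "\<beta> \<in> hom_class {1..n} E ?tE \<alpha>"
      and \<xi>: "\<xi> \<in> mf_elems {1..n} (trace_complex n w t)"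
      and \<eta>_eq: "\<eta> = (\<lambda>J. ?val c \<beta> J
        + mat_apply (mf_basis (trace_complex n w t)) (mf_diff (trace_complex n w t)) \<xi> J)"
      unfolding boundary_bulk_def coh_class_def by blast
    from c obtain h where h: "h \<in> odd_homs ?e ?X ?Y"
      and c_eq: "c = (\<lambda>J q. explicit_morphism n E J q + hom_diff ?X ?Y h J q)"
      unfolding canonical by blast
    from \<beta> obtain g where g: "g \<in> homs {1..n} E ?tE"
      and \<beta>_eq: "\<beta> = (\<lambda>d b. \<alpha> d b + hom_diff E ?tE g d b)"
      unfolding hom_class_def by blast
    note dh = hom_diff_closed[OF X Y h]
    have "c \<in> even_homs ?e ?X ?Y" unfolding c_eq by (rule even_homs_add[OF c0(2) dh(2)])
    moreover from this have "c \<in> closed_homs ?e ?X ?Y"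
      using c0(1) dh(1) by (simp add: closed_homs_def even_homs_def c_eq hom_diff_add)
    ultimately have J1: "vanish l (box_pairing t E c (hom_diff E ?tE g) ?V) \<in> ?J"
      using comp_diff g by blast
    have J2: "vanish l (box_pairing t E (hom_diff ?X ?Y h) \<alpha> ?V) \<in> ?J" by (rule diff_comp[OF h])
    have "\<xi> K \<in> series {1..n}" for K using \<xi> by (simp add: mf_elems_def)
    then have J3: "vanish l (?T \<xi>) \<in> ?J" by (rule T)
    have "mat_apply (mf_basis (trace_complex n w t)) (mf_diff (trace_complex n w t)) \<xi> ?V = ?T \<xi>"
      by (simp add: mat_apply_def trace_complex_def mf_map_def diag_kernel_simps graph_restrict_def)
    then have "\<eta> ?V = box_pairing t E (explicit_morphism n E) \<alpha> ?V
        + (box_pairing t E (hom_diff ?X ?Y h) \<alpha> ?V + box_pairing t E c (hom_diff E ?tE g) ?V + ?T \<xi>)"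
      unfolding \<eta>_eq val \<beta>_eq box_pairing_add_right
      by (simp only: c_eq box_pairing_add_left add.assoc)
    then have "vanish l (\<eta> ?V) - ?str
        = vanish l (box_pairing t E (hom_diff ?X ?Y h) \<alpha> ?V)
          + vanish l (box_pairing t E c (hom_diff E ?tE g) ?V) + vanish l (?T \<xi>)"
      by (simp only: vanish.hom_add explicit add_diff_cancel_left')
    then show ?thesis using J1 J2 J3 by (simp only: jacobian_ideal_add)
  qed
  then have H: "H_class ?V (vanish l w) (vanish l (\<eta> ?V)) = H_class ?V (vanish l w) ?str"
    if "\<eta> \<in> ?Z" for \<eta>
    using that by (intro H_class_cong) blast
  \<comment> \<open>\<open>trace_iso\<close> is a union over \<open>?Z\<close>, so agreement of all
    members yields the claim only for nonempty \<open>?Z\<close>.\<close>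
  have "?Z \<noteq> {}"
  proof -
    define c where "c J q = explicit_morphism n E J q + hom_diff ?X ?Y (\<lambda>_ _. 0) J q" for J q
    define \<beta> where "\<beta> d b = \<alpha> d b + hom_diff E ?tE (\<lambda>_ _. 0) d b" for d b
    have c: "c \<in> canonical_morphism n w E"
      unfolding canonical c_def[abs_def] using odd_homs_zero by blast
    have \<beta>: "\<beta> \<in> hom_class {1..n} E ?tE \<alpha>"
      unfolding hom_class_def \<beta>_def[abs_def] using homs_zero by blast
    have "(\<lambda>_. 0) \<in> mf_elems {1..n} (trace_complex n w t)" by (simp add: mf_elems_def)
    then have "coh_class {1..n} (trace_complex n w t) (?val c \<beta>) \<noteq> {}"
      unfolding coh_class_def by blast
    then obtain \<zeta> where "\<zeta> \<in> coh_class {1..n} (trace_complex n w t) (?val c \<beta>)" by blast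
    then have "\<zeta> \<in> ?Z"
      unfolding boundary_bulk_def by (intro UN_I[OF c] UN_I[OF \<beta>])
    then show ?thesis by blast
  qed
  then show ?thesis unfolding trace_iso_def using H by auto
qed

end
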